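(* Let $\Lambda\subset J^1(\mathbb R_{x_1})$ be a Legendrian (a union of circles in $\{x_1<0\}$ and arcs in $\{x_1\le 0\}$ with endpoints over $x_1=0$) satisfying the conditions for front spinning, and let $L\subset J^1(\mathbb R^2)$ be the front spin of $\Lambda$. Let $(\mathcal A_\Lambda,\partial_{\mathcal A_\Lambda})$ be the cellular DGA of $\Lambda$ for a cellular decomposition of $\pi_{x_1}(\Lambda)$, and let $(\mathcal A_L,\partial_{\mathcal A_L})$ be the cellular DGA of $L$ for the corresponding spun decomposition. (1) Suppose $\Lambda$ has no arc components. Then $(\mathcal A_L,\partial_{\mathcal A_L})$ is the suspension of $(\mathcal A_\Lambda,\partial_{\mathcal A_\Lambda})$. (2) Suppose $\Lambda$ has arc components whose front projections have distinct endpoints. Then $(\mathcal A_L,\partial_{\mathcal A_L})$ is the suspension of $(\mathcal A_\Lambda,\partial_{\mathcal A_\Lambda})$ relative to the sub-DGA associated to the $0$-cell $\{x_1=0=x_2\}$. (3) Suppose $\Lambda$ has arc components whose front projections have $r$ pairs of matching endpoints. Then $(\mathcal A_L,\partial_{\mathcal A_L})$ is the suspension of $(\mathcal A_\Lambda,\partial_{\mathcal A_\Lambda})$ relative to the sub-DGA associated to the $0$-cell $\{x_1=0=x_2\}$, with the following modification: if $A$ is the matrix of generators above the $0$-cell $\{x_1=0=x_2\}$, then $\Gamma(A)=0$ is replaced with $\Gamma(A)=U-I$, where $U=U_rU_{r-1}\cdots U_1$ and, if the matching endpoints join the pairs of sheets $(k_1,k_1+1),\dots,(k_r,k_r+1)$,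 $$U_p=I+\sum_{\ell<k_p}a_{\ell,k_p+1}E_{\ell,k_p}+\sum_{k_p+1<\ell}a_{k_p,\ell}E_{k_p+1,\ell}.$$
   Context: Suspension. Let $(\mathcal A,\partial_{\mathcal A})$ be a DGA over $\mathbb Z/2$ freely generated by $a_1,\dots,a_k$. Its suspension $(\hat{\mathcal A},\partial_{\hat{\mathcal A}})$ is freely generated by $a_i,\hat a_i$ with $|\hat a_i|=|a_i|+1$, $\partial_{\hat{\mathcal A}}a_i=\partial_{\mathcal A}a_i$ and $\partial_{\hat{\mathcal A}}\hat a_i=\Gamma(\partial_{\mathcal A}a_i)$, where $\Gamma:\mathcal A\to\hat{\mathcal A}$ is the derivation (over the inclusion) with $\Gamma(a_i)=\hat a_i$. If $\mathcal L\subset\mathcal A$ is a sub-DGA generated by a subset of the generators, the suspension relative to $\mathcal L$ is defined in the same way but with $\Gamma(l)=\hat l=0$ (no hatted generators) for $l\in\mathcal L$. Front spinning. $J^1(\mathbb R_{x_1})$ has contact form $dz-y_1dx_1$ and front projection to $\mathbb R^2_{x_1,z}$. $\Lambda$ is a Legendrian embedding of finitely many circles in $\{x_1<0\}$ and finitely many arcs in $\{x_1\le0\}$ whose front endpoints lie on the $z$-axis, such that the fronts of the arcs together with their reflections through the $z$-axis glue to form the front of a collection of smooth Legendrian circles; no three arcs have fronts with the same endpoint. Away from $x_1=0$ the front has generic cusps and crossings. The front spin $L\subset J^1(\mathbb R^2_{x_1,x_2})$ is the Legendrian surface whose front is obtained by rotating the front of $\Lambda$, placed in $\{x_2=0\}$,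 about the $z$-axis. A pair of arcs with the same front endpoint on $\{x_1=0\}$ produces a cone point of $L$ (front locally diffeomorphic to $x_1^2+x_2^2=z^2$). Sheets and gradings. Above a cell $e$, sheets are the components of $\pi^{-1}(e)\cap\Lambda$ (resp. $\cap L$) that are not cusps, partially ordered by $S_p\prec S_q$ iff $z(S_p)>z(S_q)$. A Maslov potential $\mu$ on $L$ is a locally constant $\mathbb Z/m(L)$-valued function on the complement of cusps, increasing by $1$ from the lower to the upper sheet at each cusp, and with $\mu(S_k)=\mu(S_{k+1})+1$ for sheets $S_k,S_{k+1}$ joined at a cone point. Here $m(L)$ is the smallest positive value, on generic loops in $L$, of the number of downward minus upward cusp edge crossings (counted after replacing cone points by a generic perturbation), or $0$ if all are zero. Gradings of $\mathcal A_\Lambda$ use the restriction of $\mu$ to $\Lambda\subset L$. Cellular DGA of $\Lambda$. Choose a decomposition of $\pi_{x_1}(\Lambda)\subset\mathbb R_{x_1}$ into $0$- and $1$-cells with all cusps and crossings above $0$-cells, and with $\{x_1=0\}$ a $0$-cell if $\Lambda$ has arcs. $\mathcal A_\Lambda$ is the free unital $\mathbb Z/2$-algebra with a generator $a_{p,q}$ ($0$-cells) or $b_{p,q}$ ($1$-cells) for each pair $S_p\prec S_q$ above the cell, $|a_{p,q}|=\mu(S_p)-\mu(S_q)-1$, $|b_{p,q}|=\mu(S_p)-\mu(S_q)$. After extending $\prec$ to a total order, arrange them in matrices $A,B$ (zero entries for pairs not related by $\prec$). Then $\partial A=A^2$ and $\partial B=A_+(I+B)+(I+B)A_-$, where $A_\pm$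 is the matrix of generators of the terminal/initial $0$-cell of the $1$-cell, ordered by the sheets of the $1$-cell, with a block $N=\begin{pmatrix}0&1\\0&0\end{pmatrix}$ inserted on the diagonal for two consecutive sheets meeting at a cusp over the $0$-cell. For the $0$-cell $\{x_1=0\}$ with matching endpoints, the sheets are labeled $1,\dots,n$ as the sheets near $x_1=0$, the matching pairs are $(k_p,k_p+1)$, and the $(k_p,k_p+1)$ entries of $A$ are $0$. $1$-cells are oriented in the direction of decreasing $x_1$ (increasing $r=-x_1$). Spun decomposition and cellular DGA of $L$. Each cell $e$ of $\pi_{x_1}(\Lambda)$ other than $\{x_1=0\}$ gives two cells of $\pi_x(L)\subset\mathbb R^2$: $e$ itself in $\{x_2=0\}$, and $\hat e$ obtained by rotating $e$ about the origin (a circle minus a point, or an annular/disk region cut along the radial cell $e$). If present, $\{x_1=0\}$ gives only the $0$-cell $\{x_1=x_2=0\}$. All $1$-cells are oriented in the positive polar coordinate direction. Generators: $a_{p,q},b_{p,q},c_{p,q}$ for $0$-,$1$-,$2$-cells and $S_p\prec S_q$ above the cell (excluding the pairs $(k_p,k_p+1)$ joined by cone points above the origin), with $|a_{p,q}|=\mu(S_p)-\mu(S_q)-1$, $|b_{p,q}|=\mu(S_p)-\mu(S_q)$, $|c_{p,q}|=\mu(S_p)-\mu(S_q)+1$; the generators of $\hat e$ correspond to the hats of the generators of $e$. Differentials: for each $0$-cell of $L$ with matrix of generators $A$, $\partial A=A^2$; for each $1$-cell of $L$ with matrix of generators $B$, $\partial B=A_+(I+B)+(I+B)A_-$, where $A_\pm$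 is the matrix of generators of the terminal/initial $0$-cell of the $1$-cell, ordered by the sheets of $L$ over the $1$-cell, with a block $N$ inserted on the diagonal for two consecutive sheets meeting at a cusp over the $0$-cell (in $A$ and $B$ a total order extending $\prec$ is used, with zero entries for pairs that have no generator); and for the $2$-cell $\{t_m<r<t_{m+1}\}$ with initial vertex $v_m=(t_m,-\pi)$ and terminal vertex $v_{m+1}=(t_{m+1},\pi)$ in polar coordinates $(r,\theta)$, $\partial C=A_{v_{m+1}}C+CA_{v_m}+(I+B_{\{r=t_{m+1}\}})(I+B_{\{\theta=-\pi\}})+(I+B_{\{\theta=\pi\}})(I+B_{\{r=t_m\}})$, where all matrices are ordered by the sheets over the $2$-cell with a diagonal block $N$ (vertices) or $0$ (edges) inserted for consecutive sheets that cusp there, and $B_{\{\theta=-\pi\}}=B_{\{\theta=\pi\}}$. If $t_m=0$, the factor $I+B_{\{r=0\}}$ is $I$ when there are no cone points over the origin, and is the matrix $U$ of the claim when there are (the cone point modification of the cellular DGA). $E_{i,j}$ denotes the elementary matrix. *)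

theory Defs
  imports
    "HOL-Analysis.Analysis"
    "HOL-Library.Poly_Mapping"
    "HOL-Library.Z2"
    "HOL-Number_Theory.Cong"
begin

section \<open>Free algebras over Z/2, derivations, suspensions\<close>

text \<open>
  The free unital (non-commutative) Z/2-algebra on \<open>'g\<close> is the monoid algebra of the free monoid
  on \<open>'g\<close>. Lists are wrapped in a new type so that concatenation can be the
  addition of the class \<^class>\<open>monoid_add\<close>, from which \<^type>\<open>poly_mapping\<close> builds the
  convolution product.
\<close>

datatype 'g fword = FWord (letters: "'g list")

instantiation fword :: (type) monoid_add
begin

definition zero_fword :: "'a fword" where
  "zero_fword = FWord []"

definition plus_fword :: "'a fword \<Rightarrow> 'a fword \<Rightarrow> 'a fword" where
  "plus_fword v w = FWord (letters v @ letters w)"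

instance
  by standard (auto simp: zero_fword_def plus_fword_def)

end

type_synonym 'g falg = "'g fword \<Rightarrow>\<^sub>0 bit"

definition var :: "'g \<Rightarrow> 'g falg" where
  "var g = Poly_Mapping.single (FWord [g]) 1"

text \<open>
  Over Z/2 an element is the sum of the words in its support, so that no coefficients occur in
  the two extension principles below: \<open>subst f\<close> is the unital algebra homomorphism with
  \<open>var g \<mapsto> f g\<close>, and \<open>derivation f d\<close> is the derivation over \<open>subst f\<close> with
  \<open>var g \<mapsto> d g\<close>.
\<close>

definition subst :: "('g \<Rightarrow> 'h falg) \<Rightarrow> 'g falg \<Rightarrow> 'h falg" where
  "subst f x = (\<Sum>w\<in>Poly_Mapping.keys x. prod_list (map f (letters w)))"

primrec word_derivation :: "('g \<Rightarrow> 'h falg) \<Rightarrow> ('g \<Rightarrow> 'h falg) \<Rightarrow> 'g list \<Rightarrow> 'h falg" where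
  "word_derivation f d [] = 0"
| "word_derivation f d (g # w) = d g * prod_list (map f w) + f g * word_derivation f d w"

definition derivation :: "('g \<Rightarrow> 'h falg) \<Rightarrow> ('g \<Rightarrow> 'h falg) \<Rightarrow> 'g falg \<Rightarrow> 'h falg" where
  "derivation f d x = (\<Sum>w\<in>Poly_Mapping.keys x. word_derivation f d (letters w))"

text \<open>
  A freely generated DGA, given by its generators with their degrees and differentials. Degrees in
  Z/m are represented by integers and compared modulo \<open>m\<close>.
\<close>

record 'g fdga =
  gens :: "'g set"
  degr :: "'g \<Rightarrow> int"
  dgen :: "'g \<Rightarrow> 'g falg"

definition falg_carrier :: "'g fdga \<Rightarrow> 'g falg set" where
  "falg_carrier D = {x. \<forall>w\<in>Poly_Mapping.keys x. set (letters w) \<subseteq> gens D}"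

definition differential :: "'g fdga \<Rightarrow> 'g falg \<Rightarrow> 'g falg" where
  "differential D = derivation var (dgen D)"

text \<open>The bijection \<open>h\<close> of generators induces an isomorphism of DGAs graded by Z/m.\<close>

definition fdga_iso :: "nat \<Rightarrow> ('g \<Rightarrow> 'h) \<Rightarrow> 'g fdga \<Rightarrow> 'h fdga \<Rightarrow> bool" where
  "fdga_iso m h D D' \<longleftrightarrow>
     bij_betw h (gens D) (gens D') \<and>
     (\<forall>g\<in>gens D. [degr D' (h g) = degr D g] (mod int m)) \<and>
     (\<forall>x\<in>falg_carrier D.
        subst (\<lambda>g. var (h g)) (differential D x) = differential D' (subst (\<lambda>g. var (h g)) x))"

datatype 'g susp = Base 'g | Hat 'g

definition base_incl :: "'g falg \<Rightarrow> 'g susp falg" where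
  "base_incl = subst (\<lambda>g. var (Base g))"

text \<open>
  The suspension in which the generators in \<open>R\<close> get no hatted companion and \<open>\<Gamma>(g) = \<gamma>(g)\<close> for
  \<open>g \<in> R\<close>.
\<close>

definition Gamma :: "'g set \<Rightarrow> ('g \<Rightarrow> 'g susp falg) \<Rightarrow> 'g falg \<Rightarrow> 'g susp falg" where
  "Gamma R \<gamma> =
     derivation (\<lambda>g. var (Base g)) (\<lambda>g. if g \<in> R then \<gamma> g else var (Hat g))"

definition modified_suspension ::
    "'g set \<Rightarrow> ('g \<Rightarrow> 'g susp falg) \<Rightarrow> 'g fdga \<Rightarrow> 'g susp fdga" where
  "modified_suspension R \<gamma> D =
     \<lparr>gens = Base ` gens D \<union> Hat ` (gens D - R),
      degr = (\<lambda>s. case s of Base g \<Rightarrow> degr D g | Hat g \<Rightarrow> degr D g + 1),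
      dgen = (\<lambda>s. case s of Base g \<Rightarrow> base_incl (dgen D g) | Hat g \<Rightarrow> Gamma R \<gamma> (dgen D g))\<rparr>"

definition relative_suspension :: "'g set \<Rightarrow> 'g fdga \<Rightarrow> 'g susp fdga" where
  "relative_suspension R = modified_suspension R (\<lambda>_. 0)"

definition suspension :: "'g fdga \<Rightarrow> 'g susp fdga" where
  "suspension = relative_suspension {}"


section \<open>One-jet spaces and fronts\<close>

text \<open>
  Points of the 1-jet spaces are triples \<open>(x, y, z)\<close>. The plane is identified with \<^typ>\<open>complex\<close>,
  so that \<open>(x, y, z)\<close> in \<open>J\<^sup>1(\<real>\<^sup>2)\<close> stands for
  \<open>x = x\<^sub>1 + \<i> x\<^sub>2\<close>, \<open>y = y\<^sub>1 + \<i> y\<^sub>2\<close>.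
\<close>

type_synonym jet1 = "real \<times> real \<times> real"
type_synonym jet2 = "complex \<times> complex \<times> real"

definition zc :: "'a \<times> 'b \<times> real \<Rightarrow> real" where
  "zc p = snd (snd p)"

definition front :: "'a \<times> 'b \<times> real \<Rightarrow> 'a \<times> real" where
  "front p = (fst p, zc p)"

text \<open>
  The points over the origin whose front point is the front of another point as well: the matching
  endpoints of arcs when \<open>X \<subseteq> J\<^sup>1(\<real>)\<close>, and the circles lying over the cone
  points when \<open>X \<subseteq> J\<^sup>1(\<real>\<^sup>2)\<close> is a front spin.
\<close>

definition doubled :: "('a::zero \<times> 'b \<times> real) set \<Rightarrow> ('a \<times> 'b \<times> real) set" where
  "doubled X = {p\<in>X. fst p = 0 \<and> (\<exists>q\<in>X. q \<noteq> p \<and> front q = front p)}"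


section \<open>Legendrians in the 1-jet space of the line that can be front spun\<close>

definition smooth :: "(real \<Rightarrow> real) \<Rightarrow> bool" where
  "smooth f \<longleftrightarrow> (\<forall>n t. (deriv ^^ n) f differentiable at t)"

abbreviation xcurve :: "(real \<Rightarrow> jet1) \<Rightarrow> real \<Rightarrow> real" where
  "xcurve \<gamma> \<equiv> \<lambda>t. fst (\<gamma> t)"

abbreviation ycurve :: "(real \<Rightarrow> jet1) \<Rightarrow> real \<Rightarrow> real" where
  "ycurve \<gamma> \<equiv> \<lambda>t. fst (snd (\<gamma> t))"

abbreviation zcurve :: "(real \<Rightarrow> jet1) \<Rightarrow> real \<Rightarrow> real" where
  "zcurve \<gamma> \<equiv> \<lambda>t. snd (snd (\<gamma> t))"

definition legendrian_on :: "real set \<Rightarrow> (real \<Rightarrow> jet1) \<Rightarrow> bool" where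
  "legendrian_on I \<gamma> \<longleftrightarrow>
     smooth (xcurve \<gamma>) \<and> smooth (ycurve \<gamma>) \<and> smooth (zcurve \<gamma>) \<and>
     (\<forall>t\<in>I. deriv (zcurve \<gamma>) t = ycurve \<gamma> t * deriv (xcurve \<gamma>) t) \<and>
     (\<forall>t\<in>I. deriv (xcurve \<gamma>) t \<noteq> 0 \<or> deriv (ycurve \<gamma>) t \<noteq> 0)"

text \<open>
  Circles are parametrised with period 1. Arcs are the restrictions to \<open>[0,1]\<close> of smooth curves;
  outside \<open>[0,1]\<close> nothing but smoothness is required.
\<close>

definition legendrian_circle :: "(real \<Rightarrow> jet1) \<Rightarrow> bool" where
  "legendrian_circle \<gamma> \<longleftrightarrow>
     legendrian_on UNIV \<gamma> \<and> (\<forall>t. \<gamma> (t + 1) = \<gamma> t) \<and> inj_on \<gamma> {0..<1}"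

definition legendrian_arc :: "(real \<Rightarrow> jet1) \<Rightarrow> bool" where
  "legendrian_arc \<gamma> \<longleftrightarrow> legendrian_on {0..1} \<gamma> \<and> inj_on \<gamma> {0..1}"

text \<open>\<open>C\<close> and \<open>A\<close> are the finite sets of parametrisations of the circles and of the arcs.\<close>

definition link :: "(real \<Rightarrow> jet1) set \<Rightarrow> (real \<Rightarrow> jet1) set \<Rightarrow> jet1 set" where
  "link C A = (\<Union>\<gamma>\<in>C \<union> A. \<gamma> ` {0..1})"

text \<open>Since \<open>z' = y x'\<close>, the front fails to be immersed exactly where \<open>x' = 0\<close>.\<close>

definition cusps :: "(real \<Rightarrow> jet1) set \<Rightarrow> (real \<Rightarrow> jet1) set \<Rightarrow> jet1 set" where
  "cusps C A = (\<Union>\<gamma>\<in>C \<union> A. \<gamma> ` {t\<in>{0..1}. deriv (xcurve \<gamma>) t = 0})"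

definition pairwise_disjoint_images :: "(real \<Rightarrow> jet1) set \<Rightarrow> bool" where
  "pairwise_disjoint_images K \<longleftrightarrow> pairwise (\<lambda>\<gamma> \<delta>. disjnt (\<gamma> ` {0..1}) (\<delta> ` {0..1})) K"

text \<open>The contact lift of the reflection of the front through the z-axis.\<close>

definition reflect :: "jet1 \<Rightarrow> jet1" where
  "reflect p = (- fst p, - fst (snd p), zc p)"

text \<open>
  Genericity: the cusps are semicubical (for a Legendrian immersion \<open>x'' \<noteq> 0\<close> suffices, because
  \<open>y' \<noteq> 0\<close> where \<open>x' = 0\<close>), no other point has the same front as a cusp, and there are no
  triple points. Double points of the front of an embedded Legendrian away from cusps are
  automatically transverse.
\<close>

definition generic_front :: "(real \<Rightarrow> jet1) set \<Rightarrow> (real \<Rightarrow> jet1) set \<Rightarrow> bool" where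
  "generic_front C A \<longleftrightarrow>
     (\<forall>\<gamma>\<in>C \<union> A. \<forall>t\<in>{0..1}. xcurve \<gamma> t < 0 \<and> deriv (xcurve \<gamma>) t = 0 \<longrightarrow>
        deriv (deriv (xcurve \<gamma>)) t \<noteq> 0) \<and>
     (\<forall>p\<in>cusps C A. \<forall>q\<in>link C A. fst p < 0 \<and> front q = front p \<longrightarrow> q = p) \<and>
     (\<forall>p\<in>link C A. fst p < 0 \<longrightarrow> card {q\<in>link C A. front q = front p} \<le> 2 \<and>
        finite {q\<in>link C A. front q = front p})"

text \<open>
  The existential condition on \<open>K\<close> says that the arcs and their reflections glue to a collection of
  smooth embedded Legendrian circles. The front is immersed at the ends of the arcs, so that
  matching ends produce cone points.
\<close>

definition front_spinnable :: "(real \<Rightarrow> jet1) set \<Rightarrow> (real \<Rightarrow> jet1) set \<Rightarrow> bool" where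
  "front_spinnable C A \<longleftrightarrow>
     finite C \<and> finite A \<and> C \<inter> A = {} \<and> pairwise_disjoint_images (C \<union> A) \<and>
     (\<forall>\<gamma>\<in>C. legendrian_circle \<gamma> \<and> (\<forall>t. xcurve \<gamma> t < 0)) \<and>
     (\<forall>\<gamma>\<in>A. legendrian_arc \<gamma> \<and> xcurve \<gamma> 0 = 0 \<and> xcurve \<gamma> 1 = 0 \<and>
        (\<forall>t\<in>{0<..<1}. xcurve \<gamma> t < 0) \<and>
        deriv (xcurve \<gamma>) 0 \<noteq> 0 \<and> deriv (xcurve \<gamma>) 1 \<noteq> 0) \<and>
     (\<exists>K. finite K \<and> (\<forall>\<delta>\<in>K. legendrian_circle \<delta>) \<and> pairwise_disjoint_images K \<and>
        link K {} = link {} A \<union> reflect ` link {} A) \<and>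
     (\<forall>p\<in>link {} A. fst p = 0 \<longrightarrow> card {q\<in>link {} A. front q = front p} \<le> 2) \<and>
     generic_front C A"


section \<open>Front spinning, Maslov potentials\<close>

text \<open>
  Rotation about the z-axis lifts to the contactomorphism \<open>(x, y, z) \<mapsto> (e\<^sup>i\<^sup>\<theta> x, e\<^sup>i\<^sup>\<theta> y, z)\<close>,
  so the Legendrian surface with the rotated front is the orbit of the curve placed in
  \<open>{x\<^sub>2 = y\<^sub>2 = 0}\<close>.
\<close>

definition spin :: "real set \<Rightarrow> jet1 set \<Rightarrow> jet2 set" where
  "spin \<Theta> S = {(cis \<theta> * of_real x, cis \<theta> * of_real y, z) | \<theta> x y z. \<theta> \<in> \<Theta> \<and> (x, y, z) \<in> S}"

definition front_spin :: "(real \<Rightarrow> jet1) set \<Rightarrow> (real \<Rightarrow> jet1) set \<Rightarrow> jet2 set" where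
  "front_spin C A = spin UNIV (link C A)"

text \<open>
  Away from the origin the rotated front \<open>(e\<^sup>i\<^sup>\<theta> x(t), z(t))\<close> fails to be immersed exactly where
  \<open>x'(t) = 0\<close>.
\<close>

definition cusp_edges :: "(real \<Rightarrow> jet1) set \<Rightarrow> (real \<Rightarrow> jet1) set \<Rightarrow> jet2 set" where
  "cusp_edges C A = spin UNIV (cusps C A)"

text \<open>
  \<open>on_upper X c e p\<close>: near the front point of \<open>c\<close> the point \<open>p\<close> has a partner on a lower sheet.
  Near a cusp edge, and near a cone point, the front has exactly two sheets. Neighbourhoods are
  taken in the front because the two sheets at a cone point have opposite covectors over
  the same base point.
\<close>

definition on_upper :: "jet2 set \<Rightarrow> jet2 \<Rightarrow> real \<Rightarrow> jet2 \<Rightarrow> bool" where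
  "on_upper X c e p \<longleftrightarrow>
     (\<exists>q\<in>X. fst q = fst p \<and> zc q < zc p \<and> dist (front q) (front c) < e)"

definition on_lower :: "jet2 set \<Rightarrow> jet2 \<Rightarrow> real \<Rightarrow> jet2 \<Rightarrow> bool" where
  "on_lower X c e p \<longleftrightarrow>
     (\<exists>q\<in>X. fst q = fst p \<and> zc p < zc q \<and> dist (front q) (front c) < e)"

definition crosses_down :: "jet2 set \<Rightarrow> (real \<Rightarrow> jet2) \<Rightarrow> real \<Rightarrow> bool" where
  "crosses_down X g t \<longleftrightarrow>
     (\<forall>e>0. (\<forall>\<^sub>F s in at_left t. on_upper X (g t) e (g s)) \<and>
            (\<forall>\<^sub>F s in at_right t. on_lower X (g t) e (g s)))"

definition crosses_up :: "jet2 set \<Rightarrow> (real \<Rightarrow> jet2) \<Rightarrow> real \<Rightarrow> bool" where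
  "crosses_up X g t \<longleftrightarrow>
     (\<forall>e>0. (\<forall>\<^sub>F s in at_left t. on_lower X (g t) e (g s)) \<and>
            (\<forall>\<^sub>F s in at_right t. on_upper X (g t) e (g s)))"

text \<open>
  \<open>Z\<close> consists of the cusp edges and of the circles over cone points. After a generic perturbation
  of a cone point a path from its upper to its lower sheet has (algebraically) one downward cusp
  edge crossing, so passing through such a circle is counted like a cusp edge crossing.
\<close>

definition generic_loop :: "jet2 set \<Rightarrow> jet2 set \<Rightarrow> (real \<Rightarrow> jet2) \<Rightarrow> bool" where
  "generic_loop X Z g \<longleftrightarrow>
     path g \<and> path_image g \<subseteq> X \<and> pathfinish g = pathstart g \<and> pathstart g \<notin> Z \<and>
     finite {t\<in>{0..1}. g t \<in> Z} \<and>
     (\<forall>t\<in>{0..1}. g t \<in> Z \<longrightarrow> crosses_down X g t \<or> crosses_up X g t)"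

definition cusp_count :: "jet2 set \<Rightarrow> jet2 set \<Rightarrow> (real \<Rightarrow> jet2) \<Rightarrow> int" where
  "cusp_count X Z g =
     int (card {t\<in>{0..1}. g t \<in> Z \<and> crosses_down X g t}) -
     int (card {t\<in>{0..1}. g t \<in> Z \<and> crosses_up X g t})"

definition maslov_number :: "jet2 set \<Rightarrow> jet2 set \<Rightarrow> nat" where
  "maslov_number X Z =
     (if \<exists>g. generic_loop X Z g \<and> cusp_count X Z g > 0
      then LEAST m. m > 0 \<and> (\<exists>g. generic_loop X Z g \<and> cusp_count X Z g = int m)
      else 0)"

definition maslov_potential :: "nat \<Rightarrow> jet2 set \<Rightarrow> jet2 set \<Rightarrow> (jet2 \<Rightarrow> int) \<Rightarrow> bool" where
  "maslov_potential m X Z \<mu> \<longleftrightarrow>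
     (\<forall>p\<in>X - Z. \<exists>e>0. \<forall>q\<in>X - Z. dist p q < e \<longrightarrow> [\<mu> q = \<mu> p] (mod int m)) \<and>
     (\<forall>c\<in>Z. \<exists>e>0. \<forall>p\<in>X - Z. \<forall>q\<in>X - Z.
        dist (front p) (front c) < e \<and> dist (front q) (front c) < e \<and>
        fst p = fst q \<and> zc q < zc p \<longrightarrow> [\<mu> p = \<mu> q + 1] (mod int m))"

definition surface_singular_set :: "(real \<Rightarrow> jet1) set \<Rightarrow> (real \<Rightarrow> jet1) set \<Rightarrow> jet2 set" where
  "surface_singular_set C A = cusp_edges C A \<union> doubled (front_spin C A)"

definition surface_maslov_number :: "(real \<Rightarrow> jet1) set \<Rightarrow> (real \<Rightarrow> jet1) set \<Rightarrow> nat" where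
  "surface_maslov_number C A = maslov_number (front_spin C A) (surface_singular_set C A)"


section \<open>Cells and sheets\<close>

datatype cell = Vertex real | Edge real real

datatype spun_cell = Radial cell | Rotated cell

primrec cell_dim :: "cell \<Rightarrow> int" where
  "cell_dim (Vertex v) = 0"
| "cell_dim (Edge u v) = 1"

primrec spun_cell_dim :: "spun_cell \<Rightarrow> int" where
  "spun_cell_dim (Radial c) = cell_dim c"
| "spun_cell_dim (Rotated c) = cell_dim c + 1"

primrec cell_locus :: "cell \<Rightarrow> real set" where
  "cell_locus (Vertex v) = {v}"
| "cell_locus (Edge u v) = {u<..<v}"

primrec spun_cell_locus :: "spun_cell \<Rightarrow> complex set" where
  "spun_cell_locus (Radial c) = of_real ` cell_locus c"
| "spun_cell_locus (Rotated c) =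
     {cis \<theta> * of_real x | \<theta> x. \<theta> \<in> {0<..<2 * pi} \<and> x \<in> cell_locus c}"

text \<open>A decomposition is given by its set \<open>V\<close> of 0-cells, which determines the 1-cells.\<close>

definition cells_of :: "(real \<Rightarrow> jet1) set \<Rightarrow> (real \<Rightarrow> jet1) set \<Rightarrow> real set \<Rightarrow> cell set" where
  "cells_of C A V =
     Vertex ` V \<union>
     {Edge u v | u v. u \<in> V \<and> v \<in> V \<and> u < v \<and> {u<..<v} \<inter> V = {} \<and>
        {u<..<v} \<subseteq> fst ` link C A}"

definition spun_cells_of ::
    "(real \<Rightarrow> jet1) set \<Rightarrow> (real \<Rightarrow> jet1) set \<Rightarrow> real set \<Rightarrow> spun_cell set" where
  "spun_cells_of C A V = Radial ` cells_of C A V \<union> Rotated ` (cells_of C A V - {Vertex 0})"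

definition cell_decomposition ::
    "(real \<Rightarrow> jet1) set \<Rightarrow> (real \<Rightarrow> jet1) set \<Rightarrow> real set \<Rightarrow> bool" where
  "cell_decomposition C A V \<longleftrightarrow>
     finite V \<and> (\<Union>c\<in>cells_of C A V. cell_locus c) = fst ` link C A \<and>
     fst ` cusps C A \<subseteq> V \<and>
     (\<forall>p\<in>link C A. \<forall>q\<in>link C A. p \<noteq> q \<and> front p = front q \<longrightarrow> fst p \<in> V) \<and>
     (A \<noteq> {} \<longrightarrow> 0 \<in> V)"

definition sheets_above ::
    "('a::topological_space \<times> 'b::topological_space \<times> real) set \<Rightarrow>
     ('a \<times> 'b \<times> real) set \<Rightarrow> 'a set \<Rightarrow> ('a \<times> 'b \<times> real) set set" where
  "sheets_above X K c = {S \<in> components (X \<inter> fst -` c). S \<inter> K = {}}"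

text \<open>The relation \<open>S \<prec> T\<close>, for sheets above the same cell.\<close>

definition z_above :: "('a \<times> 'b \<times> real) set \<Rightarrow> ('a \<times> 'b \<times> real) set \<Rightarrow> bool" where
  "z_above S T \<longleftrightarrow> (\<forall>p\<in>S. \<forall>q\<in>T. fst p = fst q \<longrightarrow> zc q < zc p)"

definition joined ::
    "('a::{zero,topological_space} \<times> 'b::topological_space \<times> real) set \<Rightarrow>
     ('a \<times> 'b \<times> real) set \<Rightarrow> bool" where
  "joined S T \<longleftrightarrow> (\<exists>p\<in>closure S. \<exists>q\<in>closure T. fst p = 0 \<and> front p = front q)"

record ('c, 'p) sheeted_complex =
  cells :: "'c set"
  sheets :: "'c \<Rightarrow> 'p set set"
  prec :: "'c \<Rightarrow> 'p set \<Rightarrow> 'p set \<Rightarrow> bool"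
  cusps_over :: "'c \<Rightarrow> 'p set"

text \<open>
  In the presence of matching endpoints (cone points), the sheets above the 0-cell at the origin are
  the sheets near the origin, i.e. those above the punctured neighbourhood bounded by the next
  0-cell (circle), and the pairs joined there are not related by \<open>\<prec>\<close>.
\<close>

definition next_vertex :: "real set \<Rightarrow> real" where
  "next_vertex V = Max {v\<in>V. v < 0}"

definition link_complex ::
    "(real \<Rightarrow> jet1) set \<Rightarrow> (real \<Rightarrow> jet1) set \<Rightarrow> real set \<Rightarrow> (cell, jet1) sheeted_complex" where
  "link_complex C A V =
     \<lparr>cells = cells_of C A V,
      sheets = (\<lambda>c. sheets_above (link C A) (cusps C A)
        (if c = Vertex 0 \<and> doubled (link C A) \<noteq> {} then {next_vertex V<..<0}
         else cell_locus c)),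
      prec = (\<lambda>c S T. z_above S T \<and> \<not> (c = Vertex 0 \<and> joined S T)),
      cusps_over = (\<lambda>c. {p\<in>cusps C A. fst p \<in> cell_locus c})\<rparr>"

definition surface_complex ::
    "(real \<Rightarrow> jet1) set \<Rightarrow> (real \<Rightarrow> jet1) set \<Rightarrow> real set \<Rightarrow>
     (spun_cell, jet2) sheeted_complex" where
  "surface_complex C A V =
     \<lparr>cells = spun_cells_of C A V,
      sheets = (\<lambda>c. sheets_above (front_spin C A) (cusp_edges C A)
        (if c = Radial (Vertex 0) \<and> doubled (front_spin C A) \<noteq> {}
         then {w. 0 < cmod w \<and> cmod w < - next_vertex V}
         else spun_cell_locus c)),
      prec = (\<lambda>c S T. z_above S T \<and> \<not> (c = Radial (Vertex 0) \<and> joined S T)),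
      cusps_over = (\<lambda>c. {p\<in>cusp_edges C A. fst p \<in> spun_cell_locus c})\<rparr>"


section \<open>Cellular DGAs\<close>

text \<open>
  Matrices are indexed by sheets. The formulas involve only sums, products and
  entrywise definitions, so no total order extending \<open>\<prec>\<close> has to be chosen.
\<close>

type_synonym ('s, 'r) smat = "'s \<Rightarrow> 's \<Rightarrow> 'r"

definition mat_mul :: "'s set \<Rightarrow> ('s, 'r::semiring_0) smat \<Rightarrow> ('s, 'r) smat \<Rightarrow> ('s, 'r) smat" where
  "mat_mul I M N = (\<lambda>p q. \<Sum>r\<in>I. M p r * N r q)"

definition mat_add :: "('s, 'r::semiring_0) smat \<Rightarrow> ('s, 'r) smat \<Rightarrow> ('s, 'r) smat" where
  "mat_add M N = (\<lambda>p q. M p q + N p q)"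

definition mat_id :: "('s, 'r::semiring_1) smat" where
  "mat_id = (\<lambda>p q. if p = q then 1 else 0)"

type_synonym ('c, 'p) generator = "'c \<times> 'p set \<times> 'p set"

definition generators :: "('c, 'p) sheeted_complex \<Rightarrow> ('c, 'p) generator set" where
  "generators X =
     {(c, S, T). c \<in> cells X \<and> S \<in> sheets X c \<and> T \<in> sheets X c \<and> prec X c S T}"

definition gen_mat ::
    "('c, 'p) sheeted_complex \<Rightarrow> 'c \<Rightarrow> ('p set, ('c, 'p) generator falg) smat" where
  "gen_mat X c = (\<lambda>S T. if (c, S, T) \<in> generators X then var (c, S, T) else 0)"

text \<open>
  \<open>T\<close> is the sheet above a face that is the end of the sheet \<open>S\<close>. The second alternative is needed
  only for the origin when its sheets are taken to be the sheets near the origin.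
\<close>

definition ends_in :: "'p::topological_space set \<Rightarrow> 'p set \<Rightarrow> bool" where
  "ends_in S T \<longleftrightarrow> T \<subseteq> closure S \<or> S \<subseteq> T"

text \<open>
  The matrix \<open>M\<close> over the face \<open>d\<close>, with rows and columns ordered by the sheets above a cell that
  has \<open>d\<close> in its boundary: since \<open>S\<close> and \<open>S'\<close> end in at most one sheet above \<open>d\<close> each, there is
  at most one summand. Rows and columns of sheets that end in a cusp are 0; for vertices the
  blocks N are added to this by \<open>vertex_mat\<close>.
\<close>

definition pull_mat ::
    "('c, 'p::topological_space) sheeted_complex \<Rightarrow> 'c \<Rightarrow> ('p set, 'r::comm_monoid_add) smat \<Rightarrow>
     ('p set, 'r) smat" where
  "pull_mat X d M = (\<lambda>S S'.
     \<Sum>T\<in>{T\<in>sheets X d. ends_in S T}. \<Sum>T'\<in>{T'\<in>sheets X d. ends_in S' T'}. M T T')"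

definition edge_mat ::
    "('c, 'p::topological_space) sheeted_complex \<Rightarrow> 'c \<Rightarrow>
     ('p set, ('c, 'p) generator falg) smat" where
  "edge_mat X d = pull_mat X d (gen_mat X d)"

definition vertex_mat ::
    "('c, 'p::topological_space) sheeted_complex \<Rightarrow> 'c \<Rightarrow> 'c \<Rightarrow>
     ('p set, ('c, 'p) generator falg) smat" where
  "vertex_mat X c d = mat_add (pull_mat X d (gen_mat X d))
     (\<lambda>S S'. if prec X c S S' \<and> closure S \<inter> closure S' \<inter> cusps_over X d \<noteq> {} then 1 else 0)"

definition diff_0cell ::
    "('c, 'p::topological_space) sheeted_complex \<Rightarrow> 'c \<Rightarrow>
     ('p set, ('c, 'p) generator falg) smat" where
  "diff_0cell X c = mat_mul (sheets X c) (gen_mat X c) (gen_mat X c)"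

text \<open>The arguments after the 1-cell \<open>c\<close> are its initial and terminal 0-cells.\<close>

definition diff_1cell ::
    "('c, 'p::topological_space) sheeted_complex \<Rightarrow> 'c \<Rightarrow> 'c \<Rightarrow> 'c \<Rightarrow>
     ('p set, ('c, 'p) generator falg) smat" where
  "diff_1cell X c v\<^sub>0 v\<^sub>1 =
     mat_add (mat_mul (sheets X c) (vertex_mat X c v\<^sub>1) (mat_add mat_id (gen_mat X c)))
             (mat_mul (sheets X c) (mat_add mat_id (gen_mat X c)) (vertex_mat X c v\<^sub>0))"

text \<open>
  The 2-cell \<open>c = {t\<^sub>m < r < t\<^sub>m\<^sub>+\<^sub>1}\<close> with initial and terminal vertices \<open>v\<^sub>0\<close>, \<open>v\<^sub>1\<close>, outer edge
  \<open>r = t\<^sub>m\<^sub>+\<^sub>1\<close> and radial edge \<open>\<theta> = \<plusminus> \<pi>\<close>; \<open>W\<close> is the factor \<open>I + B\<close> of the inner edge \<open>r = t\<^sub>m\<close>.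
\<close>

definition diff_2cell ::
    "('c, 'p::topological_space) sheeted_complex \<Rightarrow> 'c \<Rightarrow> 'c \<Rightarrow> 'c \<Rightarrow> 'c \<Rightarrow> 'c \<Rightarrow>
     ('p set, ('c, 'p) generator falg) smat \<Rightarrow> ('p set, ('c, 'p) generator falg) smat" where
  "diff_2cell X c v\<^sub>0 v\<^sub>1 outer radial W =
     mat_add
       (mat_add (mat_mul (sheets X c) (vertex_mat X c v\<^sub>1) (gen_mat X c))
                (mat_mul (sheets X c) (gen_mat X c) (vertex_mat X c v\<^sub>0)))
       (mat_add (mat_mul (sheets X c) (mat_add mat_id (edge_mat X outer))
                                      (mat_add mat_id (edge_mat X radial)))
                (mat_mul (sheets X c) (mat_add mat_id (edge_mat X radial)) W))"

text \<open>
  The pairs \<open>(k\<^sub>p, k\<^sub>p + 1)\<close> of sheets joined over the origin, and for an enumeration \<open>ks\<close> of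
  them the product \<open>U\<^sub>r \<dots> U\<^sub>1\<close>. The sheets near the origin are labelled by the order
  \<^const>\<open>z_above\<close>, so \<open>\<ell> < k\<close> reads \<open>z_above \<ell> k\<close>.
\<close>

definition joined_pairs ::
    "('c, 'a::{zero,topological_space} \<times> 'b::topological_space \<times> real) sheeted_complex \<Rightarrow> 'c \<Rightarrow>
     (('a \<times> 'b \<times> real) set \<times> ('a \<times> 'b \<times> real) set) set" where
  "joined_pairs X d = {(S, T). S \<in> sheets X d \<and> T \<in> sheets X d \<and> z_above S T \<and> joined S T}"

definition U_factor ::
    "('c, 'a \<times> 'b \<times> real) sheeted_complex \<Rightarrow> 'c \<Rightarrow>
     ('a \<times> 'b \<times> real) set \<times> ('a \<times> 'b \<times> real) set \<Rightarrow>
     (('a \<times> 'b \<times> real) set, ('c, 'a \<times> 'b \<times> real) generator falg) smat" where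
  "U_factor X d = (\<lambda>(k, k') S T.
     mat_id S T +
     (if T = k \<and> z_above S k then gen_mat X d S k' else 0) +
     (if S = k' \<and> z_above k' T then gen_mat X d k T else 0))"

definition U_mat ::
    "('c, 'a \<times> 'b \<times> real) sheeted_complex \<Rightarrow> 'c \<Rightarrow>
     (('a \<times> 'b \<times> real) set \<times> ('a \<times> 'b \<times> real) set) list \<Rightarrow>
     (('a \<times> 'b \<times> real) set, ('c, 'a \<times> 'b \<times> real) generator falg) smat" where
  "U_mat X d ks = foldl (\<lambda>M k. mat_mul (sheets X d) (U_factor X d k) M) mat_id ks"

text \<open>
  1-cells are oriented by decreasing \<open>x\<^sub>1\<close>: the edge \<open>{u<..<v}\<close> runs from \<open>v\<close> to \<open>u\<close>.
\<close>

definition sheet_maslov :: "('p \<Rightarrow> int) \<Rightarrow> 'p set \<Rightarrow> int" where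
  "sheet_maslov \<mu> S = \<mu> (SOME p. p \<in> S)"

definition link_dga ::
    "(real \<Rightarrow> jet1) set \<Rightarrow> (real \<Rightarrow> jet1) set \<Rightarrow> real set \<Rightarrow> (jet2 \<Rightarrow> int) \<Rightarrow>
     (cell, jet1) generator fdga" where
  "link_dga C A V \<mu> = (let X = link_complex C A V; \<mu>\<^sub>1 = (\<lambda>(x, y, z). \<mu> (of_real x, of_real y, z)) in
     \<lparr>gens = generators X,
      degr = (\<lambda>(c, S, T). sheet_maslov \<mu>\<^sub>1 S - sheet_maslov \<mu>\<^sub>1 T + cell_dim c - 1),
      dgen = (\<lambda>(c, S, T). case c of
          Vertex v \<Rightarrow> diff_0cell X c S T
        | Edge u v \<Rightarrow> diff_1cell X c (Vertex v) (Vertex u) S T)\<rparr>)"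

definition surface_dga ::
    "(real \<Rightarrow> jet1) set \<Rightarrow> (real \<Rightarrow> jet1) set \<Rightarrow> real set \<Rightarrow> (jet2 \<Rightarrow> int) \<Rightarrow>
     (jet2 set \<times> jet2 set) list \<Rightarrow> (spun_cell, jet2) generator fdga" where
  "surface_dga C A V \<mu> ks = (let X = surface_complex C A V in
     \<lparr>gens = generators X,
      degr = (\<lambda>(c, S, T). sheet_maslov \<mu> S - sheet_maslov \<mu> T + spun_cell_dim c - 1),
      dgen = (\<lambda>(c, S, T). case c of
          Radial (Vertex v) \<Rightarrow> diff_0cell X c S T
        | Radial (Edge u v) \<Rightarrow> diff_1cell X c (Radial (Vertex v)) (Radial (Vertex u)) S T
        | Rotated (Vertex v) \<Rightarrow> diff_1cell X c (Radial (Vertex v)) (Radial (Vertex v)) S T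
        | Rotated (Edge u v) \<Rightarrow>
            diff_2cell X c (Radial (Vertex v)) (Radial (Vertex u))
              (Rotated (Vertex u)) (Radial (Edge u v))
              (if v \<noteq> 0 then mat_add mat_id (edge_mat X (Rotated (Vertex v)))
               else if doubled (front_spin C A) = {} then mat_id
               else pull_mat X (Radial (Vertex 0)) (U_mat X (Radial (Vertex 0)) ks)) S T)\<rparr>)"

definition origin_gens ::
    "(real \<Rightarrow> jet1) set \<Rightarrow> (real \<Rightarrow> jet1) set \<Rightarrow> real set \<Rightarrow> (cell, jet1) generator set" where
  "origin_gens C A V = {(c, S, T) \<in> generators (link_complex C A V). c = Vertex 0}"

text \<open>\<open>\<Gamma>(A) = U - I\<close> for the matrix \<open>A\<close> of the 0-cell at the origin.\<close>

definition U_correction ::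
    "(real \<Rightarrow> jet1) set \<Rightarrow> (real \<Rightarrow> jet1) set \<Rightarrow> real set \<Rightarrow> (jet1 set \<times> jet1 set) list \<Rightarrow>
     (cell, jet1) generator \<Rightarrow> (cell, jet1) generator susp falg" where
  "U_correction C A V ks = (\<lambda>(c, S, T).
     base_incl (U_mat (link_complex C A V) (Vertex 0) ks S T - mat_id S T))"

text \<open>
  The identification of generators: a sheet above \<open>e\<close> becomes itself above \<open>e \<subseteq> {x\<^sub>2 = 0}\<close>, and
  sweeps out a sheet above the rotated cell. Above the origin a single smooth point is
  fixed by all rotations, and a sheet near the origin sweeps out a sheet near the origin.
\<close>

primrec spin_gen :: "(cell, jet1) generator susp \<Rightarrow> (spun_cell, jet2) generator" where
  "spin_gen (Base g) = (case g of (c, S, T) \<Rightarrow>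
     if c = Vertex 0 then (Radial c, spin UNIV S, spin UNIV T)
     else (Radial c, spin {0} S, spin {0} T))"
| "spin_gen (Hat g) = (case g of (c, S, T) \<Rightarrow>
     (Rotated c, spin {0<..<2 * pi} S, spin {0<..<2 * pi} T))"

end

theory Submission
  imports Defs
begin

text \<open>
  Away from the origin the rotations \<open>(x, y, z) \<mapsto> (e\<^sup>i\<^sup>\<theta> x, e\<^sup>i\<^sup>\<theta> y, z)\<close> act freely, and
  the link lies in \<open>x \<le> 0\<close>. So the part of the front spin above a radial cell is a copy of the part of the
  link above it, and the part above a rotated cell is that part times an open interval of angles.
  Hence sheets correspond to sheets (\<open>sheets_Y_radial\<close>, \<open>sheets_Y_rotated\<close>), and so do the order of
  sheets, the sheets in which they end (\<open>ends_in_spun_vertex\<close>) and the cusps at which they meet. In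
  other words, every matrix in the formulas for the front spin is the entrywise image of a matrix for
  the link, either under the algebra map \<open>\<iota>\<close> induced by base generators or under the derivation
  \<open>hat_der\<close> over \<open>\<iota>\<close> induced by hatted generators, which is \<open>\<Gamma>\<close> followed by the identification of
  generators.

  The differentials then match because everything is taken modulo 2. Write \<open>A'\<close> for \<open>hat_der\<close> applied
  to the entries of \<open>A\<close>. The circle through a 0-cell has the same initial and terminal vertex, and its
  formula is \<open>A (I + A') + (I + A') A\<close>; the two copies of \<open>A\<close> cancel and leave \<open>A' A + A A'\<close>, the
  derivative of \<open>A\<^sup>2\<close>. For a 1-cell the derivative of \<open>A\<^sub>+ (I + B) + (I + B) A\<^sub>-\<close> is
  \<open>A'\<^sub>+ (I + B) + A\<^sub>+ B' + B' A\<^sub>- + (I + B) A'\<^sub>-\<close>, the blocks N being constants; the formula for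
  the 2-cell contains \<open>I + B\<close> twice in addition, once from each side of the slit.

  The origin is where geometry is needed. The curve obtained by reflecting the arcs has no boundary,
  so the reflection of an end of an arc lies on the link (\<open>reflect_end_in_link\<close>). An end without a
  partner therefore has \<open>y = 0\<close>; it is fixed by all rotations, nothing is swept out, and the inner
  edge of the disk contributes \<open>W = I\<close>, that is \<open>A' = 0\<close>. If ends match, then the inner edge
  contributes \<open>W = U\<close>. Now \<open>I + A' = U\<close> holds on generators by the choice of \<open>\<Gamma>\<close>, but it has to hold
  for all entries: \<open>U\<close> must agree with \<open>I\<close> where \<open>A\<close> has no generator, which includes the pairs of
  joined sheets (\<open>U_mat_eq_mat_id\<close>). The reason is that no sheet lies between two joined sheets, since
  three ends would then have the same front (\<open>no_sheet_between_joined\<close>). The argument compares sheets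
  at and near their ends; it rests on the fact that the sheets above a 1-cell are graphs of continuous
  functions on the closed cell (\<open>sheet_over_edge\<close>), different sheets having different ends over the
  origin (\<open>sheets_with_common_end\<close>).
\<close>

section \<open>Free algebras over Z/2\<close>

lemma falg_add_self [simp]: "x + x = 0" for x :: "'g falg"
  by (rule poly_mapping_eqI) (simp add: lookup_add)

lemma falg_minus_eq_plus: "x - y = x + y" for x y :: "'g falg"
  by (simp add: diff_eq_eq add.assoc)

text \<open>
  The linear extension of a function on words; \<^const>\<open>subst\<close> and \<^const>\<open>derivation\<close> are both of this kind,
  so additivity has to be shown only once.
\<close>

definition word_sum :: "('g list \<Rightarrow> 'h falg) \<Rightarrow> 'g falg \<Rightarrow> 'h falg" where
  "word_sum F x = (\<Sum>w\<in>Poly_Mapping.keys x. F (letters w))"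

lemma word_sum_superset:
  assumes "finite W" "Poly_Mapping.keys x \<subseteq> W"
  shows "word_sum F x = (\<Sum>w\<in>W. if Poly_Mapping.lookup x w = 0 then 0 else F (letters w))"
  unfolding word_sum_def
  by (rule sum.mono_neutral_cong_left) (use assms in \<open>auto simp: in_keys_iff\<close>)

text \<open>
  The words occurring in both \<open>x\<close> and \<open>y\<close> drop out of the support of \<open>x + y\<close>; their values drop out of
  the sum because they occur there twice.
\<close>

lemma word_sum_add: "word_sum F (x + y) = word_sum F x + word_sum F y"
proof -
  let ?W = "Poly_Mapping.keys x \<union> Poly_Mapping.keys y"
  have sub: "Poly_Mapping.keys (x + y) \<subseteq> ?W"
    by (rule Poly_Mapping.keys_add)
  have "word_sum F (x + y) = (\<Sum>w\<in>?W. if Poly_Mapping.lookup (x + y) w = 0 then 0 else F (letters w))"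
    using sub by (intro word_sum_superset) auto
  also have "\<dots> = (\<Sum>w\<in>?W. (if Poly_Mapping.lookup x w = 0 then 0 else F (letters w)) +
                          (if Poly_Mapping.lookup y w = 0 then 0 else F (letters w)))"
    by (rule sum.cong) (auto simp: lookup_add)
  also have "\<dots> = word_sum F x + word_sum F y"
    by (subst (1 2) word_sum_superset[of ?W]) (auto simp: sum.distrib)
  finally show ?thesis .
qed

lemma word_sum_0 [simp]: "word_sum F 0 = 0"
  by (simp add: word_sum_def)

lemma word_sum_single [simp]: "word_sum F (Poly_Mapping.single w 1) = F (letters w)"
  by (simp add: word_sum_def)

lemma falg_induct [case_names zero add]:
  fixes x :: "'g falg"
  assumes "P 0" and "\<And>w x. P x \<Longrightarrow> P (Poly_Mapping.single (FWord w) 1 + x)"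
  shows "P x"
proof -
  have "P (\<Sum>w\<in>W. Poly_Mapping.single w 1)" if "finite W" for W :: "'g fword set"
    using that
  proof induction
    case (insert w W)
    then show ?case using assms(2)[of _ "letters w"] by simp
  qed (simp add: assms(1))
  moreover have "(\<Sum>w\<in>Poly_Mapping.keys x. Poly_Mapping.single w 1) = x"
  proof (rule poly_mapping_eqI)
    fix v
    have "(\<Sum>w\<in>Poly_Mapping.keys x. Poly_Mapping.lookup (Poly_Mapping.single w (1::bit)) v) =
          (\<Sum>w\<in>Poly_Mapping.keys x. if w = v then 1 else 0)"
      by (rule sum.cong) (auto simp: lookup_single when_def)
    then show "Poly_Mapping.lookup (\<Sum>w\<in>Poly_Mapping.keys x. Poly_Mapping.single w 1) v = Poly_Mapping.lookup x v"
      by (simp add: lookup_sum sum.delta in_keys_iff)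
  qed
  ultimately show ?thesis
    by (metis finite_keys)
qed

lemma additive_falg_eqI:
  fixes F G :: "'g falg \<Rightarrow> 'h falg"
  assumes "\<And>x y. F (x + y) = F x + F y" "\<And>x y. G (x + y) = G x + G y"
    and "\<And>w. F (Poly_Mapping.single (FWord w) 1) = G (Poly_Mapping.single (FWord w) 1)"
  shows "F x = G x"
proof (induction x rule: falg_induct)
  case zero
  have "F 0 = 0" "G 0 = 0"
    using assms(1,2)[of 0 0] by auto
  then show ?case by simp
next
  case (add w x)
  then show ?case using assms by simp
qed

lemma word_mult:
  "Poly_Mapping.single (FWord v) 1 * Poly_Mapping.single (FWord w) 1 =
   (Poly_Mapping.single (FWord (v @ w)) 1 :: 'g falg)"
  by (simp add: mult_single plus_fword_def)

lemma word_Nil: "Poly_Mapping.single (FWord []) 1 = (1 :: 'g falg)"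
  by (metis single_one zero_fword_def)

lemma prod_list_var: "prod_list (map (\<lambda>g. var (h g)) w) = Poly_Mapping.single (FWord (map h w)) 1"
  by (induction w) (auto simp: word_Nil var_def word_mult)

lemma subst_word_sum: "subst f = word_sum (\<lambda>w. prod_list (map f w))"
  by (simp add: fun_eq_iff subst_def word_sum_def)

lemma subst_add: "subst f (x + y) = subst f x + subst f y"
  by (simp add: subst_word_sum word_sum_add)

lemma subst_0 [simp]: "subst f 0 = 0"
  by (simp add: subst_word_sum)

lemma subst_word: "subst f (Poly_Mapping.single (FWord w) 1) = prod_list (map f w)"
  by (simp add: subst_word_sum)

lemma subst_1 [simp]: "subst f 1 = 1"
  using subst_word[of f "[]"] by (simp add: word_Nil)

lemma subst_var [simp]: "subst f (var g) = f g"
  using subst_word[of f "[g]"] by (simp add: var_def)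

lemma subst_mult: "subst f (x * y) = subst f x * subst f y"
proof (rule additive_falg_eqI[of "\<lambda>x. subst f (x * y)" "\<lambda>x. subst f x * subst f y"])
  fix w
  show "subst f (Poly_Mapping.single (FWord w) 1 * y) =
        subst f (Poly_Mapping.single (FWord w) 1) * subst f y"
    by (rule additive_falg_eqI[of "\<lambda>y. subst f (Poly_Mapping.single (FWord w) 1 * y)"
          "\<lambda>y. subst f (Poly_Mapping.single (FWord w) 1) * subst f y"])
      (simp_all add: subst_add distrib_left word_mult subst_word)
qed (simp_all add: subst_add distrib_right)

lemma subst_sum: "subst f (sum g I) = (\<Sum>i\<in>I. subst f (g i))"
  by (induction I rule: infinite_finite_induct) (auto simp: subst_add)

lemma subst_subst: "subst f (subst g x) = subst (\<lambda>a. subst f (g a)) x"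
proof (rule additive_falg_eqI[of "\<lambda>x. subst f (subst g x)"])
  fix w
  show "subst f (subst g (Poly_Mapping.single (FWord w) 1)) =
        subst (\<lambda>a. subst f (g a)) (Poly_Mapping.single (FWord w) 1)"
    unfolding subst_word by (induction w) (simp_all add: subst_mult)
qed (simp_all add: subst_add)

lemma derivation_word_sum: "derivation f d = word_sum (word_derivation f d)"
  by (simp add: fun_eq_iff derivation_def word_sum_def)

lemma derivation_add: "derivation f d (x + y) = derivation f d x + derivation f d y"
  by (simp add: derivation_word_sum word_sum_add)

lemma derivation_0 [simp]: "derivation f d 0 = 0"
  by (simp add: derivation_word_sum)

lemma derivation_word: "derivation f d (Poly_Mapping.single (FWord w) 1) = word_derivation f d w"
  by (simp add: derivation_word_sum)

lemma derivation_1 [simp]: "derivation f d 1 = 0"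
  using derivation_word[of f d "[]"] by (simp add: word_Nil)

lemma derivation_var [simp]: "derivation f d (var g) = d g"
  using derivation_word[of f d "[g]"] by (simp add: var_def)

lemma derivation_sum: "derivation f d (sum g I) = (\<Sum>i\<in>I. derivation f d (g i))"
  by (induction I rule: infinite_finite_induct) (auto simp: derivation_add)

lemma word_derivation_append:
  "word_derivation f d (v @ w) =
   word_derivation f d v * prod_list (map f w) + prod_list (map f v) * word_derivation f d w"
  by (induction v) (simp_all add: algebra_simps)

lemma derivation_mult:
  fixes x y :: "'a falg"
  shows "derivation f d (x * y) = derivation f d x * subst f y + subst f x * derivation f d y"
proof (rule additive_falg_eqI[of "\<lambda>x. derivation f d (x * y)"
      "\<lambda>x. derivation f d x * subst f y + subst f x * derivation f d y"])
  fix w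
  let ?w = "Poly_Mapping.single (FWord w) 1 :: 'a falg"
  show "derivation f d (?w * y) = derivation f d ?w * subst f y + subst f ?w * derivation f d y"
    by (rule additive_falg_eqI[of "\<lambda>y. derivation f d (?w * y)"
      "\<lambda>y. derivation f d ?w * subst f y + subst f ?w * derivation f d y"])
      (simp_all add: subst_add derivation_add algebra_simps word_mult subst_word derivation_word
         word_derivation_append)
qed (simp_all add: subst_add derivation_add algebra_simps)

lemma subst_derivation:
  "subst f (derivation g d x) = derivation (\<lambda>a. subst f (g a)) (\<lambda>a. subst f (d a)) x"
proof (rule additive_falg_eqI[of "\<lambda>x. subst f (derivation g d x)"])
  fix w
  have *: "subst f (prod_list (map g v)) = prod_list (map (\<lambda>a. subst f (g a)) v)" for v
    by (induction v) (simp_all add: subst_mult)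
  show "subst f (derivation g d (Poly_Mapping.single (FWord w) 1)) =
    derivation (\<lambda>a. subst f (g a)) (\<lambda>a. subst f (d a)) (Poly_Mapping.single (FWord w) 1)"
    unfolding derivation_word by (induction w) (simp_all add: subst_mult subst_add *)
qed (simp_all add: subst_add derivation_add)

text \<open>
  A map of generators is compatible with the differentials on the whole algebra as soon as it is on
  generators: both composites are derivations over the same homomorphism.
\<close>

lemma fdga_isoI:
  assumes "bij_betw h (gens D) (gens D')"
    and "\<And>g. g \<in> gens D \<Longrightarrow> [degr D' (h g) = degr D g] (mod int m)"
    and dgen: "\<And>g. g \<in> gens D \<Longrightarrow> subst (\<lambda>g. var (h g)) (dgen D g) = dgen D' (h g)"
  shows "fdga_iso m h D D'"
proof -
  have word: "word_derivation (\<lambda>g. var (h g)) (\<lambda>g. subst (\<lambda>g. var (h g)) (dgen D g)) w =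
      word_derivation var (dgen D') (map h w)" if "set w \<subseteq> gens D" for w
    using that by (induction w) (simp_all add: dgen o_def)
  have "subst (\<lambda>g. var (h g)) (differential D x) = differential D' (subst (\<lambda>g. var (h g)) x)"
    if "x \<in> falg_carrier D" for x
  proof -
    have "subst (\<lambda>g. var (h g)) (differential D x) =
      (\<Sum>w\<in>Poly_Mapping.keys x. word_derivation (\<lambda>g. var (h g))
          (\<lambda>g. subst (\<lambda>g. var (h g)) (dgen D g)) (letters w))"
      unfolding differential_def subst_derivation by (simp add: derivation_def)
    also have "\<dots> = (\<Sum>w\<in>Poly_Mapping.keys x. differential D' (prod_list (map (\<lambda>g. var (h g)) (letters w))))"
      using that
      by (intro sum.cong) (auto simp: falg_carrier_def word differential_def prod_list_var derivation_word)
    also have "\<dots> = differential D' (subst (\<lambda>g. var (h g)) x)"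
      by (simp add: differential_def subst_def derivation_sum)
    finally show ?thesis .
  qed
  with assms show ?thesis
    by (auto simp: fdga_iso_def)
qed

section \<open>Rotating subsets of the 1-jet space\<close>

text \<open>
  The lift of the rotation about the z-axis, applied to a point of \<open>{x\<^sub>2 = y\<^sub>2 = 0}\<close>.
\<close>

definition rot :: "real \<Rightarrow> jet1 \<Rightarrow> jet2" where
  "rot \<theta> p = (cis \<theta> * of_real (fst p), cis \<theta> * of_real (fst (snd p)), zc p)"

lemma spin_eq: "spin \<Theta> S = (\<lambda>(\<theta>, p). rot \<theta> p) ` (\<Theta> \<times> S)"
  by (force simp: spin_def rot_def zc_def)

lemma spin_iff: "P \<in> spin \<Theta> S \<longleftrightarrow> (\<exists>\<theta>\<in>\<Theta>. \<exists>p\<in>S. P = rot \<theta> p)"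
  by (auto simp: spin_eq)

lemma spinE:
  assumes "P \<in> spin \<Theta> S"
  obtains \<theta> p where "\<theta> \<in> \<Theta>" "p \<in> S" "P = rot \<theta> p"
  using assms unfolding spin_iff by blast

lemma rotI: "\<theta> \<in> \<Theta> \<Longrightarrow> p \<in> S \<Longrightarrow> rot \<theta> p \<in> spin \<Theta> S"
  by (auto simp: spin_iff)

lemma zc_rot [simp]: "zc (rot \<theta> p) = zc p"
  by (simp add: rot_def zc_def)

lemma fst_rot [simp]: "fst (rot \<theta> p) = cis \<theta> * of_real (fst p)"
  by (simp add: rot_def)

lemma spin_mono: "\<Theta> \<subseteq> \<Theta>' \<Longrightarrow> S \<subseteq> S' \<Longrightarrow> spin \<Theta> S \<subseteq> spin \<Theta>' S'"
  by (simp add: spin_eq image_mono Sigma_mono)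

lemma spin_eq_empty_iff: "spin \<Theta> S = {} \<longleftrightarrow> \<Theta> = {} \<or> S = {}"
  by (auto simp: spin_eq)

lemma continuous_on_rot: "continuous_on X (\<lambda>(\<theta>, p). rot \<theta> p)"
  unfolding rot_def zc_def case_prod_unfold by (intro continuous_intros)

lemma connected_spin: "connected \<Theta> \<Longrightarrow> connected S \<Longrightarrow> connected (spin \<Theta> S)"
  unfolding spin_eq by (intro connected_continuous_image continuous_on_rot connected_Times)

lemma cis_eq_cis_0_2pi: "\<exists>\<theta>'\<in>{0..<2 * pi}. cis \<theta>' = cis \<theta>"
proof -
  let ?n = "\<lfloor>\<theta> / (2 * pi)\<rfloor>"
  let ?t = "\<theta> - 2 * pi * of_int ?n"
  have "?t \<in> {0..<2 * pi}"
    using floor_divide_lower[of "2 * pi" \<theta>] floor_divide_upper[of "2 * pi" \<theta>]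
    by (simp add: algebra_simps)
  moreover have "cis ?t = cis \<theta>"
    by (simp add: cis_divide [symmetric] cis_multiple_2pi)
  ultimately show ?thesis by blast
qed

lemma rot_cong: "cis \<theta> = cis \<theta>' \<Longrightarrow> rot \<theta> p = rot \<theta>' p"
  by (simp add: rot_def)

text \<open>
  A compact set of angles suffices for a full turn; closures of swept-out sets are computed with it.
\<close>

lemma spin_circle: "spin {0..2 * pi} S = spin UNIV S"
proof -
  have "rot \<theta> p \<in> spin {0..2 * pi} S" if "p \<in> S" for \<theta> p
  proof -
    obtain \<theta>' where "\<theta>' \<in> {0..<2 * pi}" "cis \<theta>' = cis \<theta>"
      using cis_eq_cis_0_2pi by blast
    with that rotI[of \<theta>' "{0..2 * pi}" p S] show ?thesis
      by (simp add: rot_cong[of \<theta> \<theta>'])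
  qed
  then have "spin UNIV S \<subseteq> spin {0..2 * pi} S"
    by (metis spinE subsetI)
  then show ?thesis
    using spin_mono[of "{0..2 * pi}" UNIV S S] by auto
qed

text \<open>
  The image of a compact set under the continuous map \<open>(\<theta>, p) \<mapsto> rot \<theta> p\<close> is compact, so the
  closure adds nothing but images of limit points.
\<close>

lemma closure_spin:
  assumes "bounded \<Theta>" "bounded S"
  shows "closure (spin \<Theta> S) = spin (closure \<Theta>) (closure S)"
proof
  have "compact (spin (closure \<Theta>) (closure S))"
    unfolding spin_eq
    using assms by (intro compact_continuous_image continuous_on_rot compact_Times)
      (auto simp: compact_closure)
  then show "closure (spin \<Theta> S) \<subseteq> spin (closure \<Theta>) (closure S)"
    by (intro closure_minimal spin_mono closure_subset compact_imp_closed)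
  have "(\<lambda>(\<theta>, p). rot \<theta> p) ` closure (\<Theta> \<times> S) \<subseteq> closure (spin \<Theta> S)"
    by (rule image_closure_subset[OF continuous_on_rot]) (auto simp only: spin_eq closed_closure closure_subset)
  then show "spin (closure \<Theta>) (closure S) \<subseteq> closure (spin \<Theta> S)"
    by (simp add: spin_eq closure_Times)
qed

lemma closure_spin_0: "bounded S \<Longrightarrow> closure (spin {0} S) = spin {0} (closure S)"
  by (simp add: closure_spin)

lemma closure_spin_interval:
  "bounded S \<Longrightarrow> closure (spin {0<..<2 * pi} S) = spin UNIV (closure S)"
  by (simp add: closure_spin spin_circle)

lemma closure_spin_UNIV: "bounded S \<Longrightarrow> closure (spin UNIV S) = spin UNIV (closure S)"
  using closure_spin[of "{0..2 * pi}" S] by (simp add: spin_circle)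

text \<open>
  The radius determines \<open>\<bar>x\<bar>\<close>; on the half \<open>x \<le> 0\<close> also the sign of \<open>x\<close>, hence the angle.
\<close>

lemma rot_eq_rotD:
  assumes "fst p < 0" "fst p' \<le> 0" "rot \<theta> p = rot \<theta>' p'"
  shows "p = p'" "cis \<theta> = cis \<theta>'"
proof -
  have eq: "cis \<theta> * of_real (fst p) = cis \<theta>' * of_real (fst p')"
    "cis \<theta> * of_real (fst (snd p)) = cis \<theta>' * of_real (fst (snd p'))" "zc p = zc p'"
    using assms(3) by (auto simp: rot_def)
  have "\<bar>fst p\<bar> = \<bar>fst p'\<bar>"
    using arg_cong[OF eq(1), of cmod] by (simp add: norm_mult)
  then have x: "fst p = fst p'"
    using assms(1,2) by auto
  with eq(1) assms(1) show "cis \<theta> = cis \<theta>'"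
    by simp
  with eq(2) have "fst (snd p) = fst (snd p')"
    by (metis cis_neq_zero mult_left_cancel of_real_eq_iff)
  with x eq(3) show "p = p'"
    by (simp add: zc_def prod_eq_iff)
qed

text \<open>
  The continuous inverse of rotation on the complement of the fibre over the origin: it recovers the
  point of the curve, forgetting the angle.
\<close>

definition unspin :: "jet2 \<Rightarrow> jet1" where
  "unspin P = (- cmod (fst P), Re (fst (snd P) * cnj (fst P)) / - cmod (fst P), zc P)"

lemma unspin_rot:
  assumes "fst p < 0"
  shows "unspin (rot \<theta> p) = p"
proof -
  obtain x y z where p: "p = (x, y, z)" by (cases p)
  have "cis \<theta> * of_real y * cnj (cis \<theta> * of_real x) = (cis \<theta> * cnj (cis \<theta>)) * of_real (y * x)"
    by (simp add: algebra_simps)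
  also have "cis \<theta> * cnj (cis \<theta>) = 1"
    by (simp add: cis_cnj cis_mult)
  finally have "Re (cis \<theta> * of_real y * cnj (cis \<theta> * of_real x)) = y * x"
    by (metis Re_complex_of_real mult_1)
  with assms show ?thesis
    by (simp add: p unspin_def rot_def norm_mult zc_def del: times_complex.simps complex_cnj_mult)
qed

lemma continuous_on_unspin: "continuous_on {P. fst P \<noteq> 0} unspin"
  unfolding unspin_def zc_def by (intro continuous_intros) auto

text \<open>
  If the second coordinate can be recovered continuously from \<open>F (\<theta>, p)\<close>, then sweeping a set out by a
  connected parameter space neither merges nor splits its components.
\<close>

lemma connected_parametrised_components:
  fixes F :: "'a::topological_space \<times> 'b::topological_space \<Rightarrow> 'c::topological_space"
  assumes "connected \<Theta>" "\<Theta> \<noteq> {}" and cont: "continuous_on (\<Theta> \<times> S) F"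
    and inv: "continuous_on (F ` (\<Theta> \<times> S)) G" "\<And>\<theta> p. \<theta> \<in> \<Theta> \<Longrightarrow> p \<in> S \<Longrightarrow> G (F (\<theta>, p)) = p"
  shows "components (F ` (\<Theta> \<times> S)) = (\<lambda>T. F ` (\<Theta> \<times> T)) ` components S"
proof -
  have comp: "F ` (\<Theta> \<times> T) \<in> components (F ` (\<Theta> \<times> S))" if T: "T \<in> components S" for T
    unfolding in_components_maximal
  proof (intro conjI allI impI)
    have TS: "T \<subseteq> S" "T \<noteq> {}" "connected T"
      using T in_components_subset in_components_nonempty in_components_connected by auto
    show "F ` (\<Theta> \<times> T) \<noteq> {}" "F ` (\<Theta> \<times> T) \<subseteq> F ` (\<Theta> \<times> S)"
      using TS assms(2) by auto
    show "connected (F ` (\<Theta> \<times> T))"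
      using TS assms(1) by (intro connected_continuous_image continuous_on_subset[OF cont]
        connected_Times) auto
    fix D
    assume D: "D \<noteq> {} \<and> F ` (\<Theta> \<times> T) \<subseteq> D \<and> D \<subseteq> F ` (\<Theta> \<times> S) \<and> connected D"
    have "connected (G ` D)"
      using D by (intro connected_continuous_image continuous_on_subset[OF inv(1)]) auto
    moreover have "G ` D \<subseteq> S"
      using D inv(2) by fastforce
    moreover have "T \<subseteq> G ` D"
    proof
      fix p assume "p \<in> T"
      with assms(2) obtain \<theta> where "\<theta> \<in> \<Theta>" by auto
      have "F (\<theta>, p) \<in> F ` (\<Theta> \<times> T)"
        using \<open>\<theta> \<in> \<Theta>\<close> \<open>p \<in> T\<close> by simp
      with D have "F (\<theta>, p) \<in> D" by blast
      moreover have "G (F (\<theta>, p)) = p"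
        using \<open>\<theta> \<in> \<Theta>\<close> \<open>p \<in> T\<close> TS(1) inv(2) by blast
      ultimately show "p \<in> G ` D" by (metis image_eqI)
    qed
    ultimately have "G ` D \<subseteq> T"
      by (intro components_maximal[OF T]) (use TS(2) in blast)+
    show "D = F ` (\<Theta> \<times> T)"
    proof
      show "F ` (\<Theta> \<times> T) \<subseteq> D" using D by auto
      show "D \<subseteq> F ` (\<Theta> \<times> T)"
      proof
        fix P assume P: "P \<in> D"
        with D have "P \<in> F ` (\<Theta> \<times> S)" by blast
        then obtain \<theta> p where p: "\<theta> \<in> \<Theta>" "p \<in> S" "P = F (\<theta>, p)" by fastforce
        with P \<open>G ` D \<subseteq> T\<close> have "p \<in> T"
          using inv(2)[OF p(1,2)] by (metis image_subset_iff)
        with p show "P \<in> F ` (\<Theta> \<times> T)" by blast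
      qed
    qed
  qed
  show ?thesis
  proof
    show "(\<lambda>T. F ` (\<Theta> \<times> T)) ` components S \<subseteq> components (F ` (\<Theta> \<times> S))"
      using comp by auto
    show "components (F ` (\<Theta> \<times> S)) \<subseteq> (\<lambda>T. F ` (\<Theta> \<times> T)) ` components S"
    proof
      fix K assume K: "K \<in> components (F ` (\<Theta> \<times> S))"
      then obtain \<theta> p where p: "\<theta> \<in> \<Theta>" "p \<in> S" "F (\<theta>, p) \<in> K"
        using in_components_nonempty[OF K] in_components_subset[OF K] by blast
      obtain T where T: "T \<in> components S" "p \<in> T"
        using p(2) by (metis UnionE Union_components)
      have "K = F ` (\<Theta> \<times> T)"
        using components_nonoverlap[OF K comp[OF T(1)]] p T(2) by auto
      with T show "K \<in> (\<lambda>T. F ` (\<Theta> \<times> T)) ` components S" by auto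
    qed
  qed
qed

lemma components_spin:
  assumes "connected \<Theta>" "\<Theta> \<noteq> {}" "S \<subseteq> {p. fst p < 0}"
  shows "components (spin \<Theta> S) = spin \<Theta> ` components S"
  unfolding spin_eq
proof (rule connected_parametrised_components[OF assms(1,2) continuous_on_rot])
  show "continuous_on ((\<lambda>(\<theta>, p). rot \<theta> p) ` (\<Theta> \<times> S)) unspin"
    using assms(3) by (intro continuous_on_subset[OF continuous_on_unspin]) auto
  show "unspin (case (\<theta>, p) of (\<theta>, p) \<Rightarrow> rot \<theta> p) = p" if "p \<in> S" for \<theta> p
    using that assms(3) by (auto simp: unspin_rot)
qed

text \<open>
  On the z-axis the rotations act trivially, and \<^const>\<open>unspin\<close> is replaced by the height.
\<close>

lemma components_spin_axis:
  assumes "S \<subseteq> {p. fst p = 0 \<and> fst (snd p) = 0}"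
  shows "components (spin UNIV S) = spin UNIV ` components S"
  unfolding spin_eq
proof (rule connected_parametrised_components[OF connected_UNIV _ continuous_on_rot])
  let ?G = "\<lambda>P::jet2. (0::real, 0::real, zc P)"
  show "continuous_on ((\<lambda>(\<theta>, p). rot \<theta> p) ` (UNIV \<times> S)) ?G"
    unfolding zc_def by (intro continuous_intros)
  show "?G (case (\<theta>, p) of (\<theta>, p) \<Rightarrow> rot \<theta> p) = p" if "p \<in> S" for \<theta> p
  proof -
    have "p = (0, 0, zc p)"
      using that assms by (auto simp: zc_def prod_eq_iff)
    then show ?thesis by simp
  qed
qed simp

text \<open>
  Inclusions between swept-out sets can be tested before spinning. The larger set may reach the fibre over
  the origin, as closures of sheets do.
\<close>

lemma spin_subset_spin_iff:
  assumes "S \<subseteq> {p. fst p < 0}" "S' \<subseteq> {p. fst p \<le> 0}" "\<Theta> \<noteq> {}" "\<Theta> \<subseteq> \<Theta>'"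
  shows "spin \<Theta> S \<subseteq> spin \<Theta>' S' \<longleftrightarrow> S \<subseteq> S'"
proof
  assume sub: "spin \<Theta> S \<subseteq> spin \<Theta>' S'"
  obtain \<theta> where "\<theta> \<in> \<Theta>" using assms(3) by auto
  show "S \<subseteq> S'"
  proof
    fix p assume p: "p \<in> S"
    with sub \<open>\<theta> \<in> \<Theta>\<close> obtain \<theta>' p' where "p' \<in> S'" "rot \<theta> p = rot \<theta>' p'"
      by (meson rotI spin_iff subsetD)
    with p assms(1,2) show "p \<in> S'"
      using rot_eq_rotD(1)[of p p'] by auto
  qed
qed (rule spin_mono[OF assms(4)])

lemma spin_inter_eq_empty_iff:
  assumes "S \<subseteq> {p. fst p \<le> 0}" "S' \<subseteq> {p. fst p < 0}" "\<Theta> \<noteq> {}" "\<Theta> \<subseteq> \<Theta>' \<or> \<Theta>' \<subseteq> \<Theta>" "\<Theta>' \<noteq> {}"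
  shows "spin \<Theta> S \<inter> spin \<Theta>' S' = {} \<longleftrightarrow> S \<inter> S' = {}"
proof -
  have "p \<in> S \<inter> S'" if "p \<in> S" "p' \<in> S'" "rot \<theta> p = rot \<theta>' p'" for p p' \<theta> \<theta>'
    using that assms(1,2) rot_eq_rotD(1)[of p' p \<theta>' \<theta>] by auto
  then have "S \<inter> S' = {} \<Longrightarrow> spin \<Theta> S \<inter> spin \<Theta>' S' = {}"
    by (metis disjoint_iff_not_equal empty_iff spinE)
  moreover have "\<exists>\<theta>. \<theta> \<in> \<Theta> \<inter> \<Theta>'"
    using assms(3,4,5) by blast
  then have "p \<in> S \<inter> S' \<Longrightarrow> spin \<Theta> S \<inter> spin \<Theta>' S' \<noteq> {}" for p
    by (metis Int_iff empty_iff rotI)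
  ultimately show ?thesis by blast
qed

lemma inj_on_spin:
  assumes "\<Theta> \<noteq> {}"
  shows "inj_on (spin \<Theta>) (Pow {p. fst p < 0})"
proof (rule inj_onI)
  fix S S' assume *: "S \<in> Pow {p. fst p < 0}" "S' \<in> Pow {p. fst p < 0}" "spin \<Theta> S = spin \<Theta> S'"
  have "S \<subseteq> {p. fst p \<le> 0}" "S' \<subseteq> {p. fst p \<le> 0}"
    using * by (force intro: less_imp_le)+
  then show "S = S'"
    using spin_subset_spin_iff[of S S' \<Theta> \<Theta>] spin_subset_spin_iff[of S' S \<Theta> \<Theta>] * assms by auto
qed

lemma z_above_spin_iff:
  assumes "S \<subseteq> {p. fst p < 0}" "S' \<subseteq> {p. fst p < 0}" "\<Theta> \<noteq> {}"
  shows "z_above (spin \<Theta> S) (spin \<Theta> S') \<longleftrightarrow> z_above S S'"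
proof
  assume l: "z_above (spin \<Theta> S) (spin \<Theta> S')"
  obtain \<theta> where "\<theta> \<in> \<Theta>" using assms(3) by auto
  then show "z_above S S'"
    using l unfolding z_above_def by (metis fst_rot rotI zc_rot)
next
  assume r: "z_above S S'"
  have "fst p = fst p'" if "p \<in> S" "p' \<in> S'" "cis \<theta> * of_real (fst p) = cis \<theta>' * of_real (fst p')"
    for p p' \<theta> \<theta>'
  proof -
    have "\<bar>fst p\<bar> = \<bar>fst p'\<bar>"
      using arg_cong[OF that(3), of cmod] by (simp add: norm_mult)
    moreover have "fst p < 0" "fst p' < 0"
      using that(1,2) assms(1,2) by auto
    ultimately show ?thesis
      by linarith
  qed
  then show "z_above (spin \<Theta> S) (spin \<Theta> S')"
    using r unfolding z_above_def by (metis fst_rot spinE zc_rot)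
qed

lemma joined_spin_UNIV_iff:
  assumes "bounded S" "bounded S'"
  shows "joined (spin UNIV S) (spin UNIV S') \<longleftrightarrow> joined S S'"
proof -
  have "(\<exists>P\<in>spin UNIV X. \<exists>Q\<in>spin UNIV Y. fst P = 0 \<and> front P = front Q) \<longleftrightarrow>
        (\<exists>p\<in>X. \<exists>q\<in>Y. fst p = 0 \<and> front p = front q)" (is "?L \<longleftrightarrow> ?R") for X Y
  proof
    assume ?L
    then obtain P Q where PQ: "P \<in> spin UNIV X" "Q \<in> spin UNIV Y" "fst P = 0" "front P = front Q"
      by blast
    obtain \<theta> p where p: "p \<in> X" "P = rot \<theta> p" using PQ(1) by (rule spinE)
    obtain \<theta>' q where q: "q \<in> Y" "Q = rot \<theta>' q" using PQ(2) by (rule spinE)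
    have "fst p = 0" "front p = front q"
      using PQ(3,4) by (auto simp: p(2) q(2) front_def)
    with p(1) q(1) show ?R by blast
  next
    assume ?R
    then obtain p q where pq: "p \<in> X" "q \<in> Y" "fst p = 0" "front p = front q" by blast
    then have "fst (rot 0 p) = 0" "front (rot 0 p) = front (rot 0 q)"
      by (auto simp: front_def)
    with pq rotI[of 0 UNIV] show ?L by (meson UNIV_I)
  qed
  then show ?thesis
    by (simp add: joined_def closure_spin_UNIV assms)
qed

section \<open>Legendrian curves and their ends\<close>

lemma smooth_DERIV: "smooth f \<Longrightarrow> (f has_real_derivative deriv f t) (at t)"
  unfolding smooth_def by (metis DERIV_deriv_iff_real_differentiable funpow_0)

lemma legendrian_on_continuous: "legendrian_on I \<gamma> \<Longrightarrow> continuous_on X \<gamma>"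
proof -
  assume "legendrian_on I \<gamma>"
  then have "continuous_on X (xcurve \<gamma>)" "continuous_on X (ycurve \<gamma>)" "continuous_on X (zcurve \<gamma>)"
    unfolding legendrian_on_def
    by (meson smooth_DERIV DERIV_isCont continuous_at_imp_continuous_on)+
  then have "continuous_on X (\<lambda>t. (xcurve \<gamma> t, ycurve \<gamma> t, zcurve \<gamma> t))"
    by (intro continuous_on_Pair)
  then show ?thesis by simp
qed

lemma circle_period: "legendrian_circle \<gamma> \<Longrightarrow> \<gamma> (t + of_int n) = \<gamma> t"
proof (induction n rule: int_induct[where k = 0])
  case (step1 i)
  then show ?case
    by (metis add.assoc legendrian_circle_def of_int_1 of_int_add)
next
  case (step2 i)
  have "\<gamma> (t + of_int (i - 1) + 1) = \<gamma> (t + of_int (i - 1))"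
    using step2.prems unfolding legendrian_circle_def by blast
  moreover have "t + of_int (i - 1) + 1 = t + of_int i"
    by simp
  ultimately show ?case
    using step2 by metis
qed simp

lemma circle_frac: "legendrian_circle \<gamma> \<Longrightarrow> \<gamma> (frac t) = \<gamma> t"
  using circle_period[of \<gamma> "frac t" "\<lfloor>t\<rfloor>"] by (simp add: frac_def)

lemma circle_range: "legendrian_circle \<gamma> \<Longrightarrow> \<gamma> t \<in> \<gamma> ` {0..1}"
  by (metis atLeastAtMost_iff circle_frac frac_ge_0 frac_lt_1 image_eqI less_imp_le)

lemma circle_image:
  assumes "legendrian_circle \<gamma>"
  shows "(\<lambda>t. \<gamma> (t + c)) ` {0..1} = \<gamma> ` {0..1}"
proof
  show "(\<lambda>t. \<gamma> (t + c)) ` {0..1} \<subseteq> \<gamma> ` {0..1}"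
    using circle_range[OF assms] by auto
  show "\<gamma> ` {0..1} \<subseteq> (\<lambda>t. \<gamma> (t + c)) ` {0..1}"
  proof (rule image_subsetI)
    fix t :: real
    have "\<gamma> t = \<gamma> (frac (t - c) + c)"
      using circle_period[OF assms, of "frac (t - c) + c" "\<lfloor>t - c\<rfloor>"] by (simp add: frac_def)
    then show "\<gamma> t \<in> (\<lambda>t. \<gamma> (t + c)) ` {0..1}"
      using frac_lt_1[of "t - c"] by (intro image_eqI[of _ _ "frac (t - c)"]) auto
  qed
qed

lemma circle_inj:
  assumes "legendrian_circle \<gamma>" "\<gamma> s = \<gamma> t" "\<bar>s - t\<bar> < 1"
  shows "s = t"
proof -
  have "inj_on \<gamma> {0..<1}" "\<gamma> (frac s) = \<gamma> (frac t)"
    using assms by (auto simp: legendrian_circle_def circle_frac)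
  then have "frac s = frac t"
    by (meson atLeastLessThan_iff frac_ge_0 frac_lt_1 inj_onD)
  then have eq: "s - t = of_int (\<lfloor>s\<rfloor> - \<lfloor>t\<rfloor>)"
    by (simp add: frac_def)
  with assms(3) have "\<bar>\<lfloor>s\<rfloor> - \<lfloor>t\<rfloor>\<bar> < 1"
    by linarith
  with eq show ?thesis by simp
qed

lemma periodic_deriv:
  fixes f :: "real \<Rightarrow> real"
  assumes "\<And>t. f (t + 1) = f t"
  shows "deriv f (t + 1) = deriv f t"
proof -
  have "DERIV f (t + 1) :> D \<longleftrightarrow> DERIV f t :> D" for D
    using DERIV_shift[of f D t 1] assms by simp
  then show ?thesis by (simp add: deriv_def)
qed

text \<open>
  A 1-manifold does not contain an end of an arc as an interior point: expressing \<open>\<delta>\<close> in the parameter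
  of the arc gives a continuous injective, hence strictly monotone function, which takes no extreme value
  at an interior point.
\<close>

lemma injective_curve_avoids_end:
  fixes \<gamma> \<delta> :: "real \<Rightarrow> 'a::t2_space"
  assumes "continuous_on {0..1} \<gamma>" "inj_on \<gamma> {0..1}"
    and "continuous_on {a<..<b} \<delta>" "inj_on \<delta> {a<..<b}" "\<delta> ` {a<..<b} \<subseteq> \<gamma> ` {0..1}"
    and "s \<in> {a<..<b}" "\<delta> s = \<gamma> e"
  shows "e \<noteq> 0 \<and> e \<noteq> 1"
proof -
  define g where "g = inv_into {0..1} \<gamma>"
  define h where "h = g \<circ> \<delta>"
  \<comment> \<open>the value at \<open>s\<close> is compared with values on both sides, inside of the open interval\<close>
  define a' b' where "a' = (a + s) / 2" "b' = (s + b) / 2"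
  have ab: "a < a'" "a' < s" "s < b'" "b' < b"
    using assms(6) by (auto simp: a'_b'_def)
  have "continuous_on (\<gamma> ` {0..1}) g"
    using assms(1,2) by (intro continuous_on_inv) (auto simp: g_def)
  then have "continuous_on {a<..<b} h"
    unfolding h_def using assms(3,5) continuous_on_compose continuous_on_subset by blast
  then have cont: "continuous_on {a'..b'} h"
    by (rule continuous_on_subset) (use ab in auto)
  have "inj_on g (\<gamma> ` {0..1})"
    unfolding g_def by (rule inj_on_inv_into) simp
  then have "inj_on h {a<..<b}"
    unfolding h_def using assms(4,5) by (meson comp_inj_on inj_on_subset)
  then have inj: "inj_on h {a'..b'}"
    by (rule inj_on_subset) (use ab in auto)
  have bounds: "h t \<in> {0..1}" if "t \<in> {a'..b'}" for t
  proof -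
    have "\<delta> t \<in> \<gamma> ` {0..1}" using that ab assms(5) by auto
    then show ?thesis unfolding h_def g_def comp_def by (rule inv_into_into)
  qed
  have "h s = e" if "e \<in> {0..1}"
    using that assms(2,7) by (simp add: h_def g_def inv_into_f_f)
  moreover have "0 < h s \<and> h s < 1"
    using continuous_inj_imp_mono[OF ab(2,3) cont inj] bounds[of a'] bounds[of b'] ab by auto
  ultimately show ?thesis by auto
qed

locale spinnable_front =
  fixes C A :: "(real \<Rightarrow> jet1) set"
  assumes spinnable: "front_spinnable C A"
begin

lemma finite_curves: "finite (C \<union> A)"
  using spinnable by (simp add: front_spinnable_def)

lemma circleD: "\<gamma> \<in> C \<Longrightarrow> legendrian_circle \<gamma>" "\<gamma> \<in> C \<Longrightarrow> fst (\<gamma> t) < 0"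
  using spinnable by (auto simp: front_spinnable_def)

lemma arcD:
  assumes "\<gamma> \<in> A"
  shows "legendrian_arc \<gamma>" "fst (\<gamma> 0) = 0" "fst (\<gamma> 1) = 0" "0 < t \<Longrightarrow> t < 1 \<Longrightarrow> fst (\<gamma> t) < 0"
    "deriv (xcurve \<gamma>) 0 \<noteq> 0" "deriv (xcurve \<gamma>) 1 \<noteq> 0"
  using assms spinnable by (auto simp: front_spinnable_def)

lemma arc_ends: "\<gamma> \<in> A \<Longrightarrow> t \<in> {0..1} \<Longrightarrow> fst (\<gamma> t) = 0 \<Longrightarrow> t = 0 \<or> t = 1"
  using arcD(4)[of \<gamma> t] by force

lemma curve_legendrian: "\<gamma> \<in> C \<union> A \<Longrightarrow> \<exists>I. legendrian_on I \<gamma>"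
  using circleD(1)[of \<gamma>] arcD(1)[of \<gamma>] unfolding legendrian_circle_def legendrian_arc_def by blast

lemma curve_continuous: "\<gamma> \<in> C \<union> A \<Longrightarrow> continuous_on X \<gamma>"
  using curve_legendrian legendrian_on_continuous by blast

lemma curve_DERIV: "\<gamma> \<in> C \<union> A \<Longrightarrow> (xcurve \<gamma> has_real_derivative deriv (xcurve \<gamma>) t) (at t)"
  using curve_legendrian[of \<gamma>] smooth_DERIV by (auto simp: legendrian_on_def)

lemma curves_disjoint:
  assumes "\<gamma> \<in> C \<union> A" "\<delta> \<in> C \<union> A" "\<gamma> \<noteq> \<delta>" "s \<in> {0..1}" "t \<in> {0..1}"
  shows "\<gamma> s \<noteq> \<delta> t"
proof -
  have "pairwise_disjoint_images (C \<union> A)"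
    using spinnable unfolding front_spinnable_def by (elim conjE)
  with assms(1-3) have "\<gamma> ` {0..1} \<inter> \<delta> ` {0..1} = {}"
    unfolding pairwise_disjoint_images_def pairwise_def disjnt_def by simp
  moreover have "\<gamma> s \<in> \<gamma> ` {0..1}" "\<delta> t \<in> \<delta> ` {0..1}"
    using assms(4,5) by simp_all
  ultimately show ?thesis by (metis disjoint_iff)
qed

lemma linkE:
  assumes "p \<in> link C A"
  obtains \<gamma> t where "\<gamma> \<in> C \<union> A" "t \<in> {0..1}" "p = \<gamma> t"
proof -
  from assms obtain \<gamma> where "\<gamma> \<in> C \<union> A" "p \<in> \<gamma> ` {0..1}"
    unfolding link_def by (rule UN_E)
  then show thesis by (elim imageE) (rule that)
qed

lemma link_nonpos: "p \<in> link C A \<Longrightarrow> fst p \<le> 0"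
proof -
  assume "p \<in> link C A"
  then obtain \<gamma> t where "\<gamma> \<in> C \<union> A" "t \<in> {0..1}" "p = \<gamma> t"
    by (rule linkE)
  then show ?thesis
    using circleD(2)[of \<gamma> t] arcD(2,3)[of \<gamma>] arcD(4)[of \<gamma> t]
    by (cases "t = 0 \<or> t = 1") auto
qed

lemma compact_link: "compact (link C A)"
  unfolding link_def using finite_curves
  by (intro compact_UN compact_continuous_image curve_continuous) auto

lemma bounded_link: "S \<subseteq> link C A \<Longrightarrow> bounded S"
  using compact_link bounded_subset compact_imp_bounded by blast

lemma link_over_0E:
  assumes "p \<in> link C A" "fst p = 0"
  obtains \<gamma> e where "\<gamma> \<in> A" "e = 0 \<or> e = 1" "p = \<gamma> e"
proof -
  obtain \<gamma> t where *: "\<gamma> \<in> C \<union> A" "t \<in> {0..1}" "p = \<gamma> t"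
    using assms(1) by (rule linkE)
  with assms(2) circleD(2)[of \<gamma> t] have "\<gamma> \<in> A" by auto
  with * assms(2) arc_ends[of \<gamma> t] that show thesis by auto
qed

lemma cusps_neg: "p \<in> cusps C A \<Longrightarrow> fst p < 0"
proof -
  assume "p \<in> cusps C A"
  then obtain \<gamma> t where *: "\<gamma> \<in> C \<union> A" "t \<in> {0..1}" "p = \<gamma> t" "deriv (xcurve \<gamma>) t = 0"
    unfolding cusps_def by blast
  show ?thesis
  proof (cases "\<gamma> \<in> C")
    case True then show ?thesis using * circleD by simp
  next
    case False
    then show ?thesis
      using * arcD(5,6)[of \<gamma>] arcD(4)[of \<gamma> t] by (cases "t = 0 \<or> t = 1") auto
  qed
qed

text \<open>
  Otherwise the closed curves formed by the arcs and their reflections would agree near the end \<open>p\<close> with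
  a single arc that stops at \<open>p\<close>.
\<close>

lemma reflect_end_in_link:
  assumes "p \<in> link C A" "fst p = 0"
  shows "reflect p \<in> link C A"
proof (rule ccontr)
  assume notin: "reflect p \<notin> link C A"
  obtain \<gamma> e where \<gamma>: "\<gamma> \<in> A" "e = 0 \<or> e = 1" "p = \<gamma> e"
    using link_over_0E[OF assms] .
  define M where "M = link {} A"
  have "M \<subseteq> link C A" by (auto simp: M_def link_def)
  have "\<exists>K. finite K \<and> (\<forall>\<delta>\<in>K. legendrian_circle \<delta>) \<and> pairwise_disjoint_images K \<and>
      link K {} = M \<union> reflect ` M"
    using spinnable unfolding front_spinnable_def M_def by (elim conjE)
  then obtain K where K: "\<And>\<delta>. \<delta> \<in> K \<Longrightarrow> legendrian_circle \<delta>" "link K {} = M \<union> reflect ` M"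
    by blast
  have "p \<in> M"
    unfolding M_def link_def by (rule UN_I[of \<gamma>]) (use \<gamma> in auto)
  then have "p \<in> link K {}" using K(2) by blast
  then obtain \<delta> s where \<delta>: "\<delta> \<in> K" "p = \<delta> s"
    unfolding link_def by blast
  have \<delta>cont: "continuous_on X \<delta>" for X
    using K(1)[OF \<delta>(1)] legendrian_on_continuous by (auto simp: legendrian_circle_def)
  \<comment> \<open>everything but the arc \<open>\<gamma>\<close>; as a compact set it stays away from \<open>p\<close>\<close>
  define Q where "Q = reflect ` M \<union> (\<Union>\<gamma>'\<in>A - {\<gamma>}. \<gamma>' ` {0..1})"
  have "compact M"
    unfolding M_def link_def using finite_curves
    by (intro compact_UN compact_continuous_image curve_continuous) auto
  moreover have "continuous_on M reflect"
    unfolding reflect_def zc_def by (intro continuous_intros)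
  ultimately have "compact Q"
    unfolding Q_def using finite_curves
    by (intro compact_Un compact_UN compact_continuous_image curve_continuous) auto
  have "reflect (reflect q) = q" for q
    by (simp add: reflect_def zc_def)
  with notin \<open>M \<subseteq> link C A\<close> have "p \<notin> reflect ` M"
    by auto
  moreover have "p \<notin> \<gamma>' ` {0..1}" if "\<gamma>' \<in> A - {\<gamma>}" for \<gamma>'
  proof
    assume "p \<in> \<gamma>' ` {0..1}"
    then obtain t where "t \<in> {0..1}" "p = \<gamma>' t" by blast
    then show False
      using curves_disjoint[of \<gamma> \<gamma>' e t] that \<gamma> by auto
  qed
  ultimately have "p \<notin> Q"
    unfolding Q_def by blast
  have "open (\<delta> -` (- Q))"
    using \<open>compact Q\<close> \<delta>cont[of UNIV] by (intro open_vimage) (auto simp: compact_imp_closed)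
  moreover have "s \<in> \<delta> -` (- Q)"
    using \<open>p \<notin> Q\<close> \<delta> by auto
  ultimately obtain d where d: "d > 0" "\<And>t. dist t s < d \<Longrightarrow> \<delta> t \<notin> Q"
    unfolding open_dist by (auto simp: subset_iff)
  \<comment> \<open>a circle of period 1 is injective on intervals of length at most 1\<close>
  define r where "r = min d (1/2)"
  have r: "0 < r" "r \<le> d" "r \<le> 1/2" using d(1) by (auto simp: r_def)
  have "\<delta> t \<in> \<gamma> ` {0..1}" if "t \<in> {s - r<..<s + r}" for t
  proof -
    have "\<delta> t \<in> M \<union> reflect ` M"
      using circle_range[OF K(1)[OF \<delta>(1)]] \<delta>(1) unfolding K(2)[symmetric] by (force simp: link_def)
    moreover have "\<delta> t \<notin> Q"
      using that r by (intro d(2)) (auto simp: dist_real_def)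
    ultimately show ?thesis
      by (auto simp: Q_def M_def link_def)
  qed
  moreover have "inj_on \<delta> {s - r<..<s + r}"
  proof (rule inj_onI)
    fix t t' assume "t \<in> {s - r<..<s + r}" "t' \<in> {s - r<..<s + r}" "\<delta> t = \<delta> t'"
    then show "t = t'"
      using r by (intro circle_inj[OF K(1)[OF \<delta>(1)]]) auto
  qed
  moreover have "inj_on \<gamma> {0..1}"
    using arcD(1)[OF \<gamma>(1)] by (simp add: legendrian_arc_def)
  ultimately have "e \<noteq> 0 \<and> e \<noteq> 1"
    using \<delta>cont curve_continuous[of \<gamma>] \<gamma> \<delta> r
    by (intro injective_curve_avoids_end[of \<gamma> "s - r" "s + r" \<delta> s]) auto
  with \<gamma>(2) show False by simp
qed

text \<open>
  An end with \<open>y \<noteq> 0\<close> is matched with its own reflection; of two different points with the same front at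
  least one has \<open>y \<noteq> 0\<close>.
\<close>

lemma doubled_link_iff: "doubled (link C A) \<noteq> {} \<longleftrightarrow> (\<exists>p\<in>link C A. fst p = 0 \<and> fst (snd p) \<noteq> 0)"
proof
  assume "\<exists>p\<in>link C A. fst p = 0 \<and> fst (snd p) \<noteq> 0"
  then obtain p where p: "p \<in> link C A" "fst p = 0" "fst (snd p) \<noteq> 0" by blast
  then have "reflect p \<in> link C A" "reflect p \<noteq> p" "front (reflect p) = front p"
    using reflect_end_in_link by (auto simp: reflect_def front_def zc_def prod_eq_iff)
  with p show "doubled (link C A) \<noteq> {}"
    unfolding doubled_def by blast
next
  assume "doubled (link C A) \<noteq> {}"
  then obtain p q where *: "p \<in> link C A" "q \<in> link C A" "fst p = 0" "q \<noteq> p" "front q = front p"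
    unfolding doubled_def by blast
  then have "fst q = 0" "fst (snd p) \<noteq> 0 \<or> fst (snd q) \<noteq> 0"
    by (auto simp: front_def zc_def prod_eq_iff)
  with * show "\<exists>p\<in>link C A. fst p = 0 \<and> fst (snd p) \<noteq> 0" by blast
qed

text \<open>
  Over the origin a point with \<open>y \<noteq> 0\<close> sweeps out a circle with constant front, a point with \<open>y = 0\<close> is
  fixed.
\<close>

lemma doubled_front_spin_iff: "doubled (front_spin C A) = {} \<longleftrightarrow> doubled (link C A) = {}"
proof -
  have "doubled (front_spin C A) \<noteq> {} \<longleftrightarrow> (\<exists>p\<in>link C A. fst p = 0 \<and> fst (snd p) \<noteq> 0)"
  proof
    assume "\<exists>p\<in>link C A. fst p = 0 \<and> fst (snd p) \<noteq> 0"
    then obtain p where p: "p \<in> link C A" "fst p = 0" "fst (snd p) \<noteq> 0" by blast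
    then have "rot pi p \<noteq> rot 0 p" "front (rot pi p) = front (rot 0 p)" "fst (rot 0 p) = 0"
      by (auto simp: front_def rot_def zc_def)
    moreover have "rot 0 p \<in> front_spin C A" "rot pi p \<in> front_spin C A"
      using p(1) by (auto simp only: front_spin_def intro: rotI)
    ultimately show "doubled (front_spin C A) \<noteq> {}"
      unfolding doubled_def by blast
  next
    assume "doubled (front_spin C A) \<noteq> {}"
    then obtain P Q where *: "P \<in> front_spin C A" "Q \<in> front_spin C A" "fst P = 0" "Q \<noteq> P"
      "front Q = front P"
      unfolding doubled_def by blast
    obtain \<theta> p where p: "p \<in> link C A" "P = rot \<theta> p" using *(1) unfolding front_spin_def by (rule spinE)
    obtain \<theta>' q where q: "q \<in> link C A" "Q = rot \<theta>' q" using *(2) unfolding front_spin_def by (rule spinE)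
    have "fst p = 0" "fst q = 0" "fst (snd p) \<noteq> 0 \<or> fst (snd q) \<noteq> 0"
      using * by (auto simp: p q rot_def front_def zc_def)
    with p q show "\<exists>p\<in>link C A. fst p = 0 \<and> fst (snd p) \<noteq> 0" by blast
  qed
  with doubled_link_iff show ?thesis by blast
qed

end

section \<open>Sheets above an open interval without cusps\<close>

text \<open>
  The maximal interval around \<open>t0\<close> on which \<open>x\<close> stays in \<open>(u, v)\<close>. By Rolle's theorem \<open>x\<close> is injective on
  it, so it enters and leaves at different ends of \<open>(u, v)\<close> and takes all values in between.
\<close>

lemma monotone_stretch:
  fixes x :: "real \<Rightarrow> real"
  assumes cont: "continuous_on {0..1} x" and ends: "x 0 \<notin> {u<..<v}" "x 1 \<notin> {u<..<v}"
    and deriv: "\<And>t. t \<in> {0..1} \<Longrightarrow> x t \<in> {u<..<v} \<Longrightarrow> \<exists>D. D \<noteq> 0 \<and> (x has_real_derivative D) (at t)"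
    and t0: "t0 \<in> {0..1}" "x t0 \<in> {u<..<v}"
  obtains a b where "0 \<le> a" "a < t0" "t0 < b" "b \<le> 1"
    "inj_on x {a..b}" "x ` {a..b} = {u..v}" "x ` {a<..<b} = {u<..<v}"
proof -
  have closed: "compact {t \<in> {c..d}. x t \<notin> {u<..<v}}" if "0 \<le> c" "d \<le> 1" for c d
  proof -
    have "closed ({c..d} \<inter> x -` (- {u<..<v}))"
      using that by (intro continuous_closed_preimage continuous_on_subset[OF cont]) auto
    moreover have "{t \<in> {c..d}. x t \<notin> {u<..<v}} = {c..d} \<inter> x -` (- {u<..<v})"
      by auto
    ultimately show ?thesis
      by (metis compact_Icc compact_Int_closed inf.left_idem)
  qed
  let ?L = "{t \<in> {0..t0}. x t \<notin> {u<..<v}}" and ?R = "{t \<in> {t0..1}. x t \<notin> {u<..<v}}"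
  have "0 \<in> ?L" "1 \<in> ?R" using ends t0(1) by auto
  then have ne: "?L \<noteq> {}" "?R \<noteq> {}" by blast+
  have comp: "compact ?L" "compact ?R"
    using closed[of 0 t0] closed[of t0 1] t0(1) by auto
  have "\<exists>a\<in>?L. \<forall>t\<in>?L. t \<le> a"
    by (rule compact_attains_sup[OF comp(1) ne(1)])
  moreover have "\<exists>b\<in>?R. \<forall>t\<in>?R. b \<le> t"
    by (rule compact_attains_inf[OF comp(2) ne(2)])
  ultimately obtain a b where a: "a \<in> ?L" "\<And>t. t \<in> ?L \<Longrightarrow> t \<le> a" and b: "b \<in> ?R" "\<And>t. t \<in> ?R \<Longrightarrow> b \<le> t"
    by meson
  have ab: "0 \<le> a" "a < t0" "t0 < b" "b \<le> 1"
    using a(1) b(1) t0 by (auto simp: order_less_le)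
  have inside: "x t \<in> {u<..<v}" if "t \<in> {a<..<b}" for t
    using that a(2)[of t] b(2)[of t] ab by (cases "t \<le> t0") (auto simp: not_le)
  have cont': "continuous_on {a..b} x"
    using ab by (intro continuous_on_subset[OF cont]) auto
  have "u < v" using t0(2) by auto
  have sub: "x ` {a..b} \<subseteq> {u..v}"
    using image_closure_subset[of "{a<..<b}" x "{u..v}"] cont' ab inside
    by (auto simp: less_imp_le image_subset_iff)
  have inj: "inj_on x {a..b}"
  proof (rule linorder_inj_onI)
    fix s t assume st: "s < t" "s \<in> {a..b}" "t \<in> {a..b}"
    show "x s \<noteq> x t"
    proof
      assume "x s = x t"
      have der: "\<exists>D. D \<noteq> 0 \<and> (x has_real_derivative D) (at r)" if "s < r" "r < t" for r
        using that st ab inside by (intro deriv) auto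
      then obtain z where "s < z" "z < t" "(x has_real_derivative 0) (at z)"
        using Rolle[of s t x] st \<open>x s = x t\<close> continuous_on_subset[OF cont', of "{s..t}"]
        by (auto simp: real_differentiable_def)
      with der[of z] show False
        using DERIV_unique by blast
    qed
  qed auto
  have "x a \<in> {u..v}" "x b \<in> {u..v}"
    using sub ab by (auto simp: image_subset_iff)
  then have "x a \<in> {u, v}" "x b \<in> {u, v}"
    using a(1) b(1) by (auto simp: not_less)
  moreover have "x a \<noteq> x b"
    using inj ab by (auto dest: inj_onD)
  ultimately have ends': "{x a, x b} = {u, v}" by auto
  have "connected (x ` {a..b})"
    using cont' by (intro connected_continuous_image) auto
  moreover have "u \<in> x ` {a..b}" "v \<in> x ` {a..b}"
    using ends' ab by (auto simp: doubleton_eq_iff)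
  ultimately have "{u..v} \<subseteq> x ` {a..b}"
    by (rule connected_contains_Icc)
  with sub have im: "x ` {a..b} = {u..v}" by auto
  have "x ` {a<..<b} = {u<..<v}"
  proof
    show "{u<..<v} \<subseteq> x ` {a<..<b}"
    proof
      fix y assume y: "y \<in> {u<..<v}"
      then have "y \<in> x ` {a..b}" unfolding im by auto
      then obtain t where t: "t \<in> {a..b}" "y = x t" by auto
      then have "t \<noteq> a" "t \<noteq> b"
        using y a(1) b(1) by auto
      with t show "y \<in> x ` {a<..<b}" by auto
    qed
  qed (use inside in auto)
  with ab inj im that show thesis by blast
qed

context spinnable_front
begin

text \<open>
  Arcs have their ends over 0, outside of the interval. A circle has a point where \<open>x' = 0\<close>, a cusp; if
  its parametrisation starts there, then it too starts and ends outside of the interval, and the two kinds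
  of curves need not be distinguished any longer.
\<close>

lemma curve_reparametrised:
  assumes \<gamma>: "\<gamma> \<in> C \<union> A" and "v \<le> 0"
    and nocusp: "\<And>p. p \<in> cusps C A \<Longrightarrow> fst p \<notin> {u<..<v}"
  obtains g where "continuous_on {0..1} g" "g ` {0..1} = \<gamma> ` {0..1}"
    "\<And>s t. s \<in> {0<..<1} \<Longrightarrow> t \<in> {0..1} \<Longrightarrow> g s = g t \<Longrightarrow> s = t"
    "fst (g 0) \<notin> {u<..<v}" "fst (g 1) \<notin> {u<..<v}"
    "\<And>t. t \<in> {0..1} \<Longrightarrow> fst (g t) \<in> {u<..<v} \<Longrightarrow>
       \<exists>D. D \<noteq> 0 \<and> ((\<lambda>t. fst (g t)) has_real_derivative D) (at t)"
proof (cases "\<gamma> \<in> A")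
  case True
  show thesis
  proof (rule that[of \<gamma>])
    have "inj_on \<gamma> {0..1}"
      using arcD(1)[OF True] by (simp add: legendrian_arc_def)
    then show "s = t" if "s \<in> {0<..<1}" "t \<in> {0..1}" "\<gamma> s = \<gamma> t" for s t
      using that by (auto dest: inj_onD)
    show "\<exists>D. D \<noteq> 0 \<and> (xcurve \<gamma> has_real_derivative D) (at t)"
      if t: "t \<in> {0..1}" "fst (\<gamma> t) \<in> {u<..<v}" for t
    proof -
      have "\<gamma> t \<in> cusps C A" if "deriv (xcurve \<gamma>) t = 0"
        unfolding cusps_def by (rule UN_I[OF \<gamma>]) (use that t(1) in blast)
      then have "deriv (xcurve \<gamma>) t \<noteq> 0"
        using nocusp t(2) by blast
      then show ?thesis
        using curve_DERIV[OF \<gamma>] by blast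
    qed
  qed (use curve_continuous[OF \<gamma>] arcD(2,3)[OF True] \<open>v \<le> 0\<close> in auto)
next
  case False
  with \<gamma> have C: "\<gamma> \<in> C" by auto
  note circ = circleD(1)[OF C]
  have per: "\<gamma> (t + 1) = \<gamma> t" for t
    using circ by (simp add: legendrian_circle_def)
  have cusp: "\<gamma> t \<in> cusps C A" if "deriv (xcurve \<gamma>) t = 0" "0 \<le> t" "t \<le> 2" for t
  proof -
    have "\<exists>s\<in>{0..1}. \<gamma> s = \<gamma> t \<and> deriv (xcurve \<gamma>) s = 0"
    proof (cases "t \<le> 1")
      case True
      with that show ?thesis by (intro bexI[of _ t]) auto
    next
      case False
      with that show ?thesis
        using per[of "t - 1"] periodic_deriv[of "xcurve \<gamma>" "t - 1"] per
        by (intro bexI[of _ "t - 1"]) auto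
    qed
    then obtain s where "s \<in> {0..1}" "\<gamma> s = \<gamma> t" "deriv (xcurve \<gamma>) s = 0" by blast
    then show ?thesis
      unfolding cusps_def by (intro UN_I[OF \<gamma>]) (metis (mono_tags, lifting) image_eqI mem_Collect_eq)
  qed
  have "xcurve \<gamma> 0 = xcurve \<gamma> 1"
    using per[of 0] by simp
  then obtain c where c: "0 < c" "c < 1" "(xcurve \<gamma> has_real_derivative 0) (at c)"
    using Rolle[of 0 1 "xcurve \<gamma>"] curve_DERIV[OF \<gamma>] curve_continuous[OF \<gamma>]
    by (auto simp: real_differentiable_def intro: continuous_on_fst)
  then have "\<gamma> c \<in> cusps C A"
    using cusp[of c] DERIV_imp_deriv by auto
  then have "fst (\<gamma> c) \<notin> {u<..<v}"
    by (rule nocusp)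
  show thesis
  proof (rule that[of "\<lambda>t. \<gamma> (t + c)"])
    show "continuous_on {0..1} (\<lambda>t. \<gamma> (t + c))"
      by (intro continuous_on_compose2[OF curve_continuous[OF \<gamma>]] continuous_intros) auto
    show "(\<lambda>t. \<gamma> (t + c)) ` {0..1} = \<gamma> ` {0..1}"
      by (rule circle_image[OF circ])
    show "s = t" if "s \<in> {0<..<1}" "t \<in> {0..1}" "\<gamma> (s + c) = \<gamma> (t + c)" for s t
      using circle_inj[OF circ that(3)] that(1,2) by auto
    show "fst (\<gamma> (0 + c)) \<notin> {u<..<v}" "fst (\<gamma> (1 + c)) \<notin> {u<..<v}"
      using \<open>fst (\<gamma> c) \<notin> {u<..<v}\<close> per[of c] by (auto simp: add.commute)
    show "\<exists>D. D \<noteq> 0 \<and> ((\<lambda>t. fst (\<gamma> (t + c))) has_real_derivative D) (at t)"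
      if t: "t \<in> {0..1}" "fst (\<gamma> (t + c)) \<in> {u<..<v}" for t
    proof -
      have "deriv (xcurve \<gamma>) (t + c) \<noteq> 0"
        using cusp[of "t + c"] nocusp[of "\<gamma> (t + c)"] t c by auto
      moreover have "((\<lambda>t. fst (\<gamma> (t + c))) has_real_derivative deriv (xcurve \<gamma>) (t + c)) (at t)"
        using curve_DERIV[OF \<gamma>, of "t + c"] DERIV_shift[of "xcurve \<gamma>" _ t c] by blast
      ultimately show ?thesis by blast
    qed
  qed
qed

text \<open>
  The stretch \<open>g (a, b)\<close> through a point of the sheet is a component: its complement in the part of the
  link above the interval is cut out by the remaining curves and the rest of the same curve, which are
  compact. Since \<open>x\<close> is injective on \<open>[a, b]\<close>, it can serve as the parameter.
\<close>

lemma sheet_section: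
  assumes "v \<le> 0" and nocusp: "\<And>p. p \<in> cusps C A \<Longrightarrow> fst p \<notin> {u<..<v}"
    and S: "S \<in> components (link C A \<inter> fst -` {u<..<v})"
  obtains \<sigma> where "continuous_on {u..v} \<sigma>" "\<And>x. x \<in> {u..v} \<Longrightarrow> fst (\<sigma> x) = x"
    "\<sigma> ` {u..v} \<subseteq> link C A" "S = \<sigma> ` {u<..<v}"
proof -
  let ?X = "link C A \<inter> fst -` {u<..<v}"
  obtain p where p: "p \<in> S" "p \<in> link C A" "fst p \<in> {u<..<v}"
    using in_components_nonempty[OF S] in_components_subset[OF S] by blast
  obtain \<gamma> t where \<gamma>: "\<gamma> \<in> C \<union> A" "t \<in> {0..1}" "p = \<gamma> t"
    using p(2) by (rule linkE)
  obtain g where g: "continuous_on {0..1} g" "g ` {0..1} = \<gamma> ` {0..1}"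
    "\<And>s t. s \<in> {0<..<1} \<Longrightarrow> t \<in> {0..1} \<Longrightarrow> g s = g t \<Longrightarrow> s = t"
    "fst (g 0) \<notin> {u<..<v}" "fst (g 1) \<notin> {u<..<v}"
    "\<And>t. t \<in> {0..1} \<Longrightarrow> fst (g t) \<in> {u<..<v} \<Longrightarrow>
       \<exists>D. D \<noteq> 0 \<and> ((\<lambda>t. fst (g t)) has_real_derivative D) (at t)"
    using curve_reparametrised[OF \<gamma>(1) assms(1) nocusp] by metis
  have "p \<in> g ` {0..1}" using g(2) \<gamma>(2,3) by auto
  then obtain t0 where t0: "t0 \<in> {0..1}" "p = g t0" by auto
  define x where "x = (\<lambda>t. fst (g t))"
  have contx: "continuous_on {0..1} x"
    unfolding x_def by (intro continuous_on_fst g(1))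
  obtain a b where ab: "0 \<le> a" "a < t0" "t0 < b" "b \<le> 1"
    "inj_on x {a..b}" "x ` {a..b} = {u..v}" "x ` {a<..<b} = {u<..<v}"
    by (rule monotone_stretch[of x u v t0])
      (use contx g(4-6) t0 p(3) in \<open>auto simp: x_def\<close>)
  have contg: "continuous_on {a..b} g"
    by (rule continuous_on_subset[OF g(1)]) (use ab(1-4) in auto)
  have glink: "g ` {0..1} \<subseteq> link C A"
    unfolding g(2) link_def using \<gamma>(1) by blast
  \<comment> \<open>the part of the link outside of the stretch\<close>
  define Q where "Q = (\<Union>\<delta>\<in>C \<union> A - {\<gamma>}. \<delta> ` {0..1}) \<union> g ` ({0..a} \<union> {b..1})"
  have "compact ({0..a} \<union> {b..1})"
    by (intro compact_Un compact_Icc)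
  moreover have "continuous_on ({0..a} \<union> {b..1}) g"
    using ab(1-4) t0(1) by (intro continuous_on_subset[OF g(1)]) auto
  ultimately have "compact (g ` ({0..a} \<union> {b..1}))"
    by (intro compact_continuous_image)
  moreover have "compact (\<Union>\<delta>\<in>C \<union> A - {\<gamma>}. \<delta> ` {0..1})"
    using finite_curves by (intro compact_UN compact_continuous_image curve_continuous) auto
  ultimately have "compact Q"
    unfolding Q_def by (intro compact_Un)
  have disj: "g s \<notin> Q" if "s \<in> {a<..<b}" for s
  proof
    assume "g s \<in> Q"
    have s: "s \<in> {0<..<1}" using that ab(1-4) t0 by auto
    have "g s \<in> \<gamma> ` {0..1}" unfolding g(2)[symmetric] using s by auto
    then obtain s' where s': "s' \<in> {0..1}" "g s = \<gamma> s'" by auto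
    consider \<delta> r where "\<delta> \<in> C \<union> A" "\<delta> \<noteq> \<gamma>" "r \<in> {0..1}" "g s = \<delta> r"
      | r where "r \<in> {0..a} \<union> {b..1}" "g s = g r"
      using \<open>g s \<in> Q\<close> unfolding Q_def by blast
    then show False
    proof cases
      case 1
      then show False using curves_disjoint[OF \<gamma>(1) 1(1)] s' by metis
    next
      case 2
      then have "s = r" using ab(1-4) t0(1) by (intro g(3) s) auto
      with 2 that show False by auto
    qed
  qed
  have cover: "q \<in> g ` {a<..<b} \<or> q \<in> Q" if "q \<in> link C A" for q
  proof -
    obtain \<delta> r where \<delta>: "\<delta> \<in> C \<union> A" "r \<in> {0..1}" "q = \<delta> r"
      using \<open>q \<in> link C A\<close> by (rule linkE)
    show ?thesis
    proof (cases "\<delta> = \<gamma>")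
      case True
      then have "q \<in> g ` {0..1}" using \<delta> g(2) by auto
      then obtain s where "s \<in> {0..1}" "q = g s" by auto
      then show ?thesis
        unfolding Q_def by (cases "s \<in> {a<..<b}") auto
    next
      case False
      then show ?thesis using \<delta> unfolding Q_def by blast
    qed
  qed
  have comp: "g ` {a<..<b} \<in> components ?X"
    unfolding in_components_maximal
  proof (intro conjI allI impI)
    show "g ` {a<..<b} \<noteq> {}" using ab by auto
    show sub: "g ` {a<..<b} \<subseteq> ?X"
    proof (rule image_subsetI)
      fix s assume s: "s \<in> {a<..<b}"
      then have "fst (g s) \<in> {u<..<v}"
        unfolding ab(7)[symmetric] x_def by auto
      moreover have "g s \<in> link C A"
        using s ab(1-4) glink by auto
      ultimately show "g s \<in> ?X" by simp
    qed
    show "connected (g ` {a<..<b})"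
      by (intro connected_continuous_image continuous_on_subset[OF contg]) auto
    fix D assume D: "D \<noteq> {} \<and> g ` {a<..<b} \<subseteq> D \<and> D \<subseteq> ?X \<and> connected D"
    have "closed (g ` {a..b})"
      by (intro compact_imp_closed compact_continuous_image contg compact_Icc)
    moreover have "closed Q" using \<open>compact Q\<close> by (rule compact_imp_closed)
    moreover have "D \<subseteq> g ` {a..b} \<union> Q"
      using D cover by fastforce
    moreover have "g ` {a..b} \<inter> Q \<inter> D = {}"
    proof -
      have "g s \<notin> Q" if "s \<in> {a..b}" "g s \<in> D" for s
      proof (rule disj)
        have "x s \<in> {u<..<v}"
          using that(2) D by (auto simp: x_def)
        moreover have "x a \<notin> {u<..<v}" "x b \<notin> {u<..<v}"
          using ab inj_onD[OF ab(5)] unfolding ab(7)[symmetric] by force+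
        ultimately show "s \<in> {a<..<b}"
          using that(1) by (auto simp: order_less_le)
      qed
      then show ?thesis by auto
    qed
    moreover have "g t0 \<in> g ` {a..b} \<inter> D"
    proof -
      have "g t0 \<in> g ` {a<..<b}" "g t0 \<in> g ` {a..b}"
        using ab(1-4) by simp_all
      with D show ?thesis by blast
    qed
    ultimately have "Q \<inter> D = {}"
      using D connected_closed[of D] by blast
    with D cover show "D = g ` {a<..<b}"
      by blast
  qed
  have "p \<in> g ` {a<..<b}" using t0 ab by auto
  with p(1) have S_eq: "S = g ` {a<..<b}"
    using components_nonoverlap[OF S comp] by blast
  define \<sigma> where "\<sigma> = g \<circ> inv_into {a..b} x"
  have inv: "inv_into {a..b} x y \<in> {a..b}" "x (inv_into {a..b} x y) = y" if "y \<in> {u..v}" for y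
    using that unfolding ab(6)[symmetric] by (fact inv_into_into, fact f_inv_into_f)
  show thesis
  proof
    have "continuous_on {u..v} (inv_into {a..b} x)"
      unfolding ab(6)[symmetric]
      using ab(1-5) by (intro continuous_on_inv continuous_on_subset[OF contx]) auto
    then show "continuous_on {u..v} \<sigma>"
      unfolding \<sigma>_def using inv(1)
      by (intro continuous_on_compose continuous_on_subset[OF contg]) auto
    show "fst (\<sigma> y) = y" if "y \<in> {u..v}" for y
      using inv(2)[OF that] by (simp add: \<sigma>_def x_def)
    show "\<sigma> ` {u..v} \<subseteq> link C A"
      using inv(1) glink ab(1-4) by (fastforce simp: \<sigma>_def)
    have "inv_into {a..b} x ` {u<..<v} = {a<..<b}"
      unfolding ab(7)[symmetric] using ab(5)
      by (subst inv_into_image_cancel) (auto intro: less_imp_le)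
    then show "S = \<sigma> ` {u<..<v}"
      unfolding S_eq \<sigma>_def by (metis image_comp)
  qed
qed

text \<open>
  The section of the previous lemma is defined on the closed interval, so that it also describes the ends
  of the sheet.
\<close>

lemma sheet_over_edge:
  assumes "u < v" "v \<le> 0" and nocusp: "\<And>p. p \<in> cusps C A \<Longrightarrow> fst p \<notin> {u<..<v}"
    and S: "S \<in> components (link C A \<inter> fst -` {u<..<v})"
  obtains \<sigma> where "continuous_on {u..v} \<sigma>" "\<And>x. x \<in> {u..v} \<Longrightarrow> fst (\<sigma> x) = x"
    "\<sigma> ` {u..v} \<subseteq> link C A" "S = \<sigma> ` {u<..<v}" "closure S = \<sigma> ` {u..v}"
proof -
  obtain \<sigma> where \<sigma>: "continuous_on {u..v} \<sigma>" "\<And>x. x \<in> {u..v} \<Longrightarrow> fst (\<sigma> x) = x"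
    "\<sigma> ` {u..v} \<subseteq> link C A" "S = \<sigma> ` {u<..<v}"
    using sheet_section[OF assms(2) nocusp S] by blast
  have "closure S = \<sigma> ` {u..v}"
  proof
    have "closed (\<sigma> ` {u..v})"
      by (intro compact_imp_closed compact_continuous_image \<sigma>(1) compact_Icc)
    then show "closure S \<subseteq> \<sigma> ` {u..v}"
      unfolding \<sigma>(4) by (rule closure_minimal[rotated]) auto
    have "closure {u<..<v} = {u..v}" using assms(1) by simp
    then show "\<sigma> ` {u..v} \<subseteq> closure S"
      unfolding \<sigma>(4) using \<sigma>(1)
      by (metis closed_closure closure_subset image_closure_subset)
  qed
  with \<sigma> that show thesis by blast
qed

text \<open>
  Near a point over the origin the link is one end of one arc, so any sheet with this point in its
  closure contains the initial piece of the arc.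
\<close>

lemma sheets_with_common_end:
  assumes S: "S \<in> components (link C A \<inter> fst -` {u<..<0})"
    and T: "T \<in> components (link C A \<inter> fst -` {u<..<0})"
    and p: "p \<in> closure S" "p \<in> closure T" "fst p = 0" and "u < 0"
  shows "S = T"
proof -
  let ?X = "link C A \<inter> fst -` {u<..<0}"
  have "S \<subseteq> link C A" "T \<subseteq> link C A"
    using in_components_subset[OF S] in_components_subset[OF T] by auto
  have "closure S \<subseteq> link C A"
    using \<open>S \<subseteq> link C A\<close> compact_link by (intro closure_minimal compact_imp_closed) auto
  with p have "p \<in> link C A" by auto
  then obtain \<gamma> e where \<gamma>: "\<gamma> \<in> A" "e = 0 \<or> e = 1" "p = \<gamma> e"
    using link_over_0E p(3) by blast
  have cont: "continuous_on X (xcurve \<gamma>)" for X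
    using curve_continuous[of \<gamma> X] \<gamma>(1) by (intro continuous_on_fst) auto
  have "open (xcurve \<gamma> -` {u<..})"
    using cont[of UNIV] by (intro open_vimage) auto
  moreover have "e \<in> xcurve \<gamma> -` {u<..}"
    using \<gamma> p(3) \<open>u < 0\<close> by auto
  ultimately obtain d where d: "d > 0" "\<And>t. dist t e < d \<Longrightarrow> u < fst (\<gamma> t)"
    unfolding open_dist by (auto simp: subset_iff)
  define r where "r = min d 1"
  have r: "0 < r" "r \<le> d" "r \<le> 1" using d(1) by (auto simp: r_def)
  \<comment> \<open>parameters close to the end, whose points lie above the interval\<close>
  define J where "J = (if e = 0 then {0<..<r} else {1 - r<..<1})"
  have J: "J \<subseteq> {0<..<1}" "\<And>t. t \<in> J \<Longrightarrow> dist t e < d" "connected J" "J \<noteq> {}"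
    using r \<gamma>(2) by (auto simp: J_def dist_real_def)
  have JX: "\<gamma> ` J \<subseteq> ?X"
  proof (rule image_subsetI)
    fix t assume t: "t \<in> J"
    then have "t \<in> {0..1}" using J(1) by auto
    then have "\<gamma> t \<in> link C A"
      using \<gamma>(1) unfolding link_def by blast
    moreover have "u < fst (\<gamma> t)" "fst (\<gamma> t) < 0"
      using J t d(2) arcD(4)[OF \<gamma>(1), of t] by auto
    ultimately show "\<gamma> t \<in> ?X" by auto
  qed
  have conJ: "connected (\<gamma> ` J)"
    using \<gamma>(1) J(3) by (intro connected_continuous_image curve_continuous) auto
  \<comment> \<open>the part of the link away from the end \<open>\<gamma> e\<close>\<close>
  define Q where "Q = (\<Union>\<delta>\<in>C \<union> A - {\<gamma>}. \<delta> ` {0..1}) \<union> \<gamma> ` ({0..1} - J - {e})"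
  have "{0..1} - J - {e} = (if e = 0 then {r..1} else {0..1 - r})"
    using r \<gamma>(2) by (auto simp: J_def)
  then have "compact ({0..1} - J - {e})" by simp
  then have "compact Q"
    unfolding Q_def using finite_curves \<gamma>(1)
    by (intro compact_Un compact_UN compact_continuous_image curve_continuous) auto
  have e01: "e \<in> {0..1}" using \<gamma>(2) by auto
  have "p \<notin> Q"
  proof
    assume "p \<in> Q"
    then consider \<delta> s where "\<delta> \<in> C \<union> A" "\<delta> \<noteq> \<gamma>" "s \<in> {0..1}" "p = \<delta> s"
      | s where "s \<in> {0..1}" "s \<noteq> e" "p = \<gamma> s"
      unfolding Q_def by blast
    then show False
    proof cases
      case 1
      then show False
        using curves_disjoint[of \<delta> \<gamma> s e] \<gamma> e01 by auto
    next
      case 2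
      have "inj_on \<gamma> {0..1}"
        using arcD(1)[OF \<gamma>(1)] by (simp add: legendrian_arc_def)
      with 2 show False
        using \<gamma>(3) e01 by (auto dest: inj_onD)
    qed
  qed
  have meets: "\<gamma> ` J \<subseteq> R" if R: "R \<in> components ?X" "p \<in> closure R" for R
  proof -
    have "open (- Q)" using \<open>compact Q\<close> by (simp add: compact_imp_closed open_Compl)
    with R(2) \<open>p \<notin> Q\<close> obtain q where q: "q \<in> R" "q \<notin> Q"
      using closure_iff_nhds_not_empty[of p R] by (metis ComplI Compl_iff disjoint_iff order_refl)
    have "q \<in> ?X" using in_components_subset[OF R(1)] q(1) by auto
    then have "q \<in> link C A" "fst q < 0" by auto
    then obtain \<delta> s where s: "\<delta> \<in> C \<union> A" "s \<in> {0..1}" "q = \<delta> s"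
      using linkE by blast
    have "\<delta> = \<gamma>" "s \<in> J \<or> s = e"
      using q(2) s unfolding Q_def by blast+
    moreover have "s \<noteq> e"
      using \<open>fst q < 0\<close> p(3) \<gamma>(3) s(3) \<open>\<delta> = \<gamma>\<close> by auto
    ultimately have "q \<in> \<gamma> ` J" using s by auto
    with q(1) show ?thesis
      by (intro components_maximal[OF R(1) conJ JX]) auto
  qed
  have "\<gamma> ` J \<subseteq> S \<inter> T"
    using meets[OF S p(1)] meets[OF T p(2)] by auto
  with J(4) show ?thesis
    using components_nonoverlap[OF S T] by auto
qed

end

section \<open>Sheets of the link and of its front spin\<close>

text \<open>
  Components are relatively closed.
\<close>

lemma component_subset_closure_iff:
  assumes "S \<in> components F" "T \<in> components F"
  shows "T \<subseteq> closure S \<longleftrightarrow> T = S"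
proof
  assume sub: "T \<subseteq> closure S"
  have "closedin (top_of_set F) S"
    using assms(1) by (rule closedin_component)
  then obtain U where "closed U" "S = F \<inter> U"
    by (auto simp: closedin_closed)
  then have "closure S \<subseteq> U"
    by (intro closure_minimal) auto
  with sub \<open>S = F \<inter> U\<close> have "T \<subseteq> S"
    using in_components_subset[OF assms(2)] by blast
  with assms show "T = S"
    using components_nonoverlap[OF assms] in_components_nonempty[OF assms(2)] by blast
qed (simp add: closure_subset)

lemma component_subset_iff:
  assumes "S \<in> components F" "T \<in> components F"
  shows "S \<subseteq> T \<longleftrightarrow> T = S"
  using components_nonoverlap[OF assms] in_components_nonempty[OF assms(1)] by blast

lemma pi_in_turn: "pi \<in> {0<..<2 * pi}"
  using pi_gt_zero by auto

lemma turn_nonempty: "{0<..<2 * pi} \<noteq> {}"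
  using pi_in_turn by blast

lemma spin_0_subset_iff: "spin {0} S \<subseteq> spin {0} S' \<longleftrightarrow> S \<subseteq> S'"
proof -
  have "inj (rot 0)"
    by (rule injI) (simp add: rot_def zc_def prod_eq_iff)
  moreover have "spin {0} S = rot 0 ` S" for S
    by (auto simp: spin_eq)
  ultimately show ?thesis
    by (simp add: inj_image_subset_iff)
qed

text \<open>
  Rotating by \<open>\<pi>\<close> leads to the half-plane over the positive real axis.
\<close>

lemma not_spin_subset_spin_0:
  assumes "pi \<in> \<Theta>" "S \<noteq> {}" "S \<subseteq> {p. fst p < 0}" "S' \<subseteq> {p. fst p \<le> 0}"
  shows "\<not> spin \<Theta> S \<subseteq> spin {0} S'"
proof
  assume sub: "spin \<Theta> S \<subseteq> spin {0} S'"
  obtain p where p: "p \<in> S" using assms(2) by blast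
  then have "rot pi p \<in> spin {0} S'" using sub assms(1) by (blast intro: rotI)
  then obtain p' where p': "p' \<in> S'" "rot pi p = rot 0 p'"
    by (auto elim: spinE)
  have "cis pi = cis 0"
    by (rule rot_eq_rotD(2)[OF _ _ p'(2)]) (use p p'(1) assms(3,4) in auto)
  then show False by simp
qed

abbreviation z_axis :: "jet1 set" where
  "z_axis \<equiv> {p. fst p = 0 \<and> fst (snd p) = 0}"

lemma rot_axis:
  assumes "p \<in> z_axis" "p' \<in> z_axis"
  shows "rot \<theta> p = rot \<theta>' p' \<longleftrightarrow> p = p'"
  using assms by (auto simp: rot_def zc_def prod_eq_iff)

lemma spin_axis_subset_iff:
  assumes "S \<subseteq> z_axis" "S' \<inter> {p. fst p = 0} \<subseteq> z_axis" "\<Theta> \<noteq> {}" "\<Theta> \<subseteq> \<Theta>'"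
  shows "spin \<Theta> S \<subseteq> spin \<Theta>' S' \<longleftrightarrow> S \<subseteq> S'"
proof
  assume sub: "spin \<Theta> S \<subseteq> spin \<Theta>' S'"
  obtain \<theta> where "\<theta> \<in> \<Theta>" using assms(3) by auto
  show "S \<subseteq> S'"
  proof
    fix p assume p: "p \<in> S"
    with sub \<open>\<theta> \<in> \<Theta>\<close> obtain \<theta>' p' where p': "p' \<in> S'" "rot \<theta> p = rot \<theta>' p'"
      by (meson rotI spin_iff subsetD)
    have "p \<in> z_axis" using p assms(1) by blast
    then have "fst (rot \<theta>' p') = 0"
      using fst_rot[of \<theta> p] unfolding p'(2)[symmetric] by simp
    then have "p' \<in> z_axis" using p'(1) assms(2) by auto
    with p' show "p \<in> S'"
      using rot_axis[OF \<open>p \<in> z_axis\<close>, of p' \<theta> \<theta>'] by simp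
  qed
qed (rule spin_mono[OF assms(4)])

lemma spin_axis: "S \<subseteq> z_axis \<Longrightarrow> \<Theta> \<noteq> {} \<Longrightarrow> spin \<Theta> S = spin {0} S"
proof -
  assume ax: "S \<subseteq> z_axis" and ne: "\<Theta> \<noteq> {}"
  have *: "rot \<theta> p = rot 0 p" if "p \<in> S" for \<theta> p
    using that ax by (auto simp: rot_def)
  from ne obtain \<theta> where "\<theta> \<in> \<Theta>" by blast
  show "spin \<Theta> S = spin {0} S"
  proof (intro equalityI subsetI)
    fix P assume "P \<in> spin \<Theta> S"
    then obtain \<theta> p where "p \<in> S" "P = rot \<theta> p" by (rule spinE)
    then show "P \<in> spin {0} S" using *[of p \<theta>] rotI[of 0 "{0}" p S] by simp
  next
    fix P assume "P \<in> spin {0} S"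
    then obtain p where "p \<in> S" "P = rot 0 p" by (auto elim: spinE)
    with *[of p \<theta>] \<open>\<theta> \<in> \<Theta>\<close> show "P \<in> spin \<Theta> S" by (metis rotI)
  qed
qed

lemma z_above_spin_axis_iff:
  assumes "S \<subseteq> z_axis" "S' \<subseteq> z_axis"
  shows "z_above (spin UNIV S) (spin UNIV S') \<longleftrightarrow> z_above S S'"
proof -
  have "fst p = 0" if "p \<in> S \<or> p \<in> S'" for p
    using that assms by blast
  then have "z_above (spin \<Theta> S) (spin \<Theta> S') \<longleftrightarrow> (\<forall>\<theta>\<in>\<Theta>. \<forall>p\<in>S. \<forall>\<theta>'\<in>\<Theta>. \<forall>q\<in>S'. zc q < zc p)"
    and "z_above S S' \<longleftrightarrow> (\<forall>p\<in>S. \<forall>q\<in>S'. zc q < zc p)" for \<Theta>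
    by (auto simp only: z_above_def spin_iff fst_rot zc_rot Ball_def Bex_def mult_zero_right of_real_0)
      (metis fst_rot zc_rot mult_zero_right of_real_0)+
  then show ?thesis
    by blast
qed

locale decomposed_front = spinnable_front +
  fixes V :: "real set"
  assumes decomposition: "cell_decomposition C A V"
begin

abbreviation X :: "(cell, jet1) sheeted_complex" where
  "X \<equiv> link_complex C A V"

abbreviation Y :: "(spun_cell, jet2) sheeted_complex" where
  "Y \<equiv> surface_complex C A V"

abbreviation link_cells :: "cell set" where
  "link_cells \<equiv> cells_of C A V"

lemma cells_X [simp]: "cells X = link_cells"
  by (simp add: link_complex_def)

lemma cells_Y [simp]: "cells Y = Radial ` link_cells \<union> Rotated ` (link_cells - {Vertex 0})"
  by (simp add: surface_complex_def spun_cells_of_def)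

lemma finite_V: "finite V"
  using decomposition by (simp add: cell_decomposition_def)

lemma V_nonpos: "v \<in> V \<Longrightarrow> v \<le> 0"
proof -
  assume "v \<in> V"
  then have "Vertex v \<in> link_cells" by (simp add: cells_of_def)
  then have "v \<in> (\<Union>c\<in>link_cells. cell_locus c)" by force
  also have "\<dots> = fst ` link C A"
    using decomposition by (simp add: cell_decomposition_def)
  finally show ?thesis
    using link_nonpos by auto
qed

lemma cusps_over_V: "p \<in> cusps C A \<Longrightarrow> fst p \<in> V"
  using decomposition by (auto simp: cell_decomposition_def image_subset_iff)

lemma VertexD: "Vertex v \<in> link_cells \<Longrightarrow> v \<in> V"
  by (auto simp: cells_of_def)

lemma EdgeD:
  assumes "Edge u v \<in> link_cells"
  shows "u \<in> V" "v \<in> V" "u < v" "v \<le> 0" "u < 0" "{u<..<v} \<inter> V = {}"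
    "p \<in> cusps C A \<Longrightarrow> fst p \<notin> {u<..<v}" "Vertex u \<in> link_cells" "Vertex v \<in> link_cells"
proof -
  show *: "u \<in> V" "v \<in> V" "u < v" "{u<..<v} \<inter> V = {}"
    using assms by (auto simp: cells_of_def)
  then show "v \<le> 0" "u < 0" "p \<in> cusps C A \<Longrightarrow> fst p \<notin> {u<..<v}"
    using V_nonpos[of v] cusps_over_V[of p] by auto
  from * show "Vertex u \<in> link_cells" "Vertex v \<in> link_cells"
    by (auto simp: cells_of_def)
qed

lemma next_vertex_gap: "{next_vertex V<..<0} \<inter> V = {}"
proof -
  have "v \<le> next_vertex V" if "v \<in> V" "v < 0" for v
    unfolding next_vertex_def using that finite_V by (intro Max_ge) auto
  then show ?thesis by force
qed

lemma next_vertex_Edge: "Edge u 0 \<in> link_cells \<Longrightarrow> next_vertex V = u"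
  unfolding next_vertex_def using EdgeD[of u 0] finite_V
  by (intro Max_eqI) (auto simp: not_le disjoint_iff)

definition sheet_locus :: "cell \<Rightarrow> real set" where
  "sheet_locus c =
     (if c = Vertex 0 \<and> doubled (link C A) \<noteq> {} then {next_vertex V<..<0} else cell_locus c)"

definition fibre :: "cell \<Rightarrow> jet1 set" where
  "fibre c = link C A \<inter> fst -` sheet_locus c"

text \<open>
  For the 0-cell at the origin the sheets of the front spin are invariant under all rotations, for all
  other radial cells they lie in \<open>{x\<^sub>2 = 0}\<close>.
\<close>

definition radial_sheet :: "cell \<Rightarrow> jet1 set \<Rightarrow> jet2 set" where
  "radial_sheet c = spin (if c = Vertex 0 then UNIV else {0})"

abbreviation rotated_sheet :: "jet1 set \<Rightarrow> jet2 set" where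
  "rotated_sheet \<equiv> spin {0<..<2 * pi}"

lemma sheets_X: "sheets X c = {S \<in> components (fibre c). S \<inter> cusps C A = {}}"
  by (simp add: link_complex_def sheets_above_def fibre_def sheet_locus_def)

lemma sheetsD:
  assumes "S \<in> sheets X c"
  shows "S \<in> components (fibre c)" "S \<subseteq> fibre c" "S \<subseteq> link C A" "S \<noteq> {}" "connected S"
    "bounded S" "S \<inter> cusps C A = {}" "closure S \<subseteq> link C A" "closure S \<subseteq> {p. fst p \<le> 0}"
proof -
  show comp: "S \<in> components (fibre c)" and "S \<inter> cusps C A = {}"
    using assms by (auto simp: sheets_X)
  then show "S \<subseteq> fibre c" "S \<noteq> {}" "connected S"
    using in_components_subset[OF comp] in_components_nonempty[OF comp]
      in_components_connected[OF comp] by auto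
  then show link: "S \<subseteq> link C A"
    by (auto simp: fibre_def)
  then show "bounded S" by (rule bounded_link)
  from link show "closure S \<subseteq> link C A"
    using compact_link by (intro closure_minimal compact_imp_closed) auto
  then show "closure S \<subseteq> {p. fst p \<le> 0}"
    using link_nonpos by blast
qed

lemma cell_locus_neg: "c \<in> link_cells \<Longrightarrow> c \<noteq> Vertex 0 \<Longrightarrow> cell_locus c \<subseteq> {..<0}"
proof (cases c)
  case (Vertex v)
  assume "c \<in> link_cells" "c \<noteq> Vertex 0"
  then show ?thesis
    using Vertex VertexD V_nonpos[of v] by (auto simp: order_less_le)
next
  case (Edge u v)
  assume "c \<in> link_cells"
  then show ?thesis using Edge EdgeD(4) by force
qed

lemma sheet_locus_neg:
  "c \<in> link_cells \<Longrightarrow> c \<noteq> Vertex 0 \<or> doubled (link C A) \<noteq> {} \<Longrightarrow> sheet_locus c \<subseteq> {..<0}"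
  using cell_locus_neg by (auto simp: sheet_locus_def)

lemma fibre_neg:
  "c \<in> link_cells \<Longrightarrow> c \<noteq> Vertex 0 \<or> doubled (link C A) \<noteq> {} \<Longrightarrow> fibre c \<subseteq> {p. fst p < 0}"
  using sheet_locus_neg by (auto simp: fibre_def)

lemma sheet_neg:
  "S \<in> sheets X c \<Longrightarrow> c \<in> link_cells \<Longrightarrow> c \<noteq> Vertex 0 \<or> doubled (link C A) \<noteq> {} \<Longrightarrow> S \<subseteq> {p. fst p < 0}"
  using fibre_neg sheetsD(2) by blast

lemma link_axis: "doubled (link C A) = {} \<Longrightarrow> link C A \<inter> {p. fst p = 0} \<subseteq> z_axis"
  using doubled_link_iff by blast

lemma fibre_axis: "doubled (link C A) = {} \<Longrightarrow> fibre (Vertex 0) \<subseteq> z_axis"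
  using link_axis by (auto simp: fibre_def sheet_locus_def)

lemma sheet_axis: "S \<in> sheets X (Vertex 0) \<Longrightarrow> doubled (link C A) = {} \<Longrightarrow> S \<subseteq> z_axis"
  using fibre_axis sheetsD(2) by blast

lemma spun_fibre_radial:
  assumes "c \<in> link_cells" "c \<noteq> Vertex 0"
  shows "front_spin C A \<inter> fst -` spun_cell_locus (Radial c) = spin {0} (fibre c)"
proof -
  have fib: "fibre c = link C A \<inter> fst -` cell_locus c"
    using assms(2) by (simp add: fibre_def sheet_locus_def)
  show ?thesis
  proof (intro equalityI subsetI)
    fix P assume P: "P \<in> front_spin C A \<inter> fst -` spun_cell_locus (Radial c)"
    then obtain \<theta> p where p: "p \<in> link C A" "P = rot \<theta> p"
      unfolding front_spin_def by (auto elim: spinE)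
    obtain x where x: "x \<in> cell_locus c" "cis \<theta> * of_real (fst p) = of_real x"
      using P p(2) by auto
    have "x < 0" using x(1) cell_locus_neg[OF assms] by auto
    \<comment> \<open>the covector and the height are irrelevant for the comparison of base points\<close>
    have "rot 0 (x, 0, 0) = rot \<theta> (fst p, 0, 0)"
      using x(2) by (simp add: rot_def zc_def)
    then have "(x, 0::real, 0::real) = (fst p, 0, 0)" "cis 0 = cis \<theta>"
      using rot_eq_rotD[of "(x, 0, 0)" "(fst p, 0, 0)" 0 \<theta>] \<open>x < 0\<close> link_nonpos[OF p(1)] by auto
    then have "p \<in> fibre c" "P = rot 0 p"
      using p x(1) rot_cong[of 0 \<theta> p] by (auto simp: fib)
    then show "P \<in> spin {0} (fibre c)"
      by (auto intro: rotI)
  next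
    fix P assume "P \<in> spin {0} (fibre c)"
    then obtain p where "p \<in> fibre c" "P = rot 0 p" by (auto elim: spinE)
    then show "P \<in> front_spin C A \<inter> fst -` spun_cell_locus (Radial c)"
      by (auto simp: fib front_spin_def intro: rotI)
  qed
qed

lemma spun_fibre_rotated:
  assumes "c \<in> link_cells" "c \<noteq> Vertex 0"
  shows "front_spin C A \<inter> fst -` spun_cell_locus (Rotated c) = rotated_sheet (fibre c)"
proof -
  have fib: "fibre c = link C A \<inter> fst -` cell_locus c"
    using assms(2) by (simp add: fibre_def sheet_locus_def)
  show ?thesis
  proof (intro equalityI subsetI)
    fix P assume P: "P \<in> front_spin C A \<inter> fst -` spun_cell_locus (Rotated c)"
    then obtain \<theta> p where p: "p \<in> link C A" "P = rot \<theta> p"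
      unfolding front_spin_def by (auto elim: spinE)
    obtain x \<theta>' where x: "x \<in> cell_locus c" "\<theta>' \<in> {0<..<2 * pi}"
      "cis \<theta> * of_real (fst p) = cis \<theta>' * of_real x"
      using P p(2) by auto
    have "x < 0" using x(1) cell_locus_neg[OF assms] by auto
    \<comment> \<open>only base points are compared, so the remaining coordinates are set to 0\<close>
    have "rot \<theta>' (x, 0, 0) = rot \<theta> (fst p, 0, 0)"
      using x(3) by (simp add: rot_def zc_def)
    then have "(x, 0::real, 0::real) = (fst p, 0, 0)" "cis \<theta>' = cis \<theta>"
      using rot_eq_rotD[of "(x, 0, 0)" "(fst p, 0, 0)" \<theta>' \<theta>] \<open>x < 0\<close> link_nonpos[OF p(1)] by auto
    then have "p \<in> fibre c" "P = rot \<theta>' p"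
      using p x(1) rot_cong[of \<theta>' \<theta> p] by (auto simp: fib)
    then show "P \<in> rotated_sheet (fibre c)"
      using x(2) by (auto intro: rotI)
  next
    fix P assume "P \<in> rotated_sheet (fibre c)"
    then obtain p \<theta> where *: "p \<in> fibre c" "\<theta> \<in> {0<..<2 * pi}" "P = rot \<theta> p" by (rule spinE)
    then have "fst P \<in> spun_cell_locus (Rotated c)"
      unfolding spun_cell_locus.simps fib by auto
    moreover have "P \<in> front_spin C A"
      using * by (auto simp: fib front_spin_def intro: rotI)
    ultimately show "P \<in> front_spin C A \<inter> fst -` spun_cell_locus (Rotated c)"
      by simp
  qed
qed

text \<open>
  In both cases the condition on the base point depends on its distance from the origin alone.
\<close>

lemma spun_fibre_origin:
  "front_spin C A \<inter> fst -` (if doubled (front_spin C A) \<noteq> {}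
     then {w. 0 < cmod w \<and> cmod w < - next_vertex V} else spun_cell_locus (Radial (Vertex 0))) =
   spin UNIV (fibre (Vertex 0))" (is "_ \<inter> fst -` ?L = _")
proof -
  have "fst (rot \<theta> p) \<in> ?L \<longleftrightarrow> fst p \<in> sheet_locus (Vertex 0)" if "p \<in> link C A" for \<theta> p
    using link_nonpos[OF that] doubled_front_spin_iff
    by (auto simp: sheet_locus_def norm_mult)
  then have "P \<in> front_spin C A \<inter> fst -` ?L \<longleftrightarrow> P \<in> spin UNIV (fibre (Vertex 0))" for P
    unfolding front_spin_def fibre_def by (auto simp only: spin_iff Int_iff vimage_eq) blast+
  then show ?thesis by blast
qed

lemma spin_inter_cusp_edges:
  assumes "S \<subseteq> link C A" "\<Theta> \<noteq> {}"
  shows "spin \<Theta> S \<inter> cusp_edges C A = {} \<longleftrightarrow> S \<inter> cusps C A = {}"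
  unfolding cusp_edges_def using assms link_nonpos cusps_neg
  by (intro spin_inter_eq_empty_iff) auto

lemma sheets_Y_radial:
  assumes "c \<in> link_cells"
  shows "sheets Y (Radial c) = radial_sheet c ` sheets X c"
proof -
  let ?\<Theta> = "if c = Vertex 0 then UNIV else {0::real}"
  have "sheets Y (Radial c) =
      {S \<in> components (radial_sheet c (fibre c)). S \<inter> cusp_edges C A = {}}"
    using spun_fibre_radial[OF assms] spun_fibre_origin
    by (cases "c = Vertex 0")
      (simp_all add: surface_complex_def sheets_above_def radial_sheet_def)
  also have "components (radial_sheet c (fibre c)) = radial_sheet c ` components (fibre c)"
  proof (cases "c \<noteq> Vertex 0 \<or> doubled (link C A) \<noteq> {}")
    case True
    then show ?thesis
      unfolding radial_sheet_def by (intro components_spin fibre_neg[OF assms]) auto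
  next
    case False
    then show ?thesis
      unfolding radial_sheet_def using fibre_axis components_spin_axis by auto
  qed
  also have "{S \<in> radial_sheet c ` components (fibre c). S \<inter> cusp_edges C A = {}} =
      radial_sheet c ` sheets X c"
  proof -
    have "radial_sheet c S \<inter> cusp_edges C A = {} \<longleftrightarrow> S \<inter> cusps C A = {}"
      if "S \<in> components (fibre c)" for S
      unfolding radial_sheet_def using in_components_subset[OF that]
      by (intro spin_inter_cusp_edges) (auto simp: fibre_def)
    then show ?thesis by (auto simp: sheets_X)
  qed
  finally show ?thesis .
qed

lemma sheets_Y_rotated:
  assumes "c \<in> link_cells" "c \<noteq> Vertex 0"
  shows "sheets Y (Rotated c) = rotated_sheet ` sheets X c"
proof -
  have "sheets Y (Rotated c) =
      {S \<in> components (rotated_sheet (fibre c)). S \<inter> cusp_edges C A = {}}"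
    using spun_fibre_rotated[OF assms]
    by (simp add: surface_complex_def sheets_above_def)
  also have "components (rotated_sheet (fibre c)) = rotated_sheet ` components (fibre c)"
    using assms by (intro components_spin fibre_neg turn_nonempty) auto
  also have "{S \<in> rotated_sheet ` components (fibre c). S \<inter> cusp_edges C A = {}} =
      rotated_sheet ` sheets X c"
  proof -
    have "rotated_sheet S \<inter> cusp_edges C A = {} \<longleftrightarrow> S \<inter> cusps C A = {}"
      if "S \<in> components (fibre c)" for S
      using in_components_subset[OF that]
      by (intro spin_inter_cusp_edges turn_nonempty) (auto simp: fibre_def)
    then show ?thesis by (auto simp: sheets_X)
  qed
  finally show ?thesis .
qed

lemma bij_radial_sheet:
  assumes "c \<in> link_cells"
  shows "bij_betw (radial_sheet c) (sheets X c) (sheets Y (Radial c))"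
  unfolding sheets_Y_radial[OF assms]
proof (rule inj_on_imp_bij_betw)
  show "inj_on (radial_sheet c) (sheets X c)"
  proof (cases "c \<noteq> Vertex 0 \<or> doubled (link C A) \<noteq> {}")
    case True
    then show ?thesis
      unfolding radial_sheet_def
      by (intro inj_on_subset[OF inj_on_spin]) (use sheet_neg[OF _ assms] in auto)
  next
    case False
    then have "S \<subseteq> z_axis" if "S \<in> sheets X c" for S
      using that sheet_axis by auto
    then have *: "radial_sheet c S = spin {0} S" if "S \<in> sheets X c" for S
      using that False spin_axis[of S UNIV] by (simp add: radial_sheet_def)
    show ?thesis
    proof (rule inj_onI)
      fix S T assume "S \<in> sheets X c" "T \<in> sheets X c" "radial_sheet c S = radial_sheet c T"
      then have "spin {0} S = spin {0} T" by (simp only: *)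
      then show "S = T"
        using spin_0_subset_iff[of S T] spin_0_subset_iff[of T S] by blast
    qed
  qed
qed

lemma bij_rotated_sheet:
  assumes "c \<in> link_cells" "c \<noteq> Vertex 0"
  shows "bij_betw rotated_sheet (sheets X c) (sheets Y (Rotated c))"
  unfolding sheets_Y_rotated[OF assms]
  by (intro inj_on_imp_bij_betw inj_on_subset[OF inj_on_spin] turn_nonempty)
    (use sheet_neg[OF _ assms(1)] assms(2) in auto)

lemma prec_radial_sheet:
  assumes "c \<in> link_cells" "S \<in> sheets X c" "T \<in> sheets X c"
  shows "prec Y (Radial c) (radial_sheet c S) (radial_sheet c T) \<longleftrightarrow> prec X c S T"
    and "z_above (radial_sheet c S) (radial_sheet c T) \<longleftrightarrow> z_above S T"
    and "c = Vertex 0 \<Longrightarrow> joined (radial_sheet c S) (radial_sheet c T) \<longleftrightarrow> joined S T"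
proof -
  show z: "z_above (radial_sheet c S) (radial_sheet c T) \<longleftrightarrow> z_above S T"
  proof (cases "c \<noteq> Vertex 0 \<or> doubled (link C A) \<noteq> {}")
    case True
    then show ?thesis
      unfolding radial_sheet_def using assms by (intro z_above_spin_iff sheet_neg) auto
  next
    case False
    then show ?thesis
      unfolding radial_sheet_def using assms sheet_axis by (auto intro!: z_above_spin_axis_iff)
  qed
  show j: "c = Vertex 0 \<Longrightarrow> joined (radial_sheet c S) (radial_sheet c T) \<longleftrightarrow> joined S T"
    using assms sheetsD(6) by (simp add: radial_sheet_def joined_spin_UNIV_iff)
  from z j show "prec Y (Radial c) (radial_sheet c S) (radial_sheet c T) \<longleftrightarrow> prec X c S T"
    by (auto simp: link_complex_def surface_complex_def)
qed

lemma prec_rotated_sheet: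
  assumes "c \<in> link_cells" "c \<noteq> Vertex 0" "S \<in> sheets X c" "T \<in> sheets X c"
  shows "prec Y (Rotated c) (rotated_sheet S) (rotated_sheet T) \<longleftrightarrow> prec X c S T"
proof -
  have "z_above (rotated_sheet S) (rotated_sheet T) \<longleftrightarrow> z_above S T"
    using assms by (intro z_above_spin_iff sheet_neg turn_nonempty) auto
  with assms(2) show ?thesis
    by (auto simp: link_complex_def surface_complex_def)
qed

lemma fibre_Edge_0: "Edge u 0 \<in> link_cells \<Longrightarrow> doubled (link C A) \<noteq> {} \<Longrightarrow> fibre (Edge u 0) = fibre (Vertex 0)"
  using next_vertex_Edge by (auto simp: fibre_def sheet_locus_def)

lemma sheets_Edge_0: "Edge u 0 \<in> link_cells \<Longrightarrow> doubled (link C A) \<noteq> {} \<Longrightarrow> sheets X (Edge u 0) = sheets X (Vertex 0)"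
  by (simp add: sheets_X fibre_Edge_0)

text \<open>
  This is applied to the origin when its sheets are those of the adjacent 1-cell.
\<close>

lemma ends_in_same_cell:
  assumes "S \<in> sheets X c" "T \<in> sheets X c"
  shows "ends_in S T \<longleftrightarrow> T = S"
  using component_subset_closure_iff[OF sheetsD(1)[OF assms(1)] sheetsD(1)[OF assms(2)]]
    component_subset_iff[OF sheetsD(1)[OF assms(1)] sheetsD(1)[OF assms(2)]]
  by (auto simp: ends_in_def)

lemma edge_sheet_not_subset:
  assumes "S \<in> sheets X (Edge u v)" "T \<in> sheets X (Vertex w)" "w \<in> {u, v}"
    "w \<noteq> 0 \<or> doubled (link C A) = {}"
  shows "\<not> S \<subseteq> T"
proof
  assume "S \<subseteq> T"
  obtain p where "p \<in> S" using sheetsD(4)[OF assms(1)] by blast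
  then have "p \<in> fibre (Edge u v)" "p \<in> fibre (Vertex w)"
    using sheetsD(2)[OF assms(1)] sheetsD(2)[OF assms(2)] \<open>S \<subseteq> T\<close> by blast+
  then have "fst p \<in> {u<..<v}" "fst p = w"
    using assms(4) by (auto simp: fibre_def sheet_locus_def)
  with assms(3) show False by auto
qed

text \<open>
  Three cases have to be distinguished. Above a vertex away from the origin the rotations act freely on
  the end \<open>T\<close>. Above the origin without matching ends \<open>T\<close> is a fixed point. Above the origin with
  matching ends \<open>S\<close> and \<open>T\<close> are sheets above the same interval, and \<open>S\<close> ends in \<open>T\<close> only if they are
  equal.
\<close>

lemma ends_in_spun_vertex:
  assumes e: "Edge u v \<in> link_cells" and w: "w \<in> {u, v}"
    and S: "S \<in> sheets X (Edge u v)" and T: "T \<in> sheets X (Vertex w)"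
  shows ends_in_radial_radial:
      "ends_in (radial_sheet (Edge u v) S) (radial_sheet (Vertex w) T) \<longleftrightarrow> ends_in S T"
    and ends_in_rotated_radial:
      "ends_in (rotated_sheet S) (radial_sheet (Vertex w) T) \<longleftrightarrow> ends_in S T"
    and ends_in_rotated_rotated:
      "w \<noteq> 0 \<Longrightarrow> ends_in (rotated_sheet S) (rotated_sheet T) \<longleftrightarrow> ends_in S T"
proof -
  have wc: "Vertex w \<in> link_cells" using w EdgeD(8,9)[OF e] by auto
  have Sneg: "S \<subseteq> {p. fst p < 0}" using sheet_neg[OF S e] by auto
  have Snonpos: "S \<subseteq> {p. fst p \<le> 0}" and Tnonpos: "T \<subseteq> {p. fst p \<le> 0}"
    using sheetsD(3)[OF S] sheetsD(3)[OF T] link_nonpos by blast+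
  note cS = sheetsD(9)[OF S] and bS = sheetsD(6)[OF S] and bT = sheetsD(6)[OF T]
  note pi = pi_in_turn and ne = turn_nonempty
  have sub0: "{0} \<subseteq> (UNIV :: real set)" "{0<..<2 * pi} \<subseteq> (UNIV :: real set)"
    by auto
  have rS: "radial_sheet (Edge u v) S = spin {0} S"
    by (simp add: radial_sheet_def)
  consider "w \<noteq> 0" | "w = 0" "doubled (link C A) = {}" | "w = 0" "doubled (link C A) \<noteq> {}"
    by blast
  then have "(ends_in (spin {0} S) (radial_sheet (Vertex w) T) \<longleftrightarrow> ends_in S T) \<and>
    (ends_in (rotated_sheet S) (radial_sheet (Vertex w) T) \<longleftrightarrow> ends_in S T) \<and>
    (w \<noteq> 0 \<longrightarrow> (ends_in (rotated_sheet S) (rotated_sheet T) \<longleftrightarrow> ends_in S T))"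
  proof cases
    case 1
    then have rT: "radial_sheet (Vertex w) T = spin {0} T"
      by (simp add: radial_sheet_def)
    have Tneg: "T \<subseteq> {p. fst p < 0}" using sheet_neg[OF T wc] 1 by auto
    show ?thesis
      unfolding rT ends_in_def closure_spin_0[OF bS] closure_spin_interval[OF bS]
      using spin_subset_spin_iff[OF Tneg cS _ sub0(1)] spin_subset_spin_iff[OF Tneg cS ne sub0(2)]
        spin_subset_spin_iff[OF Sneg Tnonpos ne order_refl]
        not_spin_subset_spin_0[OF pi sheetsD(4)[OF S] Sneg Tnonpos]
        edge_sheet_not_subset[OF S T w]
      by (auto simp: 1 spin_0_subset_iff)
  next
    case 2
    have ax: "T \<subseteq> z_axis" using sheet_axis T 2 by auto
    have rT: "radial_sheet (Vertex w) T = spin {0} T"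
      using 2(1) spin_axis[OF ax UNIV_not_empty] by (simp add: radial_sheet_def)
    have axS: "closure S \<inter> {p. fst p = 0} \<subseteq> z_axis"
      using link_axis[OF 2(2)] sheetsD(8)[OF S] by blast
    show ?thesis
      unfolding rT ends_in_def closure_spin_0[OF bS] closure_spin_interval[OF bS]
      using spin_axis_subset_iff[OF ax axS _ sub0(1)]
        not_spin_subset_spin_0[OF pi sheetsD(4)[OF S] Sneg Tnonpos]
        edge_sheet_not_subset[OF S T w]
      by (auto simp: 2 spin_0_subset_iff)
  next
    case 3
    then have "v = 0" using w EdgeD(5)[OF e] by auto
    then have S': "S \<in> sheets X (Vertex w)"
      using S e 3 sheets_Edge_0 by auto
    have rT: "radial_sheet (Vertex w) T = spin UNIV T"
      using 3 by (simp add: radial_sheet_def)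
    have Tneg: "T \<subseteq> {p. fst p < 0}" using sheet_neg[OF T wc] 3 by auto
    have UN: "(UNIV :: real set) \<noteq> {}" by simp
    show ?thesis
      unfolding rT ends_in_same_cell[OF S' T]
      unfolding ends_in_def closure_spin_0[OF bS] closure_spin_interval[OF bS]
      using spin_subset_spin_iff[OF Tneg cS UN order_refl] spin_subset_spin_iff[OF Sneg Tnonpos _ sub0(1)]
        spin_subset_spin_iff[OF Sneg Tnonpos ne sub0(2)]
        not_spin_subset_spin_0[OF UNIV_I sheetsD(4)[OF T] Tneg cS]
        component_subset_closure_iff[OF sheetsD(1)[OF S'] sheetsD(1)[OF T]]
        component_subset_iff[OF sheetsD(1)[OF S'] sheetsD(1)[OF T]]
      by (auto simp: 3)
  qed
  then show "ends_in (radial_sheet (Edge u v) S) (radial_sheet (Vertex w) T) \<longleftrightarrow> ends_in S T"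
    "ends_in (rotated_sheet S) (radial_sheet (Vertex w) T) \<longleftrightarrow> ends_in S T"
    "w \<noteq> 0 \<Longrightarrow> ends_in (rotated_sheet S) (rotated_sheet T) \<longleftrightarrow> ends_in S T"
    unfolding rS by blast+
qed

text \<open>
  The slit along the radial cell cuts a swept-out sheet precisely at the sheet from which it was made.
\<close>

lemma ends_in_rotated_radial_same:
  assumes c: "c \<in> link_cells" "c \<noteq> Vertex 0" and S: "S \<in> sheets X c" and T: "T \<in> sheets X c"
  shows "ends_in (rotated_sheet S) (radial_sheet c T) \<longleftrightarrow> T = S"
proof -
  have neg: "S \<subseteq> {p. fst p < 0}" "T \<subseteq> {p. fst p < 0}"
    using sheet_neg S T c by auto
  have Tnonpos: "T \<subseteq> {p. fst p \<le> 0}"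
    using sheetsD(3)[OF T] link_nonpos by blast
  note pi = pi_in_turn
  show ?thesis
    using c(2) spin_subset_spin_iff[OF neg(2) sheetsD(9)[OF S], of "{0}" UNIV]
      not_spin_subset_spin_0[OF pi sheetsD(4)[OF S] neg(1) Tnonpos]
      component_subset_closure_iff[OF sheetsD(1)[OF S] sheetsD(1)[OF T]]
    by (simp add: ends_in_def radial_sheet_def closure_spin_interval[OF sheetsD(6)[OF S]])
qed

text \<open>
  Rotations act freely at cusps, so a cusp edge point in the closures of two swept-out sheets comes from a
  common cusp.
\<close>

lemma spun_cusps_meet_iff:
  assumes "0 \<in> \<Theta>" "S \<subseteq> {p. fst p \<le> 0}" "S' \<subseteq> {p. fst p \<le> 0}" "w \<le> 0"
  shows "spin \<Theta> S \<inter> spin \<Theta> S' \<inter> cusps_over Y (Radial (Vertex w)) \<noteq> {} \<longleftrightarrow>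
         S \<inter> S' \<inter> cusps_over X (Vertex w) \<noteq> {}"
proof
  assume "spin \<Theta> S \<inter> spin \<Theta> S' \<inter> cusps_over Y (Radial (Vertex w)) \<noteq> {}"
  then obtain P where P: "P \<in> spin \<Theta> S" "P \<in> spin \<Theta> S'" "P \<in> cusp_edges C A" "fst P = of_real w"
    by (auto simp: surface_complex_def)
  obtain \<theta> q where q: "q \<in> cusps C A" "P = rot \<theta> q"
    using P(3) unfolding cusp_edges_def by (rule spinE)
  have neg: "fst q < 0" using q(1) by (rule cusps_neg)
  have "q \<in> R" if R: "P \<in> spin \<Theta> R" "R \<subseteq> {p. fst p \<le> 0}" for R
  proof -
    obtain \<theta>' p where p: "p \<in> R" "P = rot \<theta>' p" using R(1) by (rule spinE)
    have "fst p \<le> 0" using p(1) R(2) by auto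
    then have "q = p" using rot_eq_rotD(1)[OF neg] q(2) p(2) by metis
    with p(1) show ?thesis by simp
  qed
  then have "q \<in> S" "q \<in> S'" using P(1,2) assms(2,3) by auto
  moreover have "\<bar>fst q\<bar> = \<bar>w\<bar>"
    using arg_cong[OF P(4), of cmod] q(2) by (simp add: norm_mult)
  then have "fst q = w" using neg assms(4) by auto
  ultimately show "S \<inter> S' \<inter> cusps_over X (Vertex w) \<noteq> {}"
    using q(1) by (auto simp: link_complex_def)
next
  assume "S \<inter> S' \<inter> cusps_over X (Vertex w) \<noteq> {}"
  then obtain q where q: "q \<in> S" "q \<in> S'" "q \<in> cusps C A" "fst q = w"
    by (auto simp: link_complex_def)
  then have "rot 0 q \<in> spin \<Theta> S" "rot 0 q \<in> spin \<Theta> S'" "rot 0 q \<in> cusp_edges C A"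
    "fst (rot 0 q) = of_real w"
    using assms(1) by (auto simp: cusp_edges_def intro: rotI)
  then show "spin \<Theta> S \<inter> spin \<Theta> S' \<inter> cusps_over Y (Radial (Vertex w)) \<noteq> {}"
    by (auto simp: surface_complex_def)
qed

lemma cusp_block_radial:
  assumes e: "Edge u v \<in> link_cells" and w: "w \<in> {u, v}"
    and S: "S \<in> sheets X (Edge u v)" and S': "S' \<in> sheets X (Edge u v)"
  shows "closure (radial_sheet (Edge u v) S) \<inter> closure (radial_sheet (Edge u v) S') \<inter>
           cusps_over Y (Radial (Vertex w)) \<noteq> {} \<longleftrightarrow>
         closure S \<inter> closure S' \<inter> cusps_over X (Vertex w) \<noteq> {}"
    and "closure (rotated_sheet S) \<inter> closure (rotated_sheet S') \<inter>
           cusps_over Y (Radial (Vertex w)) \<noteq> {} \<longleftrightarrow>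
         closure S \<inter> closure S' \<inter> cusps_over X (Vertex w) \<noteq> {}"
proof -
  have "w \<le> 0" using w EdgeD(4,5)[OF e] by auto
  note iff = spun_cusps_meet_iff[OF _ sheetsD(9)[OF S] sheetsD(9)[OF S'] this]
  note closure = closure_spin_0 closure_spin_interval sheetsD(6)[OF S] sheetsD(6)[OF S']
  show "closure (radial_sheet (Edge u v) S) \<inter> closure (radial_sheet (Edge u v) S') \<inter>
      cusps_over Y (Radial (Vertex w)) \<noteq> {} \<longleftrightarrow>
      closure S \<inter> closure S' \<inter> cusps_over X (Vertex w) \<noteq> {}"
    using iff[of "{0}"] by (simp add: radial_sheet_def closure)
  show "closure (rotated_sheet S) \<inter> closure (rotated_sheet S') \<inter>
      cusps_over Y (Radial (Vertex w)) \<noteq> {} \<longleftrightarrow>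
      closure S \<inter> closure S' \<inter> cusps_over X (Vertex w) \<noteq> {}"
    using iff[of UNIV] by (simp add: closure)
qed

text \<open>
  Closing up a sheet above a circle adds only rotated copies of its own points, and cusp edges are
  invariant under rotations.
\<close>

lemma no_cusp_block_rotated_vertex:
  assumes v: "Vertex v \<in> link_cells" "v \<noteq> 0" and S: "S \<in> sheets X (Vertex v)" and S': "S' \<in> sheets X (Vertex v)"
  shows "closure (rotated_sheet S) \<inter> closure (rotated_sheet S') \<inter> cusps_over Y (Radial (Vertex v)) = {}"
proof -
  have "closed (fst -` {v} :: jet1 set)"
    by (intro closed_vimage) (auto intro: continuous_intros)
  then have "closed (fibre (Vertex v))"
    using v(2) compact_link by (auto simp: fibre_def sheet_locus_def intro: compact_imp_closed)
  then have "closure S = S"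
    using closed_components[OF _ sheetsD(1)[OF S]] by (simp add: closure_closed)
  then have "closure S \<inter> closure S' \<inter> cusps_over X (Vertex v) = {}"
    using sheetsD(7)[OF S] by (auto simp: link_complex_def)
  then show ?thesis
    using spun_cusps_meet_iff[of UNIV "closure S" "closure S'" v] sheetsD(6,9)[OF S] sheetsD(6,9)[OF S']
      V_nonpos[OF VertexD[OF v(1)]]
    by (simp add: closure_spin_interval)
qed

end

section \<open>Sheets near the origin and the matrix U\<close>

context spinnable_front
begin

lemma finite_link_over_0: "finite (link C A \<inter> {p. fst p = 0})"
proof (rule finite_subset)
  show "link C A \<inter> {p. fst p = 0} \<subseteq> (\<lambda>\<gamma>. \<gamma> 0) ` A \<union> (\<lambda>\<gamma>. \<gamma> 1) ` A"
  proof
    fix p assume "p \<in> link C A \<inter> {p. fst p = 0}"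
    then have "p \<in> link C A" "fst p = 0" by simp_all
    then obtain \<gamma> e where "\<gamma> \<in> A" "e = 0 \<or> e = 1" "p = \<gamma> e" by (rule link_over_0E)
    then show "p \<in> (\<lambda>\<gamma>. \<gamma> 0) ` A \<union> (\<lambda>\<gamma>. \<gamma> 1) ` A" by blast
  qed
qed (use finite_curves in auto)

text \<open>
  At most two arcs end at the same front point.
\<close>

lemma no_triple_ends:
  assumes "p \<in> link C A" "q \<in> link C A" "r \<in> link C A" "fst p = 0"
    "front q = front p" "front r = front p"
  shows "p = q \<or> q = r \<or> p = r"
proof (rule ccontr)
  assume "\<not> (p = q \<or> q = r \<or> p = r)"
  then have "card {p, q, r} = 3" by auto
  have arc: "s \<in> link {} A" if "s \<in> link C A" "fst s = 0" for s
  proof -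
    obtain \<gamma> e where "\<gamma> \<in> A" "e = 0 \<or> e = 1" "s = \<gamma> e"
      by (rule link_over_0E[OF \<open>s \<in> link C A\<close> \<open>fst s = 0\<close>])
    then show ?thesis unfolding link_def by (intro UN_I[of \<gamma>]) auto
  qed
  let ?F = "{s \<in> link {} A. front s = front p}"
  have "link {} A \<subseteq> link C A" by (auto simp: link_def)
  then have "?F \<subseteq> link C A \<inter> {p. fst p = 0}"
    using assms(4) by (auto simp: front_def)
  then have "finite ?F" using finite_link_over_0 finite_subset by blast
  moreover have "{p, q, r} \<subseteq> ?F"
    using assms arc by (auto simp: front_def)
  ultimately have "card {p, q, r} \<le> card ?F"
    by (rule card_mono)
  moreover have "card ?F \<le> 2"
    using spinnable arc[OF assms(1,4)] assms(4) unfolding front_spinnable_def by meson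
  ultimately show False using \<open>card {p, q, r} = 3\<close> by simp
qed

end

context decomposed_front
begin

lemma sheet_at_originE:
  assumes d: "doubled (link C A) \<noteq> {}" and S: "S \<in> sheets X (Vertex 0)"
  obtains \<sigma> where "next_vertex V < 0" "continuous_on {next_vertex V..0} \<sigma>"
    "\<And>x. x \<in> {next_vertex V..0} \<Longrightarrow> fst (\<sigma> x) = x" "\<sigma> 0 \<in> link C A"
    "S = \<sigma> ` {next_vertex V<..<0}"
    "\<And>p. p \<in> closure S \<Longrightarrow> fst p = 0 \<Longrightarrow> p = \<sigma> 0" "\<sigma> 0 \<in> closure S"
proof -
  let ?u = "next_vertex V"
  have fib: "fibre (Vertex 0) = link C A \<inter> fst -` {?u<..<0}"
    using d by (simp add: fibre_def sheet_locus_def)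
  obtain p where "p \<in> S" using sheetsD(4)[OF S] by blast
  then have u: "?u < 0" using sheetsD(2)[OF S] unfolding fib by force
  have nocusp: "fst p \<notin> {?u<..<0}" if "p \<in> cusps C A" for p
    using cusps_over_V[OF that] next_vertex_gap by blast
  obtain \<sigma> where \<sigma>: "continuous_on {?u..0} \<sigma>" "\<And>x. x \<in> {?u..0} \<Longrightarrow> fst (\<sigma> x) = x"
    "\<sigma> ` {?u..0} \<subseteq> link C A" "S = \<sigma> ` {?u<..<0}" "closure S = \<sigma> ` {?u..0}"
    using sheet_over_edge[OF u order_refl nocusp] sheetsD(1)[OF S] unfolding fib by metis
  show thesis
  proof (rule that[OF u \<sigma>(1,2) _ \<sigma>(4)])
    show "\<sigma> 0 \<in> link C A" "\<sigma> 0 \<in> closure S"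
      using u \<sigma>(3) \<sigma>(5) by auto
    show "p = \<sigma> 0" if "p \<in> closure S" "fst p = 0" for p
      using that \<sigma>(2) unfolding \<sigma>(5) by auto
  qed
qed

text \<open>
  The unique point over the origin to which the sheet extends.
\<close>

definition sheet_end :: "jet1 set \<Rightarrow> jet1" where
  "sheet_end S = (THE p. p \<in> closure S \<and> fst p = 0)"

lemma sheet_end:
  assumes d: "doubled (link C A) \<noteq> {}" and S: "S \<in> sheets X (Vertex 0)"
  shows "sheet_end S \<in> closure S" "fst (sheet_end S) = 0" "sheet_end S \<in> link C A"
    "p \<in> closure S \<Longrightarrow> fst p = 0 \<Longrightarrow> p = sheet_end S"
proof -
  obtain \<sigma> where \<sigma>: "next_vertex V < 0"
    "\<And>x. x \<in> {next_vertex V..0} \<Longrightarrow> fst (\<sigma> x) = x" "\<sigma> 0 \<in> link C A"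
    "\<And>p. p \<in> closure S \<Longrightarrow> fst p = 0 \<Longrightarrow> p = \<sigma> 0" "\<sigma> 0 \<in> closure S"
    by (rule sheet_at_originE[OF d S]) blast
  have f: "fst (\<sigma> 0) = 0" using \<sigma>(1,2) by auto
  have "sheet_end S = \<sigma> 0"
    unfolding sheet_end_def by (rule the_equality) (use \<sigma>(4,5) f in blast)+
  then show "sheet_end S \<in> closure S" "fst (sheet_end S) = 0" "sheet_end S \<in> link C A"
    "p \<in> closure S \<Longrightarrow> fst p = 0 \<Longrightarrow> p = sheet_end S"
    using \<sigma>(5) f \<sigma>(3) \<sigma>(4)[of p] by metis+
qed

lemma joined_iff_same_end_front:
  assumes d: "doubled (link C A) \<noteq> {}" and S: "S \<in> sheets X (Vertex 0)" and T: "T \<in> sheets X (Vertex 0)"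
  shows "joined S T \<longleftrightarrow> front (sheet_end S) = front (sheet_end T)"
proof
  assume "joined S T"
  then obtain p q where pq: "p \<in> closure S" "q \<in> closure T" "fst p = 0" "front p = front q"
    by (auto simp: joined_def)
  then have "fst q = 0" by (simp add: front_def)
  with pq sheet_end(4)[OF d S pq(1)] sheet_end(4)[OF d T pq(2)]
  show "front (sheet_end S) = front (sheet_end T)" by simp
next
  assume "front (sheet_end S) = front (sheet_end T)"
  with sheet_end(1,2)[OF d S] sheet_end(1)[OF d T] show "joined S T"
    unfolding joined_def by blast
qed

lemma sheet_end_inj:
  assumes d: "doubled (link C A) \<noteq> {}" and S: "S \<in> sheets X (Vertex 0)" and T: "T \<in> sheets X (Vertex 0)"
    and "sheet_end S = sheet_end T"
  shows "S = T"
proof -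
  have fib: "fibre (Vertex 0) = link C A \<inter> fst -` {next_vertex V<..<0}"
    using d by (simp add: fibre_def sheet_locus_def)
  have "next_vertex V < 0"
    by (rule sheet_at_originE[OF d S])
  then show ?thesis
    using sheets_with_common_end[of S "next_vertex V" T "sheet_end S"] sheetsD(1)[OF S] sheetsD(1)[OF T]
      sheet_end(1,2)[OF d S] sheet_end(1)[OF d T] assms(4)
    unfolding fib by simp
qed

text \<open>
  Finiteness matters here: sums over infinite sets vanish, so with infinitely many sheets the product
  defining \<open>U\<close> would not have the unit diagonal.
\<close>

lemma finite_sheets_at_origin:
  assumes d: "doubled (link C A) \<noteq> {}"
  shows "finite (sheets X (Vertex 0))"
proof (rule inj_on_finite[OF _ _ finite_link_over_0])
  show "inj_on sheet_end (sheets X (Vertex 0))"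
    using sheet_end_inj[OF d] by (rule inj_onI)
  show "sheet_end ` sheets X (Vertex 0) \<subseteq> link C A \<inter> {p. fst p = 0}"
    using sheet_end(2,3)[OF d] by auto
qed

lemma z_above_irrefl: "S \<in> sheets X c \<Longrightarrow> \<not> z_above S S"
  using sheetsD(4) by (force simp: z_above_def)

text \<open>
  Each sheet has a point over every point of the interval, so heights can be compared through the middle
  sheet.
\<close>

lemma z_above_trans_at_origin:
  assumes d: "doubled (link C A) \<noteq> {}" and S: "S \<in> sheets X (Vertex 0)" and R: "R \<in> sheets X (Vertex 0)"
    and T: "T \<in> sheets X (Vertex 0)" and above: "z_above S R" "z_above R T"
  shows "z_above S T"
  unfolding z_above_def
proof (intro ballI impI)
  fix p q assume pq: "p \<in> S" "q \<in> T" "fst p = fst q"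
  obtain \<sigma> where \<sigma>: "\<And>x. x \<in> {next_vertex V..0} \<Longrightarrow> fst (\<sigma> x) = x" "R = \<sigma> ` {next_vertex V<..<0}"
    by (rule sheet_at_originE[OF d R]) blast
  have "fst p \<in> {next_vertex V<..<0}"
    using pq(1) sheetsD(2)[OF S] d by (auto simp: fibre_def sheet_locus_def)
  then have "\<sigma> (fst p) \<in> R" "fst (\<sigma> (fst p)) = fst p"
    using \<sigma> by auto
  then show "zc q < zc p"
    using above pq unfolding z_above_def by (metis order.strict_trans)
qed

lemma sheet_end_mono:
  assumes d: "doubled (link C A) \<noteq> {}" and S: "S \<in> sheets X (Vertex 0)" and T: "T \<in> sheets X (Vertex 0)"
    and above: "z_above S T"
  shows "zc (sheet_end T) \<le> zc (sheet_end S)"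
proof -
  let ?u = "next_vertex V"
  obtain \<sigma> where \<sigma>: "?u < 0" "continuous_on {?u..0} \<sigma>" "\<And>x. x \<in> {?u..0} \<Longrightarrow> fst (\<sigma> x) = x"
    "S = \<sigma> ` {?u<..<0}" "\<sigma> 0 \<in> closure S"
    by (rule sheet_at_originE[OF d S]) blast
  obtain \<tau> where \<tau>: "continuous_on {?u..0} \<tau>" "\<And>x. x \<in> {?u..0} \<Longrightarrow> fst (\<tau> x) = x"
    "T = \<tau> ` {?u<..<0}" "\<tau> 0 \<in> closure T"
    by (rule sheet_at_originE[OF d T]) blast
  have ends: "sheet_end S = \<sigma> 0" "sheet_end T = \<tau> 0"
    using sheet_end(4)[OF d S \<sigma>(5)] sheet_end(4)[OF d T \<tau>(4)] \<sigma>(1,3) \<tau>(2) by auto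
  have cont: "continuous_on {?u..0} (\<lambda>x. zc (\<sigma> x) - zc (\<tau> x))"
    unfolding zc_def using \<sigma>(2) \<tau>(1) by (intro continuous_intros)
  have "zc (\<sigma> x) - zc (\<tau> x) \<in> {0..}" if "x \<in> {?u<..<0}" for x
    using that above \<sigma>(3,4) \<tau>(2,3) unfolding z_above_def by (auto simp: less_imp_le)
  then have "(\<lambda>x. zc (\<sigma> x) - zc (\<tau> x)) ` {?u<..<0} \<subseteq> {0..}" by blast
  then have "(\<lambda>x. zc (\<sigma> x) - zc (\<tau> x)) ` closure {?u<..<0} \<subseteq> {0..}"
    using cont \<sigma>(1) by (intro image_closure_subset) auto
  moreover have "0 \<in> closure {?u<..<0}" using \<sigma>(1) by simp
  ultimately have "zc (\<sigma> 0) - zc (\<tau> 0) \<in> {0..}" by blast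
  then show ?thesis by (simp add: ends)
qed

text \<open>
  By squeezing, the end of a sheet between two joined sheets has the same front as theirs. At most two
  points of the link share a front point over the origin, and sheets with a common end are equal.
\<close>

lemma no_sheet_between_joined:
  assumes d: "doubled (link C A) \<noteq> {}" and S: "S \<in> sheets X (Vertex 0)" and R: "R \<in> sheets X (Vertex 0)"
    and T: "T \<in> sheets X (Vertex 0)" and above: "z_above S R" "z_above R T"
  shows "\<not> joined S T"
proof
  assume "joined S T"
  then have "front (sheet_end S) = front (sheet_end T)"
    using joined_iff_same_end_front[OF d S T] by simp
  moreover have "zc (sheet_end T) \<le> zc (sheet_end R)" "zc (sheet_end R) \<le> zc (sheet_end S)"
    using sheet_end_mono[OF d] S R T above by auto
  ultimately have "front (sheet_end R) = front (sheet_end S)" "front (sheet_end T) = front (sheet_end S)"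
    using sheet_end(2)[OF d] S R T by (auto simp: front_def)
  then have "sheet_end S = sheet_end R \<or> sheet_end R = sheet_end T \<or> sheet_end S = sheet_end T"
    using no_triple_ends sheet_end(2,3)[OF d] S R T by blast
  then have "S = R \<or> R = T \<or> S = T"
    using sheet_end_inj[OF d] S R T by blast
  then show False
    using above z_above_trans_at_origin[OF d S R T above] z_above_irrefl S R T by blast
qed

lemma joined_trans_at_origin:
  assumes d: "doubled (link C A) \<noteq> {}" and "S \<in> sheets X (Vertex 0)" "R \<in> sheets X (Vertex 0)"
    "T \<in> sheets X (Vertex 0)" "joined S R" "joined R T"
  shows "joined S T"
  using assms joined_iff_same_end_front[OF d] by simp

lemma joined_pairsD:
  assumes "(k, k') \<in> joined_pairs X (Vertex 0)"
  shows "k \<in> sheets X (Vertex 0)" "k' \<in> sheets X (Vertex 0)" "z_above k k'" "joined k k'"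
  using assms by (auto simp: joined_pairs_def)

lemma gen_mat_origin:
  assumes "Vertex 0 \<in> link_cells" "S \<in> sheets X (Vertex 0)" "T \<in> sheets X (Vertex 0)"
  shows "(Vertex 0, S, T) \<in> generators X \<longleftrightarrow> z_above S T \<and> \<not> joined S T"
  using assms by (auto simp: generators_def) (simp_all add: link_complex_def)

text \<open>
  An off-diagonal entry of a factor is nonzero only at positions \<open>(\<ell>, k)\<close> and \<open>(k', \<ell>)\<close> with
  \<open>\<ell>\<close> above \<open>k\<close> and \<open>\<ell>\<close> below \<open>k'\<close> respectively, so products of factors are unitriangular and vanish at
  unrelated sheets. If \<open>S\<close> and \<open>T\<close> are joined, then a contribution to the entry at \<open>(S, T)\<close> would either
  pass through a sheet between them, or have \<open>T = k\<close> or \<open>S = k'\<close>. In the last two cases three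
  different sheets are joined, one of which lies between the others.
\<close>

lemma U_mat_eq_mat_id:
  assumes d: "doubled (link C A) \<noteq> {}" and v: "Vertex 0 \<in> link_cells"
    and ks: "set ks \<subseteq> joined_pairs X (Vertex 0)"
    and "S \<in> sheets X (Vertex 0)" "T \<in> sheets X (Vertex 0)" "(Vertex 0, S, T) \<notin> generators X"
  shows "U_mat X (Vertex 0) ks S T = mat_id S T"
  using ks assms(4-6)
proof (induction ks arbitrary: S T rule: rev_induct)
  case Nil
  then show ?case by (simp add: U_mat_def)
next
  case (snoc kk ks)
  let ?I = "sheets X (Vertex 0)" and ?G = "gen_mat X (Vertex 0)"
  obtain k k' where kk: "kk = (k, k')" by (cases kk)
  with snoc.prems have k: "k \<in> ?I" "k' \<in> ?I" "z_above k k'" "joined k k'"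
    using joined_pairsD[of k k'] by auto
  note S = snoc.prems(2) and T = snoc.prems(3)
  define U where "U = U_mat X (Vertex 0) ks"
  define F where "F = U_factor X (Vertex 0) (k, k')"
  have gen: "(Vertex 0, P, Q) \<in> generators X \<longleftrightarrow> z_above P Q \<and> \<not> joined P Q"
    if "P \<in> ?I" "Q \<in> ?I" for P Q
    using gen_mat_origin[OF v that] .
  have IH: "U P Q \<noteq> 0 \<Longrightarrow> P = Q \<or> z_above P Q" if "P \<in> ?I" "Q \<in> ?I" for P Q
    using snoc.IH[of P Q] snoc.prems(1) that gen[OF that] by (auto simp: U_def mat_id_def split: if_splits)
  have not_prec: "z_above S T \<Longrightarrow> joined S T"
    using snoc.prems(4) gen[OF S T] by blast
  have trans: "z_above P R \<Longrightarrow> z_above R Q \<Longrightarrow> z_above P Q" and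
    between: "z_above P R \<Longrightarrow> z_above R Q \<Longrightarrow> \<not> joined P Q" if "P \<in> ?I" "R \<in> ?I" "Q \<in> ?I" for P Q R
    using z_above_trans_at_origin[OF d that(1,2,3)] no_sheet_between_joined[OF d that(1,2,3)] by auto
  \<comment> \<open>of row \<open>S\<close> of the new factor only the diagonal entry contributes\<close>
  have zero: "F S R * U R T = 0" if R: "R \<in> ?I" and "R \<noteq> S" for R
  proof (rule ccontr)
    assume nz: "F S R * U R T \<noteq> 0"
    then have "U R T \<noteq> 0" by (metis mult_zero_right)
    then have "R = T \<or> z_above R T" by (rule IH[OF R T])
    from nz have "F S R \<noteq> 0" by (metis mult_zero_left)
    then consider "R = k" "z_above S k" | "S = k'" "z_above k' R"
      using \<open>R \<noteq> S\<close> by (auto simp: F_def U_factor_def mat_id_def split: if_splits)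
    then show False
    proof cases
      case 1
      show False
      proof (cases "R = T")
        case True
        then have "joined S k" using 1 not_prec by simp
        then have "joined S k'"
          using joined_trans_at_origin[OF d S k(1,2)] k(4) by simp
        then show False using between[OF S k(1,2)] 1 k(3) by simp
      next
        case False
        then have "z_above k T" using \<open>R = T \<or> z_above R T\<close> 1 by simp
        then show False
          using between[OF S k(1) T] trans[OF S k(1) T] 1 not_prec by simp
      qed
    next
      case 2
      show False
      proof (cases "R = T")
        case True
        then have "joined k' T" using 2 not_prec by simp
        then have "joined k T"
          using joined_trans_at_origin[OF d k(1,2) T] k(4) by simp
        then show False using between[OF k(1,2) T] 2 k(3) True by simp
      next
        case False
        then have "z_above R T" using \<open>R = T \<or> z_above R T\<close> by simp
        then show False
          using between[OF S R T] trans[OF S R T] 2 not_prec by simp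
      qed
    qed
  qed
  have diag: "F S S = 1"
    using z_above_irrefl[OF k(1)] z_above_irrefl[OF k(2)] by (auto simp: F_def U_factor_def mat_id_def)
  have "U_mat X (Vertex 0) (ks @ [kk]) S T = (\<Sum>R\<in>?I. F S R * U R T)"
    by (simp add: U_mat_def kk U_def F_def mat_mul_def)
  also have "\<dots> = (\<Sum>R\<in>?I. if R = S then U S T else 0)"
    by (intro sum.cong refl) (auto simp: diag zero)
  also have "\<dots> = U S T"
    using finite_sheets_at_origin[OF d] S by simp
  also have "\<dots> = mat_id S T"
    using snoc.IH[of S T] snoc.prems unfolding U_def by auto
  finally show ?case .
qed

end

section \<open>Matrices indexed by sheets\<close>

lemma mat_add_apply: "mat_add M N S T = M S T + N S T"
  by (simp add: mat_add_def)

lemma mat_mul_add_left: "mat_mul I (mat_add M N) P = mat_add (mat_mul I M P) (mat_mul I N P)"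
  by (simp add: mat_mul_def mat_add_def fun_eq_iff distrib_right sum.distrib)

lemma mat_mul_add_right: "mat_mul I P (mat_add M N) = mat_add (mat_mul I P M) (mat_mul I P N)"
  by (simp add: mat_mul_def mat_add_def fun_eq_iff distrib_left sum.distrib)

text \<open>
  Over an infinite index set both products are 0, sums over infinite sets being 0.
\<close>

lemma mat_mul_id_commute:
  assumes "S \<in> I" "T \<in> I"
  shows "mat_mul I mat_id M S T = mat_mul I M mat_id S T"
proof (cases "finite I")
  case True
  then show ?thesis
    using assms by (simp add: mat_mul_def mat_id_def if_distrib[of "\<lambda>x. x * _"] if_distrib[of "\<lambda>x. _ * x"]
        sum.delta sum.delta' cong: if_cong)
qed (simp add: mat_mul_def)

lemma mat_mul_cong:
  assumes "\<And>R. R \<in> I \<Longrightarrow> M S R = M' S R" "\<And>R. R \<in> I \<Longrightarrow> N R T = N' R T"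
  shows "mat_mul I M N S T = mat_mul I M' N' S T"
  unfolding mat_mul_def using assms by (intro sum.cong) auto

text \<open>
  A matrix over the sheets of the front spin, read as a matrix over the sheets of the link.
\<close>

definition reindex :: "('s \<Rightarrow> 't) \<Rightarrow> ('t, 'r) smat \<Rightarrow> ('s, 'r) smat" where
  "reindex f M = (\<lambda>S T. M (f S) (f T))"

lemma reindex_mat_add: "reindex f (mat_add M N) = mat_add (reindex f M) (reindex f N)"
  by (simp add: reindex_def mat_add_def)

lemma reindex_mat_mul:
  assumes "bij_betw f I J"
  shows "reindex f (mat_mul J M N) = mat_mul I (reindex f M) (reindex f N)"
  unfolding reindex_def mat_mul_def
  by (intro ext sum.reindex_bij_betw[OF assms, symmetric])

lemma reindex_mat_id: "inj_on f I \<Longrightarrow> S \<in> I \<Longrightarrow> T \<in> I \<Longrightarrow> reindex f mat_id S T = mat_id S T"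
  by (auto simp: reindex_def mat_id_def dest: inj_onD)

lemma pull_mat_cong:
  assumes "\<And>T T'. T \<in> sheets Z d \<Longrightarrow> T' \<in> sheets Z d \<Longrightarrow> M T T' = N T T'"
  shows "pull_mat Z d M S S' = pull_mat Z d N S S'"
  unfolding pull_mat_def using assms by (intro sum.cong refl) auto

lemma pull_mat_reindex:
  assumes g: "bij_betw g (sheets X d) (sheets Y e)"
    and R: "\<And>T. T \<in> sheets X d \<Longrightarrow> ends_in A (g T) \<longleftrightarrow> ends_in S T"
      "\<And>T. T \<in> sheets X d \<Longrightarrow> ends_in A' (g T) \<longleftrightarrow> ends_in S' T"
  shows "pull_mat Y e M A A' = pull_mat X d (reindex g M) S S'"
proof -
  have bij: "bij_betw g {T \<in> sheets X d. ends_in Q T} {T \<in> sheets Y e. ends_in P T}"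
    if "\<And>T. T \<in> sheets X d \<Longrightarrow> ends_in P (g T) \<longleftrightarrow> ends_in Q T" for P Q
  proof -
    have "sheets Y e = g ` sheets X d" "inj_on g (sheets X d)"
      using g by (auto simp: bij_betw_def)
    then show ?thesis
      using that by (auto simp: bij_betw_def intro: inj_on_subset)
  qed
  show ?thesis
    unfolding pull_mat_def reindex_def
    by (subst sum.reindex_bij_betw[OF bij[OF R(1)], symmetric], assumption, rule sum.cong[OF refl],
        subst sum.reindex_bij_betw[OF bij[OF R(2)], symmetric], assumption, rule refl)
qed

text \<open>
  This covers a face with the same sheets as the cell, where no row is lost or moved.
\<close>

lemma pull_mat_single:
  assumes "S \<in> sheets X d" "S' \<in> sheets X d"
    and "\<And>T. T \<in> sheets X d \<Longrightarrow> ends_in S T \<longleftrightarrow> T = S"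
    and "\<And>T. T \<in> sheets X d \<Longrightarrow> ends_in S' T \<longleftrightarrow> T = S'"
  shows "pull_mat X d M S S' = M S S'"
proof -
  have "{T \<in> sheets X d. ends_in S T} = {S}" "{T \<in> sheets X d. ends_in S' T} = {S'}"
    using assms by auto
  then show ?thesis by (simp add: pull_mat_def)
qed

lemma pull_mat_single_reindex:
  assumes g: "bij_betw g I (sheets Y e)" and "S \<in> I" "S' \<in> I"
    and "\<And>T. T \<in> I \<Longrightarrow> ends_in A (g T) \<longleftrightarrow> T = S"
    and "\<And>T. T \<in> I \<Longrightarrow> ends_in A' (g T) \<longleftrightarrow> T = S'"
  shows "pull_mat Y e M A A' = M (g S) (g S')"
proof -
  have "{T \<in> sheets Y e. ends_in A T} = {g S}" "{T \<in> sheets Y e. ends_in A' T} = {g S'}"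
    using assms(2-) unfolding bij_betw_imp_surj_on[OF g, symmetric] by auto
  then show ?thesis by (simp add: pull_mat_def)
qed

section \<open>Comparison of the differentials\<close>

context decomposed_front
begin

definition \<iota> :: "(cell, jet1) generator falg \<Rightarrow> (spun_cell, jet2) generator falg" where
  "\<iota> = subst (\<lambda>g. var (spin_gen (Base g)))"

lemma \<iota>_hom [simp]:
  "\<iota> 0 = 0" "\<iota> 1 = 1" "\<iota> (x + y) = \<iota> x + \<iota> y" "\<iota> (x * y) = \<iota> x * \<iota> y"
  "\<iota> (sum F I) = (\<Sum>i\<in>I. \<iota> (F i))"
  by (simp_all add: \<iota>_def subst_add subst_mult subst_sum)

lemma spin_gen_Base: "spin_gen (Base (c, S, T)) = (Radial c, radial_sheet c S, radial_sheet c T)"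
  by (simp add: radial_sheet_def)

lemma spin_gen_Hat: "spin_gen (Hat (c, S, T)) = (Rotated c, rotated_sheet S, rotated_sheet T)"
  by simp

lemma generators_radial:
  assumes "c \<in> link_cells" "S \<in> sheets X c" "T \<in> sheets X c"
  shows "(Radial c, radial_sheet c S, radial_sheet c T) \<in> generators Y \<longleftrightarrow> (c, S, T) \<in> generators X"
  using assms prec_radial_sheet(1)[OF assms] sheets_Y_radial[OF assms(1)]
  by (auto simp: generators_def)

lemma generators_rotated:
  assumes "c \<in> link_cells" "c \<noteq> Vertex 0" "S \<in> sheets X c" "T \<in> sheets X c"
  shows "(Rotated c, rotated_sheet S, rotated_sheet T) \<in> generators Y \<longleftrightarrow> (c, S, T) \<in> generators X"
  using assms prec_rotated_sheet[OF assms] sheets_Y_rotated[OF assms(1,2)]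
  by (auto simp: generators_def)

lemma \<iota>_gen_mat:
  assumes "c \<in> link_cells" "S \<in> sheets X c" "T \<in> sheets X c"
  shows "\<iota> (gen_mat X c S T) = reindex (radial_sheet c) (gen_mat Y (Radial c)) S T"
  using generators_radial[OF assms]
  by (simp add: gen_mat_def reindex_def \<iota>_def spin_gen_Base del: spin_gen.simps)

lemma \<iota>_mat_id: "\<iota> (mat_id S T) = mat_id S T"
  by (simp add: mat_id_def)

lemma \<iota>_pull_mat: "\<iota> (pull_mat X d M S S') = pull_mat X d (\<lambda>T T'. \<iota> (M T T')) S S'"
  by (simp add: pull_mat_def)

lemma \<iota>_mat_mul: "\<iota> (mat_mul I M N S T) = mat_mul I (\<lambda>S T. \<iota> (M S T)) (\<lambda>S T. \<iota> (N S T)) S T"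
  by (simp add: mat_mul_def)

text \<open>
  Both the radial and the rotated cell see above a vertex of the link the same matrix, including the blocks N
  for sheets that meet at a cusp.
\<close>

lemma vertex_mat_spun:
  assumes e: "Edge u v \<in> link_cells" and w: "w \<in> {u, v}"
    and S: "S \<in> sheets X (Edge u v)" and S': "S' \<in> sheets X (Edge u v)"
  shows "reindex (radial_sheet (Edge u v)) (vertex_mat Y (Radial (Edge u v)) (Radial (Vertex w))) S S' =
      \<iota> (vertex_mat X (Edge u v) (Vertex w) S S')" (is ?radial)
    and "reindex rotated_sheet (vertex_mat Y (Rotated (Edge u v)) (Radial (Vertex w))) S S' =
      \<iota> (vertex_mat X (Edge u v) (Vertex w) S S')" (is ?rotated)
proof -
  have wc: "Vertex w \<in> link_cells" using w EdgeD(8,9)[OF e] by auto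
  have pull: "pull_mat Y (Radial (Vertex w)) (gen_mat Y (Radial (Vertex w))) Q Q' =
      \<iota> (pull_mat X (Vertex w) (gen_mat X (Vertex w)) S S')"
    if "\<And>T. T \<in> sheets X (Vertex w) \<Longrightarrow> ends_in Q (radial_sheet (Vertex w) T) \<longleftrightarrow> ends_in S T"
      "\<And>T. T \<in> sheets X (Vertex w) \<Longrightarrow> ends_in Q' (radial_sheet (Vertex w) T) \<longleftrightarrow> ends_in S' T" for Q Q'
  proof -
    have "pull_mat Y (Radial (Vertex w)) (gen_mat Y (Radial (Vertex w))) Q Q' =
      pull_mat X (Vertex w) (reindex (radial_sheet (Vertex w)) (gen_mat Y (Radial (Vertex w)))) S S'"
      by (rule pull_mat_reindex[OF bij_radial_sheet[OF wc]]) (use that in auto)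
    also have "\<dots> = \<iota> (pull_mat X (Vertex w) (gen_mat X (Vertex w)) S S')"
      unfolding \<iota>_pull_mat by (rule pull_mat_cong) (simp add: \<iota>_gen_mat[OF wc])
    finally show ?thesis .
  qed
  have blk: "\<iota> (if P then 1 else 0) = (if P then 1 else 0)" for P
    by simp
  show ?radial
    unfolding vertex_mat_def reindex_def mat_add_def \<iota>_hom(3) blk
    using pull[OF ends_in_radial_radial[OF e w S] ends_in_radial_radial[OF e w S']]
      prec_radial_sheet(1)[OF e S S'] cusp_block_radial(1)[OF e w S S'] by simp
  show ?rotated
    unfolding vertex_mat_def reindex_def mat_add_def \<iota>_hom(3) blk
    using pull[OF ends_in_rotated_radial[OF e w S] ends_in_rotated_radial[OF e w S']]
      prec_rotated_sheet[OF e _ S S'] cusp_block_radial(2)[OF e w S S'] by simp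
qed

text \<open>
  The slit of the 2-cell carries the matrix \<open>B\<close> of the 1-cell from which the 2-cell was made.
\<close>

lemma edge_mat_radial:
  assumes e: "Edge u v \<in> link_cells" and S: "S \<in> sheets X (Edge u v)" and S': "S' \<in> sheets X (Edge u v)"
  shows "reindex rotated_sheet (edge_mat Y (Radial (Edge u v))) S S' = \<iota> (gen_mat X (Edge u v) S S')"
  unfolding edge_mat_def \<iota>_gen_mat[OF e S S'] unfolding reindex_def
  by (rule pull_mat_single_reindex[OF bij_radial_sheet[OF e] S S'])
    (use ends_in_rotated_radial_same[OF e _ S] ends_in_rotated_radial_same[OF e _ S'] in auto)

lemma vertex_mat_rotated_vertex:
  assumes c: "Vertex v \<in> link_cells" "v \<noteq> 0" and S: "S \<in> sheets X (Vertex v)" and S': "S' \<in> sheets X (Vertex v)"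
  shows "reindex rotated_sheet (vertex_mat Y (Rotated (Vertex v)) (Radial (Vertex v))) S S' =
    \<iota> (gen_mat X (Vertex v) S S')"
proof -
  have "pull_mat Y (Radial (Vertex v)) (gen_mat Y (Radial (Vertex v))) (rotated_sheet S) (rotated_sheet S') =
      gen_mat Y (Radial (Vertex v)) (radial_sheet (Vertex v) S) (radial_sheet (Vertex v) S')"
    by (rule pull_mat_single_reindex[OF bij_radial_sheet[OF c(1)] S S'])
      (use ends_in_rotated_radial_same[OF c(1) _ S] ends_in_rotated_radial_same[OF c(1) _ S'] c(2) in auto)
  with no_cusp_block_rotated_vertex[OF c S S'] show ?thesis
    by (simp add: vertex_mat_def mat_add_def reindex_def \<iota>_gen_mat[OF c(1) S S'])
qed

lemma \<iota>_diff_0cell: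
  assumes c: "c \<in> link_cells" and S: "S \<in> sheets X c" and T: "T \<in> sheets X c"
  shows "\<iota> (diff_0cell X c S T) = reindex (radial_sheet c) (diff_0cell Y (Radial c)) S T"
  unfolding diff_0cell_def reindex_mat_mul[OF bij_radial_sheet[OF c]] \<iota>_mat_mul
  by (rule mat_mul_cong) (simp_all add: \<iota>_gen_mat[OF c] S T)

lemma \<iota>_diff_1cell:
  assumes e: "Edge u v \<in> link_cells" and S: "S \<in> sheets X (Edge u v)" and T: "T \<in> sheets X (Edge u v)"
  shows "\<iota> (diff_1cell X (Edge u v) (Vertex v) (Vertex u) S T) =
    reindex (radial_sheet (Edge u v))
      (diff_1cell Y (Radial (Edge u v)) (Radial (Vertex v)) (Radial (Vertex u))) S T"
proof -
  let ?f = "radial_sheet (Edge u v)" and ?I = "sheets X (Edge u v)"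
  note bij = bij_radial_sheet[OF e]
  have B: "\<iota> (mat_add mat_id (gen_mat X (Edge u v)) P Q) =
      reindex ?f (mat_add mat_id (gen_mat Y (Radial (Edge u v)))) P Q" if "P \<in> ?I" "Q \<in> ?I" for P Q
    by (simp only: mat_add_apply reindex_mat_add \<iota>_hom(3) \<iota>_mat_id \<iota>_gen_mat[OF e that]
        reindex_mat_id[OF bij_betw_imp_inj_on[OF bij] that])
  have "\<iota> (mat_mul ?I (vertex_mat X (Edge u v) (Vertex u)) (mat_add mat_id (gen_mat X (Edge u v))) S T) =
    reindex ?f (mat_mul (sheets Y (Radial (Edge u v))) (vertex_mat Y (Radial (Edge u v)) (Radial (Vertex u)))
      (mat_add mat_id (gen_mat Y (Radial (Edge u v))))) S T"
    unfolding reindex_mat_mul[OF bij] \<iota>_mat_mul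
    by (rule mat_mul_cong) (use B S T vertex_mat_spun(1)[OF e] in auto)
  moreover have "\<iota> (mat_mul ?I (mat_add mat_id (gen_mat X (Edge u v))) (vertex_mat X (Edge u v) (Vertex v)) S T) =
    reindex ?f (mat_mul (sheets Y (Radial (Edge u v)))
      (mat_add mat_id (gen_mat Y (Radial (Edge u v)))) (vertex_mat Y (Radial (Edge u v)) (Radial (Vertex v)))) S T"
    unfolding reindex_mat_mul[OF bij] \<iota>_mat_mul
    by (rule mat_mul_cong) (use B S T vertex_mat_spun(1)[OF e] in auto)
  ultimately show ?thesis
    by (simp only: diff_1cell_def mat_add_apply reindex_mat_add \<iota>_hom(3))
qed

context
  fixes \<gamma> :: "(cell, jet1) generator \<Rightarrow> (cell, jet1) generator susp falg"
begin

text \<open>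
  The composite of \<open>\<Gamma>\<close> with the identification of generators.
\<close>

definition hat_der :: "(cell, jet1) generator falg \<Rightarrow> (spun_cell, jet2) generator falg" where
  "hat_der = derivation (\<lambda>g. var (spin_gen (Base g)))
     (\<lambda>g. subst (\<lambda>g. var (spin_gen g)) (if g \<in> origin_gens C A V then \<gamma> g else var (Hat g)))"

lemma hat_der_simps [simp]:
  "hat_der 0 = 0" "hat_der 1 = 0" "hat_der (x + y) = hat_der x + hat_der y"
  "hat_der (x * y) = hat_der x * \<iota> y + \<iota> x * hat_der y"
  "hat_der (sum F I) = (\<Sum>i\<in>I. hat_der (F i))"
  by (simp_all add: hat_der_def \<iota>_def derivation_add derivation_mult derivation_sum)

lemma hat_der_mat_mul:
  "hat_der (mat_mul I M N S T) =
   mat_mul I (\<lambda>S T. hat_der (M S T)) (\<lambda>S T. \<iota> (N S T)) S T +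
   mat_mul I (\<lambda>S T. \<iota> (M S T)) (\<lambda>S T. hat_der (N S T)) S T"
  by (simp add: mat_mul_def sum.distrib)

lemma hat_der_gen_mat:
  assumes "c \<in> link_cells" "c \<noteq> Vertex 0" "S \<in> sheets X c" "T \<in> sheets X c"
  shows "hat_der (gen_mat X c S T) = reindex rotated_sheet (gen_mat Y (Rotated c)) S T"
  using generators_rotated[OF assms] assms(2)
  by (simp add: gen_mat_def reindex_def hat_der_def spin_gen_Hat origin_gens_def del: spin_gen.simps)

lemma hat_der_mat_id: "hat_der (mat_id S T) = 0"
  by (simp add: mat_id_def)

text \<open>
  The blocks N are constant and disappear.
\<close>

lemma hat_der_vertex_mat:
  "hat_der (vertex_mat X c d S S') = pull_mat X d (\<lambda>T T'. hat_der (gen_mat X d T T')) S S'"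
  by (simp add: vertex_mat_def mat_add_def pull_mat_def)

text \<open>
  The generators of the bounding circle are the hats of those of the vertex, and a rotated sheet ends in
  a sheet above the circle exactly when the original sheet ends in the corresponding one above the vertex.
\<close>

lemma hat_der_vertex_mat_edge:
  assumes e: "Edge u v \<in> link_cells" and w: "w \<in> {u, v}" "w \<noteq> 0"
    and S: "S \<in> sheets X (Edge u v)" and S': "S' \<in> sheets X (Edge u v)"
  shows "hat_der (vertex_mat X (Edge u v) (Vertex w) S S') =
    reindex rotated_sheet (edge_mat Y (Rotated (Vertex w))) S S'"
proof -
  have wc: "Vertex w \<in> link_cells" "Vertex w \<noteq> Vertex 0" using w EdgeD(8,9)[OF e] by auto
  have "edge_mat Y (Rotated (Vertex w)) (rotated_sheet S) (rotated_sheet S') =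
      pull_mat X (Vertex w) (reindex rotated_sheet (gen_mat Y (Rotated (Vertex w)))) S S'"
    unfolding edge_mat_def
    using ends_in_rotated_rotated[OF e w(1) S _ w(2)] ends_in_rotated_rotated[OF e w(1) S' _ w(2)]
    by (intro pull_mat_reindex bij_rotated_sheet wc)
  also have "\<dots> = hat_der (vertex_mat X (Edge u v) (Vertex w) S S')"
    unfolding hat_der_vertex_mat
    by (rule pull_mat_cong) (simp add: hat_der_gen_mat[OF wc])
  finally show ?thesis by (simp add: reindex_def)
qed

text \<open>
  The circle starts and ends at the same vertex, so the linear terms \<open>A\<close> appear twice.
\<close>

lemma hat_der_diff_0cell:
  assumes c: "Vertex v \<in> link_cells" "v \<noteq> 0" and S: "S \<in> sheets X (Vertex v)" and T: "T \<in> sheets X (Vertex v)"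
  shows "hat_der (diff_0cell X (Vertex v) S T) =
    reindex rotated_sheet
      (diff_1cell Y (Rotated (Vertex v)) (Radial (Vertex v)) (Radial (Vertex v))) S T"
proof -
  let ?I = "sheets X (Vertex v)" and ?J = "sheets Y (Rotated (Vertex v))"
  let ?A = "\<lambda>S T. \<iota> (gen_mat X (Vertex v) S T)" and ?H = "\<lambda>S T. hat_der (gen_mat X (Vertex v) S T)"
  let ?v = "vertex_mat Y (Rotated (Vertex v)) (Radial (Vertex v))"
  let ?B = "mat_add mat_id (gen_mat Y (Rotated (Vertex v)))"
  have c': "Vertex v \<noteq> Vertex 0" using c by simp
  note bij = bij_rotated_sheet[OF c(1) c']
  have B: "reindex rotated_sheet ?B P Q = mat_add mat_id ?H P Q" if "P \<in> ?I" "Q \<in> ?I" for P Q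
    by (simp only: mat_add_apply reindex_mat_add hat_der_gen_mat[OF c(1) c' that]
        reindex_mat_id[OF bij_betw_imp_inj_on[OF bij] that])
  have "reindex rotated_sheet (mat_mul ?J ?v ?B) S T = mat_mul ?I ?A (mat_add mat_id ?H) S T"
    unfolding reindex_mat_mul[OF bij]
    by (rule mat_mul_cong) (use B S T vertex_mat_rotated_vertex[OF c] in auto)
  moreover have "reindex rotated_sheet (mat_mul ?J ?B ?v) S T = mat_mul ?I (mat_add mat_id ?H) ?A S T"
    unfolding reindex_mat_mul[OF bij]
    by (rule mat_mul_cong) (use B S T vertex_mat_rotated_vertex[OF c] in auto)
  ultimately have "reindex rotated_sheet
      (diff_1cell Y (Rotated (Vertex v)) (Radial (Vertex v)) (Radial (Vertex v))) S T =
    (mat_mul ?I ?A mat_id S T + mat_mul ?I ?A ?H S T) + (mat_mul ?I mat_id ?A S T + mat_mul ?I ?H ?A S T)"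
    by (simp only: diff_1cell_def mat_add_apply reindex_mat_add mat_mul_add_left mat_mul_add_right)
  also have "\<dots> = (mat_mul ?I ?A mat_id S T + mat_mul ?I mat_id ?A S T) +
      (mat_mul ?I ?H ?A S T + mat_mul ?I ?A ?H S T)"
    by (simp add: algebra_simps)
  also have "\<dots> = mat_mul ?I ?H ?A S T + mat_mul ?I ?A ?H S T"
    by (simp add: mat_mul_id_commute[OF S T])
  also have "\<dots> = hat_der (diff_0cell X (Vertex v) S T)"
    by (simp add: diff_0cell_def hat_der_mat_mul)
  finally show ?thesis by simp
qed

text \<open>
  The two sides of the slit contribute \<open>I + B\<close> each; the rest is the Leibniz rule. The assumption on \<open>W\<close>
  says that the inner edge contributes \<open>I + A'\<^sub>-\<close>, which is automatic for a circle and is the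
  content of the choice of \<open>\<Gamma>\<close> at the origin.
\<close>

lemma hat_der_diff_1cell:
  assumes e: "Edge u v \<in> link_cells" and S: "S \<in> sheets X (Edge u v)" and T: "T \<in> sheets X (Edge u v)"
    and W: "\<And>P Q. P \<in> sheets X (Edge u v) \<Longrightarrow> Q \<in> sheets X (Edge u v) \<Longrightarrow>
      reindex rotated_sheet W P Q = mat_id P Q + hat_der (vertex_mat X (Edge u v) (Vertex v) P Q)"
  shows "hat_der (diff_1cell X (Edge u v) (Vertex v) (Vertex u) S T) =
    reindex rotated_sheet (diff_2cell Y (Rotated (Edge u v)) (Radial (Vertex v)) (Radial (Vertex u))
      (Rotated (Vertex u)) (Radial (Edge u v)) W) S T"
proof -
  let ?I = "sheets X (Edge u v)" and ?J = "sheets Y (Rotated (Edge u v))" and ?\<rho> = "reindex rotated_sheet"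
  define a0 where "a0 = (\<lambda>S T. \<iota> (vertex_mat X (Edge u v) (Vertex v) S T))"
  define a1 where "a1 = (\<lambda>S T. \<iota> (vertex_mat X (Edge u v) (Vertex u) S T))"
  define h0 where "h0 = (\<lambda>S T. hat_der (vertex_mat X (Edge u v) (Vertex v) S T))"
  define h1 where "h1 = (\<lambda>S T. hat_der (vertex_mat X (Edge u v) (Vertex u) S T))"
  define b where "b = (\<lambda>S T. \<iota> (gen_mat X (Edge u v) S T))"
  define h where "h = (\<lambda>S T. hat_der (gen_mat X (Edge u v) S T))"
  have c': "Edge u v \<noteq> Vertex 0" by simp
  have u0: "u \<noteq> 0" using EdgeD(5)[OF e] by simp
  note bij = bij_rotated_sheet[OF e c']
  have id: "?\<rho> mat_id P Q = (mat_id P Q :: (spun_cell, jet2) generator falg)" if "P \<in> ?I" "Q \<in> ?I" for P Q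
    using reindex_mat_id[OF bij_betw_imp_inj_on[OF bij] that] .
  have entries: "?\<rho> (vertex_mat Y (Rotated (Edge u v)) (Radial (Vertex v))) P Q = a0 P Q"
    "?\<rho> (vertex_mat Y (Rotated (Edge u v)) (Radial (Vertex u))) P Q = a1 P Q"
    "?\<rho> (gen_mat Y (Rotated (Edge u v))) P Q = h P Q"
    "?\<rho> (mat_add mat_id (edge_mat Y (Rotated (Vertex u)))) P Q = mat_add mat_id h1 P Q"
    "?\<rho> (mat_add mat_id (edge_mat Y (Radial (Edge u v)))) P Q = mat_add mat_id b P Q"
    "?\<rho> W P Q = mat_add mat_id h0 P Q" if PQ: "P \<in> ?I" "Q \<in> ?I" for P Q
    using vertex_mat_spun(2)[OF e _ PQ] hat_der_gen_mat[OF e c' PQ] hat_der_vertex_mat_edge[OF e _ u0 PQ]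
      edge_mat_radial[OF e PQ] W[OF PQ] id[OF PQ]
    by (simp_all only: a0_def a1_def h_def h1_def b_def h0_def reindex_mat_add mat_add_apply insertI1 insertI2 singletonI)
  have "?\<rho> (diff_2cell Y (Rotated (Edge u v)) (Radial (Vertex v)) (Radial (Vertex u))
      (Rotated (Vertex u)) (Radial (Edge u v)) W) S T =
    (mat_mul ?I a1 h S T + mat_mul ?I h a0 S T) +
    (mat_mul ?I (mat_add mat_id h1) (mat_add mat_id b) S T +
     mat_mul ?I (mat_add mat_id b) (mat_add mat_id h0) S T)"
  proof -
    note cong = mat_mul_cong[where I = "?I" and S = S and T = T]
    have "mat_mul ?I (?\<rho> (vertex_mat Y (Rotated (Edge u v)) (Radial (Vertex u)))) (?\<rho> (gen_mat Y (Rotated (Edge u v)))) S T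
        = mat_mul ?I a1 h S T"
      by (rule cong) (simp_all only: entries S T)
    moreover have "mat_mul ?I (?\<rho> (gen_mat Y (Rotated (Edge u v)))) (?\<rho> (vertex_mat Y (Rotated (Edge u v)) (Radial (Vertex v)))) S T
        = mat_mul ?I h a0 S T"
      by (rule cong) (simp_all only: entries S T)
    moreover have "mat_mul ?I (?\<rho> (mat_add mat_id (edge_mat Y (Rotated (Vertex u)))))
        (?\<rho> (mat_add mat_id (edge_mat Y (Radial (Edge u v))))) S T = mat_mul ?I (mat_add mat_id h1) (mat_add mat_id b) S T"
      by (rule cong) (simp_all only: entries S T)
    moreover have "mat_mul ?I (?\<rho> (mat_add mat_id (edge_mat Y (Radial (Edge u v))))) (?\<rho> W) S T =
        mat_mul ?I (mat_add mat_id b) (mat_add mat_id h0) S T"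
      by (rule cong) (simp_all only: entries S T)
    ultimately show ?thesis
      unfolding diff_2cell_def reindex_mat_add[of _ "mat_add _ _" "mat_add _ _"]
        reindex_mat_add[of _ "mat_mul _ _ _" "mat_mul _ _ _"] reindex_mat_mul[OF bij] mat_add_apply[of "mat_add _ _" "mat_add _ _"]
        mat_add_apply[of "mat_mul _ _ _" "mat_mul _ _ _"]
      by (simp only:)
  qed
  also have "mat_mul ?I (mat_add mat_id h1) (mat_add mat_id b) S T =
      mat_mul ?I mat_id (mat_add mat_id b) S T + mat_mul ?I h1 (mat_add mat_id b) S T"
    unfolding mat_mul_add_left mat_add_apply ..
  also have "mat_mul ?I (mat_add mat_id b) (mat_add mat_id h0) S T =
      mat_mul ?I mat_id (mat_add mat_id b) S T + mat_mul ?I (mat_add mat_id b) h0 S T"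
    unfolding mat_mul_add_right[of _ _ mat_id h0] mat_mul_id_commute[OF S T] mat_add_apply ..
  also have "(mat_mul ?I a1 h S T + mat_mul ?I h a0 S T) +
      (mat_mul ?I mat_id (mat_add mat_id b) S T + mat_mul ?I h1 (mat_add mat_id b) S T +
       (mat_mul ?I mat_id (mat_add mat_id b) S T + mat_mul ?I (mat_add mat_id b) h0 S T)) =
      (mat_mul ?I mat_id (mat_add mat_id b) S T + mat_mul ?I mat_id (mat_add mat_id b) S T) +
      ((mat_mul ?I h1 (mat_add mat_id b) S T + mat_mul ?I a1 h S T) +
       (mat_mul ?I h a0 S T + mat_mul ?I (mat_add mat_id b) h0 S T))"
    by (simp only: ac_simps)
  also have "\<dots> = hat_der (diff_1cell X (Edge u v) (Vertex v) (Vertex u) S T)"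
  proof -
    have "(\<lambda>S T. \<iota> (mat_add mat_id (gen_mat X (Edge u v)) S T)) = mat_add mat_id b"
      "(\<lambda>S T. hat_der (mat_add mat_id (gen_mat X (Edge u v)) S T)) = h"
      by (simp_all add: fun_eq_iff mat_add_def b_def h_def \<iota>_mat_id hat_der_mat_id)
    then show ?thesis
      unfolding diff_1cell_def mat_add_apply[of "mat_mul _ _ _"] hat_der_simps(3) hat_der_mat_mul
      by (simp only: a0_def a1_def h0_def h1_def falg_add_self add_0)
  qed
  finally show ?thesis by simp
qed

end

end

section \<open>The isomorphism\<close>

text \<open>
  Being locally constant, a Maslov potential is constant on connected sets of smooth points, so the
  degree of a generator does not depend on the chosen points of the sheets.
\<close>

lemma maslov_constant:
  assumes \<mu>: "maslov_potential m L Z \<mu>" and D: "connected D" "D \<subseteq> L - Z" and "P \<in> D" "Q \<in> D"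
  shows "[\<mu> P = \<mu> Q] (mod int m)"
proof (rule connected_equivalence_relation[OF D(1) \<open>P \<in> D\<close> \<open>Q \<in> D\<close>])
  show "[\<mu> x = \<mu> y] (mod int m) \<Longrightarrow> [\<mu> y = \<mu> x] (mod int m)" for x y
    by (rule cong_sym)
  show "[\<mu> x = \<mu> y] (mod int m) \<Longrightarrow> [\<mu> y = \<mu> z] (mod int m) \<Longrightarrow> [\<mu> x = \<mu> z] (mod int m)" for x y z
    by (rule cong_trans)
  fix a assume "a \<in> D"
  then obtain e where e: "e > 0" "\<And>q. q \<in> L - Z \<Longrightarrow> dist a q < e \<Longrightarrow> [\<mu> q = \<mu> a] (mod int m)"
    using \<mu> D(2) unfolding maslov_potential_def by blast
  show "\<exists>T. openin (top_of_set D) T \<and> a \<in> T \<and> (\<forall>x\<in>T. [\<mu> a = \<mu> x] (mod int m))"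
    using e D(2) \<open>a \<in> D\<close>
    by (intro exI[of _ "D \<inter> ball a e"]) (auto intro!: openin_open_Int cong_sym[OF e(2)])
qed

context decomposed_front
begin

lemma spin_gen_Gamma:
  "subst (\<lambda>g. var (spin_gen g)) (Gamma (origin_gens C A V) \<gamma> x) = hat_der \<gamma> x"
  by (simp add: Gamma_def hat_der_def subst_derivation)

lemma spin_gen_base_incl: "subst (\<lambda>g. var (spin_gen g)) (base_incl x) = \<iota> x"
  by (simp add: base_incl_def \<iota>_def subst_subst)

lemma hat_der_origin:
  "hat_der \<gamma> (gen_mat X (Vertex 0) S T) =
    (if (Vertex 0, S, T) \<in> generators X then subst (\<lambda>g. var (spin_gen g)) (\<gamma> (Vertex 0, S, T)) else 0)"
proof (cases "(Vertex 0, S, T) \<in> generators X")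
  case True
  then have "(Vertex 0, S, T) \<in> origin_gens C A V" by (simp add: origin_gens_def)
  with True show ?thesis
    by (simp add: gen_mat_def hat_der_def)
next
  case False
  then show ?thesis by (simp add: gen_mat_def)
qed

lemma inner_edge_smooth_origin:
  assumes "\<And>g. \<gamma> g = 0"
  shows "hat_der \<gamma> (vertex_mat X c (Vertex 0) P Q) = 0"
proof -
  have "hat_der \<gamma> (gen_mat X (Vertex 0) S T) = 0" for S T
    by (auto simp: hat_der_origin assms)
  then show ?thesis
    by (simp add: hat_der_vertex_mat pull_mat_def)
qed

lemma U_factor_spun:
  assumes v: "Vertex 0 \<in> link_cells" and k: "k \<in> sheets X (Vertex 0)" "k' \<in> sheets X (Vertex 0)"
    and S: "S \<in> sheets X (Vertex 0)" and T: "T \<in> sheets X (Vertex 0)"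
  shows "reindex (radial_sheet (Vertex 0))
      (U_factor Y (Radial (Vertex 0)) (radial_sheet (Vertex 0) k, radial_sheet (Vertex 0) k')) S T =
    \<iota> (U_factor X (Vertex 0) (k, k') S T)"
proof -
  have inj: "radial_sheet (Vertex 0) P = radial_sheet (Vertex 0) Q \<longleftrightarrow> P = Q"
    if "P \<in> sheets X (Vertex 0)" "Q \<in> sheets X (Vertex 0)" for P Q
    using bij_betw_imp_inj_on[OF bij_radial_sheet[OF v]] that by (auto dest: inj_onD)
  have gen: "gen_mat Y (Radial (Vertex 0)) (radial_sheet (Vertex 0) P) (radial_sheet (Vertex 0) Q) =
      \<iota> (gen_mat X (Vertex 0) P Q)" if "P \<in> sheets X (Vertex 0)" "Q \<in> sheets X (Vertex 0)" for P Q
    using \<iota>_gen_mat[OF v that] by (simp add: reindex_def)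
  show ?thesis
    unfolding U_factor_def reindex_def prod.case mat_id_def
    using k S T by (simp add: inj gen prec_radial_sheet(2)[OF v])
qed

lemma U_mat_spun:
  assumes v: "Vertex 0 \<in> link_cells" and ks: "set ks \<subseteq> joined_pairs X (Vertex 0)"
    and S: "S \<in> sheets X (Vertex 0)" and T: "T \<in> sheets X (Vertex 0)"
  shows "reindex (radial_sheet (Vertex 0))
      (U_mat Y (Radial (Vertex 0)) (map (map_prod (spin UNIV) (spin UNIV)) ks)) S T =
    \<iota> (U_mat X (Vertex 0) ks S T)"
  using ks S T
proof (induction ks arbitrary: S T rule: rev_induct)
  case Nil
  note bij = bij_radial_sheet[OF v]
  show ?case
    using reindex_mat_id[OF bij_betw_imp_inj_on[OF bij] Nil.prems(2,3)]
    by (simp add: U_mat_def \<iota>_mat_id)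
next
  case (snoc kk ks)
  let ?f = "map_prod (spin UNIV) (spin UNIV)" and ?r = "radial_sheet (Vertex 0)"
  note bij = bij_radial_sheet[OF v]
  obtain k k' where kk: "kk = (k, k')" by (cases kk)
  with snoc.prems have k: "k \<in> sheets X (Vertex 0)" "k' \<in> sheets X (Vertex 0)"
    using joined_pairsD[of k k'] by auto
  have f: "?f kk = (?r k, ?r k')"
    by (simp add: kk radial_sheet_def)
  have ks: "set ks \<subseteq> joined_pairs X (Vertex 0)"
    using snoc.prems by auto
  have "U_mat Y (Radial (Vertex 0)) (map ?f (ks @ [kk])) =
      mat_mul (sheets Y (Radial (Vertex 0))) (U_factor Y (Radial (Vertex 0)) (?r k, ?r k'))
        (U_mat Y (Radial (Vertex 0)) (map ?f ks))"
    by (simp only: U_mat_def map_append foldl_append list.map foldl_Cons foldl_Nil f)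
  then have "reindex ?r (U_mat Y (Radial (Vertex 0)) (map ?f (ks @ [kk]))) S T =
      mat_mul (sheets X (Vertex 0)) (reindex ?r (U_factor Y (Radial (Vertex 0)) (?r k, ?r k')))
        (reindex ?r (U_mat Y (Radial (Vertex 0)) (map ?f ks))) S T"
    by (simp only: reindex_mat_mul[OF bij])
  also have "\<dots> = \<iota> (mat_mul (sheets X (Vertex 0)) (U_factor X (Vertex 0) (k, k')) (U_mat X (Vertex 0) ks) S T)"
    unfolding \<iota>_mat_mul
    by (rule mat_mul_cong)
      (simp_all only: U_factor_spun[OF v k snoc.prems(2)] snoc.IH[OF ks _ snoc.prems(3)])
  also have "mat_mul (sheets X (Vertex 0)) (U_factor X (Vertex 0) (k, k')) (U_mat X (Vertex 0) ks) =
      U_mat X (Vertex 0) (ks @ [kk])"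
    by (simp only: U_mat_def foldl_append foldl_Cons foldl_Nil kk)
  finally show ?case .
qed

text \<open>
  Above the disk around the origin the vertex matrix is the matrix \<open>A\<close> itself, because the sheets at the
  origin are those of the 1-cell. Entries of \<open>A\<close> that are generators are sent to those of \<open>U - I\<close> by
  definition; for the others \<open>U\<close> agrees with \<open>I\<close>.
\<close>

lemma inner_edge_cone_points:
  assumes e: "Edge u 0 \<in> link_cells" and d: "doubled (link C A) \<noteq> {}"
    and ks: "set ks \<subseteq> joined_pairs X (Vertex 0)"
    and P: "P \<in> sheets X (Edge u 0)" and Q: "Q \<in> sheets X (Edge u 0)"
  shows "reindex rotated_sheet (pull_mat Y (Radial (Vertex 0))
      (U_mat Y (Radial (Vertex 0)) (map (map_prod (spin UNIV) (spin UNIV)) ks))) P Q =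
    mat_id P Q + hat_der (U_correction C A V ks) (vertex_mat X (Edge u 0) (Vertex 0) P Q)"
proof -
  let ?ks = "map (map_prod (spin UNIV) (spin UNIV)) ks"
  have v: "Vertex 0 \<in> link_cells" using EdgeD(9)[OF e] .
  have P': "P \<in> sheets X (Vertex 0)" and Q': "Q \<in> sheets X (Vertex 0)"
    using P Q sheets_Edge_0[OF e d] by auto
  have "reindex rotated_sheet (pull_mat Y (Radial (Vertex 0)) (U_mat Y (Radial (Vertex 0)) ?ks)) P Q =
      reindex (radial_sheet (Vertex 0)) (U_mat Y (Radial (Vertex 0)) ?ks) P Q"
    unfolding reindex_def
    by (rule pull_mat_single_reindex[OF bij_radial_sheet[OF v] P' Q'])
      (simp_all add: ends_in_rotated_radial[OF e _ P] ends_in_rotated_radial[OF e _ Q]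
        ends_in_same_cell[OF P'] ends_in_same_cell[OF Q'])
  also have "\<dots> = \<iota> (U_mat X (Vertex 0) ks P Q)"
    by (rule U_mat_spun[OF v ks P' Q'])
  also have "\<dots> = mat_id P Q + hat_der (U_correction C A V ks) (gen_mat X (Vertex 0) P Q)"
  proof (cases "(Vertex 0, P, Q) \<in> generators X")
    case True
    then have "hat_der (U_correction C A V ks) (gen_mat X (Vertex 0) P Q) =
        \<iota> (U_mat X (Vertex 0) ks P Q + mat_id P Q)"
      by (simp only: hat_der_origin if_True U_correction_def prod.case spin_gen_base_incl falg_minus_eq_plus)
    also have "\<dots> = \<iota> (U_mat X (Vertex 0) ks P Q) + mat_id P Q"
      by (simp add: \<iota>_mat_id)
    finally show ?thesis
      by (simp add: add.left_commute)
  next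
    case False
    then show ?thesis
      by (simp add: hat_der_origin U_mat_eq_mat_id[OF d v ks P' Q' False] \<iota>_mat_id)
  qed
  also have "gen_mat X (Vertex 0) P Q = pull_mat X (Vertex 0) (gen_mat X (Vertex 0)) P Q"
    by (rule pull_mat_single[OF P' Q', symmetric]) (simp_all add: ends_in_same_cell[OF P'] ends_in_same_cell[OF Q'])
  also have "hat_der (U_correction C A V ks) \<dots> =
      hat_der (U_correction C A V ks) (vertex_mat X (Edge u 0) (Vertex 0) P Q)"
    unfolding hat_der_vertex_mat by (simp add: pull_mat_def)
  finally show ?thesis .
qed

lemma joined_pairs_spun:
  assumes v: "Vertex 0 \<in> link_cells"
  shows "joined_pairs Y (Radial (Vertex 0)) =
      map_prod (spin UNIV) (spin UNIV) ` joined_pairs X (Vertex 0)"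
    and "inj_on (map_prod (spin UNIV) (spin UNIV)) (joined_pairs X (Vertex 0))"
proof -
  have r: "radial_sheet (Vertex 0) = spin UNIV" by (simp add: radial_sheet_def)
  note bij = bij_radial_sheet[OF v, unfolded r]
  have iff: "z_above (spin UNIV S) (spin UNIV T) \<longleftrightarrow> z_above S T"
    "joined (spin UNIV S) (spin UNIV T) \<longleftrightarrow> joined S T"
    if "S \<in> sheets X (Vertex 0)" "T \<in> sheets X (Vertex 0)" for S T
    using prec_radial_sheet(2,3)[OF v that] by (simp_all add: r)
  show "joined_pairs Y (Radial (Vertex 0)) =
      map_prod (spin UNIV) (spin UNIV) ` joined_pairs X (Vertex 0)"
    unfolding joined_pairs_def bij_betw_imp_surj_on[OF bij, symmetric]
    using iff by (auto simp: map_prod_def image_iff split: prod.splits)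
  show "inj_on (map_prod (spin UNIV) (spin UNIV)) (joined_pairs X (Vertex 0))"
    by (rule inj_on_subset[OF map_prod_inj_on[OF bij_betw_imp_inj_on[OF bij] bij_betw_imp_inj_on[OF bij]]])
      (auto simp: joined_pairs_def)
qed

lemma bij_spin_gen:
  "bij_betw spin_gen (Base ` generators X \<union> Hat ` (generators X - origin_gens C A V)) (generators Y)"
proof -
  have org: "g \<in> origin_gens C A V \<longleftrightarrow> g \<in> generators X \<and> fst g = Vertex 0" for g
    by (auto simp: origin_gens_def)
  have genD: "c \<in> link_cells" "S \<in> sheets X c" "T \<in> sheets X c" if "(c, S, T) \<in> generators X" for c S T
    using that by (auto simp: generators_def)
  have Base: "bij_betw (\<lambda>g. spin_gen (Base g)) (generators X) {g \<in> generators Y. \<exists>c. fst g = Radial c}"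
    (is "bij_betw ?h _ ?Y")
    unfolding bij_betw_def
  proof
    show "inj_on ?h (generators X)"
    proof (rule inj_onI)
      fix g g' assume *: "g \<in> generators X" "g' \<in> generators X" "?h g = ?h g'"
      obtain c S T c' S' T' where g: "g = (c, S, T)" "g' = (c', S', T')" by (metis prod_cases3)
      have "c' = c" "radial_sheet c S = radial_sheet c S'" "radial_sheet c T = radial_sheet c T'"
        using *(3) unfolding g spin_gen_Base by auto
      then show "g = g'"
        using *(1,2) genD[of c S T] genD[of c S' T'] bij_betw_imp_inj_on[OF bij_radial_sheet[of c]]
        unfolding g by (auto dest: inj_onD)
    qed
    show "?h ` generators X = ?Y"
    proof (intro equalityI subsetI)
      fix h assume "h \<in> ?h ` generators X"
      then obtain g where "g \<in> generators X" "h = ?h g" by blast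
      moreover obtain c S T where "g = (c, S, T)" by (rule prod_cases3)
      ultimately have g: "(c, S, T) \<in> generators X" "h = spin_gen (Base (c, S, T))" by simp_all
      then show "h \<in> ?Y"
        unfolding spin_gen_Base using generators_radial[OF genD[OF g(1)]] by simp
    next
      fix h assume "h \<in> ?Y"
      then obtain c where "fst h = Radial c" and hY: "h \<in> generators Y" by blast
      then obtain S' T' where h: "h = (Radial c, S', T')"
        by (metis prod.collapse)
      note h = h hY
      then have c: "c \<in> link_cells" and "S' \<in> sheets Y (Radial c)" "T' \<in> sheets Y (Radial c)"
        by (auto simp: generators_def)
      then obtain S T where S: "S \<in> sheets X c" "T \<in> sheets X c" "S' = radial_sheet c S" "T' = radial_sheet c T"
        unfolding sheets_Y_radial[OF c] by blast
      then have "(c, S, T) \<in> generators X"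
        using h generators_radial[OF c S(1,2)] by simp
      moreover have "h = spin_gen (Base (c, S, T))"
        unfolding spin_gen_Base h S ..
      ultimately show "h \<in> ?h ` generators X" by blast
    qed
  qed
  have Hat: "bij_betw (\<lambda>g. spin_gen (Hat g)) (generators X - origin_gens C A V)
      {g \<in> generators Y. \<exists>c. fst g = Rotated c}"
    (is "bij_betw ?h ?X ?Y")
    unfolding bij_betw_def
  proof
    show "inj_on ?h ?X"
    proof (rule inj_onI)
      fix g g' assume *: "g \<in> ?X" "g' \<in> ?X" "?h g = ?h g'"
      obtain c S T c' S' T' where g: "g = (c, S, T)" "g' = (c', S', T')" by (metis prod_cases3)
      have eq: "c' = c" "rotated_sheet S = rotated_sheet S'" "rotated_sheet T = rotated_sheet T'"
        using *(3) unfolding g spin_gen_Hat by auto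
      have "c \<noteq> Vertex 0" using *(1) org g by auto
      then show "g = g'"
        using *(1,2) genD[of c S T] genD[of c S' T'] eq bij_betw_imp_inj_on[OF bij_rotated_sheet[of c]]
        unfolding g by (auto dest: inj_onD)
    qed
    show "?h ` ?X = ?Y"
    proof (intro equalityI subsetI)
      fix h assume "h \<in> ?h ` ?X"
      then obtain g where "g \<in> ?X" "h = ?h g" by blast
      moreover obtain c S T where "g = (c, S, T)" by (rule prod_cases3)
      ultimately have g: "(c, S, T) \<in> ?X" "h = spin_gen (Hat (c, S, T))" by simp_all
      then have "(c, S, T) \<in> generators X" "c \<noteq> Vertex 0" using org by auto
      then show "h \<in> ?Y"
        unfolding g(2) spin_gen_Hat using generators_rotated[of c S T] genD[of c S T] by simp
    next
      fix h assume "h \<in> ?Y"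
      then obtain c where "fst h = Rotated c" and hY: "h \<in> generators Y" by blast
      then obtain S' T' where h: "h = (Rotated c, S', T')"
        by (metis prod.collapse)
      note h = h hY
      then have c: "c \<in> link_cells" "c \<noteq> Vertex 0" and "S' \<in> sheets Y (Rotated c)" "T' \<in> sheets Y (Rotated c)"
        by (auto simp: generators_def)
      then obtain S T where S: "S \<in> sheets X c" "T \<in> sheets X c" "S' = rotated_sheet S" "T' = rotated_sheet T"
        unfolding sheets_Y_rotated[OF c] by blast
      then have "(c, S, T) \<in> ?X"
        using h generators_rotated[OF c S(1,2)] org c(2) by simp
      moreover have "h = spin_gen (Hat (c, S, T))"
        unfolding spin_gen_Hat h S ..
      ultimately show "h \<in> ?h ` ?X" by blast
    qed
  qed
  have "bij_betw spin_gen (Base ` generators X) {g \<in> generators Y. \<exists>c. fst g = Radial c}"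
    using Base by (auto simp: bij_betw_def inj_on_def image_image)
  moreover have "bij_betw spin_gen (Hat ` (generators X - origin_gens C A V))
      {g \<in> generators Y. \<exists>c. fst g = Rotated c}"
    using Hat by (auto simp: bij_betw_def inj_on_def image_image)
  ultimately have "bij_betw spin_gen (Base ` generators X \<union> Hat ` (generators X - origin_gens C A V))
      ({g \<in> generators Y. \<exists>c. fst g = Radial c} \<union> {g \<in> generators Y. \<exists>c. fst g = Rotated c})"
    by (rule bij_betw_combine) auto
  moreover have "{g \<in> generators Y. \<exists>c. fst g = Radial c} \<union> {g \<in> generators Y. \<exists>c. fst g = Rotated c} =
      generators Y"
    by (auto intro: spun_cell.exhaust)
  ultimately show ?thesis by simp
qed

lemma spun_sheet_smooth:
  assumes c: "c \<in> link_cells" and S: "S \<in> sheets X c"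
  shows "spin UNIV S \<subseteq> front_spin C A - surface_singular_set C A"
proof -
  have "spin UNIV S \<subseteq> front_spin C A"
    unfolding front_spin_def using sheetsD(3)[OF S] by (intro spin_mono) auto
  moreover have "spin UNIV S \<inter> cusp_edges C A = {}"
    using spin_inter_cusp_edges[OF sheetsD(3)[OF S] UNIV_not_empty] sheetsD(7)[OF S] by simp
  moreover have "spin UNIV S \<inter> doubled (front_spin C A) = {}"
  proof (cases "c \<noteq> Vertex 0 \<or> doubled (link C A) \<noteq> {}")
    case True
    have "fst P \<noteq> 0" if "P \<in> spin UNIV S" for P
      using that sheet_neg[OF S c True] by (auto elim!: spinE)
    then show ?thesis by (auto simp: doubled_def)
  next
    case False
    then show ?thesis using doubled_front_spin_iff by simp
  qed
  ultimately show ?thesis by (auto simp: surface_singular_set_def)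
qed

text \<open>
  All sheets made from \<open>S\<close> lie in the connected orbit of \<open>S\<close>.
\<close>

lemma sheet_maslov_spun:
  assumes \<mu>: "maslov_potential m (front_spin C A) (surface_singular_set C A) \<mu>"
    and c: "c \<in> link_cells" and S: "S \<in> sheets X c" and "\<Theta> \<noteq> {}"
  shows "[sheet_maslov \<mu> (spin \<Theta> S) =
    sheet_maslov (\<lambda>(x, y, z). \<mu> (of_real x, of_real y, z)) S] (mod int m)"
proof -
  define p where "p = (SOME p. p \<in> S)"
  define P where "P = (SOME P. P \<in> spin \<Theta> S)"
  have "p \<in> S" unfolding p_def using sheetsD(4)[OF S] by (simp add: some_in_eq)
  have "spin \<Theta> S \<noteq> {}" using sheetsD(4)[OF S] assms(4) by (simp add: spin_eq_empty_iff)
  then have "P \<in> spin \<Theta> S" unfolding P_def by (simp add: some_in_eq)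
  then have "P \<in> spin UNIV S" using spin_mono[of \<Theta> UNIV S S] by auto
  moreover have "rot 0 p \<in> spin UNIV S" using \<open>p \<in> S\<close> by (auto intro: rotI)
  ultimately have "[\<mu> P = \<mu> (rot 0 p)] (mod int m)"
    by (intro maslov_constant[OF \<mu> _ spun_sheet_smooth[OF c S]] connected_spin sheetsD(5)[OF S])
      auto
  then show ?thesis
    by (simp add: sheet_maslov_def p_def[symmetric] P_def[symmetric] rot_def zc_def case_prod_unfold)
qed

text \<open>
  All three cases of the theorem reduce to this: the only thing left to check is the inner edge of the disk
  around the origin.
\<close>

lemma surface_dga_iso_modified_suspension:
  fixes ks' :: "(jet2 set \<times> jet2 set) list"
  defines "W0 \<equiv> (if doubled (front_spin C A) = {} then mat_id
      else pull_mat Y (Radial (Vertex 0)) (U_mat Y (Radial (Vertex 0)) ks'))"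
  assumes \<mu>: "maslov_potential m (front_spin C A) (surface_singular_set C A) \<mu>"
    and W0: "\<And>u P Q. Edge u 0 \<in> link_cells \<Longrightarrow> P \<in> sheets X (Edge u 0) \<Longrightarrow> Q \<in> sheets X (Edge u 0) \<Longrightarrow>
      reindex rotated_sheet W0 P Q = mat_id P Q + hat_der \<gamma> (vertex_mat X (Edge u 0) (Vertex 0) P Q)"
  shows "fdga_iso m spin_gen (modified_suspension (origin_gens C A V) \<gamma> (link_dga C A V \<mu>))
    (surface_dga C A V \<mu> ks')"
proof (rule fdga_isoI)
  let ?D = "link_dga C A V \<mu>" and ?E = "surface_dga C A V \<mu> ks'"
  let ?S = "modified_suspension (origin_gens C A V) \<gamma> ?D"
  let ?\<mu> = "\<lambda>(x, y, z). \<mu> (of_real x, of_real y, z)"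
  have gens: "gens ?S = Base ` generators X \<union> Hat ` (generators X - origin_gens C A V)" "gens ?E = generators Y"
    by (simp_all add: modified_suspension_def link_dga_def surface_dga_def Let_def)
  show "bij_betw spin_gen (gens ?S) (gens ?E)"
    unfolding gens by (rule bij_spin_gen)
  have cases: thesis
    if "g \<in> gens ?S"
      "\<And>c S T. c \<in> link_cells \<Longrightarrow> S \<in> sheets X c \<Longrightarrow> T \<in> sheets X c \<Longrightarrow> g = Base (c, S, T) \<Longrightarrow> thesis"
      "\<And>c S T. c \<in> link_cells \<Longrightarrow> c \<noteq> Vertex 0 \<Longrightarrow> S \<in> sheets X c \<Longrightarrow> T \<in> sheets X c \<Longrightarrow> g = Hat (c, S, T) \<Longrightarrow> thesis"
    for g thesis
  proof -
    from that(1) consider h where "h \<in> generators X" "g = Base h"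
      | h where "h \<in> generators X" "h \<notin> origin_gens C A V" "g = Hat h"
      unfolding gens by blast
    then show thesis
    proof cases
      case 1
      obtain c S T where "h = (c, S, T)" by (metis prod_cases3)
      with 1 that(2) show thesis by (auto simp: generators_def)
    next
      case 2
      obtain c S T where "h = (c, S, T)" by (metis prod_cases3)
      with 2 that(3) show thesis by (auto simp: generators_def origin_gens_def)
    qed
  qed
  show "[degr ?E (spin_gen g) = degr ?S g] (mod int m)" if g: "g \<in> gens ?S" for g
  proof (rule cases[OF g])
    fix c S T assume *: "c \<in> link_cells" "S \<in> sheets X c" "T \<in> sheets X c" "g = Base (c, S, T)"
    have "degr ?E (spin_gen g) =
        sheet_maslov \<mu> (radial_sheet c S) - sheet_maslov \<mu> (radial_sheet c T) + cell_dim c - 1"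
      unfolding *(4) spin_gen_Base by (simp add: surface_dga_def Let_def)
    moreover have "degr ?S g = sheet_maslov ?\<mu> S - sheet_maslov ?\<mu> T + cell_dim c - 1"
      unfolding *(4) by (simp add: modified_suspension_def link_dga_def Let_def)
    ultimately show ?thesis
      using sheet_maslov_spun[OF \<mu> *(1,2)] sheet_maslov_spun[OF \<mu> *(1,3)]
      by (auto simp: radial_sheet_def intro!: cong_diff cong_add)
  next
    fix c S T assume *: "c \<in> link_cells" "S \<in> sheets X c" "T \<in> sheets X c" "g = Hat (c, S, T)"
    have "degr ?E (spin_gen g) =
        sheet_maslov \<mu> (rotated_sheet S) - sheet_maslov \<mu> (rotated_sheet T) + cell_dim c"
      unfolding *(4) spin_gen_Hat by (simp add: surface_dga_def Let_def)
    moreover have "degr ?S g = sheet_maslov ?\<mu> S - sheet_maslov ?\<mu> T + cell_dim c"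
      unfolding *(4) by (simp add: modified_suspension_def link_dga_def Let_def)
    ultimately show ?thesis
      using sheet_maslov_spun[OF \<mu> *(1,2) turn_nonempty] sheet_maslov_spun[OF \<mu> *(1,3) turn_nonempty]
      by (auto intro!: cong_diff cong_add)
  qed
  show "subst (\<lambda>g. var (spin_gen g)) (dgen ?S g) = dgen ?E (spin_gen g)" if g: "g \<in> gens ?S" for g
  proof (rule cases[OF g])
    fix c S T assume *: "c \<in> link_cells" "S \<in> sheets X c" "T \<in> sheets X c" "g = Base (c, S, T)"
    have "subst (\<lambda>g. var (spin_gen g)) (dgen ?S g) = \<iota> (dgen ?D (c, S, T))"
      by (simp add: *(4) modified_suspension_def spin_gen_base_incl)
    also have "\<dots> = dgen ?E (Radial c, radial_sheet c S, radial_sheet c T)"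
    proof (cases c)
      case (Vertex v)
      then show ?thesis
        using \<iota>_diff_0cell[OF *(1-3)] by (simp add: link_dga_def surface_dga_def Let_def reindex_def)
    next
      case (Edge u v)
      then show ?thesis
        using \<iota>_diff_1cell[of u v S T] * by (simp add: link_dga_def surface_dga_def Let_def reindex_def)
    qed
    finally show ?thesis
      unfolding *(4) spin_gen_Base .
  next
    fix c S T assume *: "c \<in> link_cells" "c \<noteq> Vertex 0" "S \<in> sheets X c" "T \<in> sheets X c" "g = Hat (c, S, T)"
    have "subst (\<lambda>g. var (spin_gen g)) (dgen ?S g) = hat_der \<gamma> (dgen ?D (c, S, T))"
      by (simp add: *(5) modified_suspension_def spin_gen_Gamma)
    also have "\<dots> = dgen ?E (Rotated c, rotated_sheet S, rotated_sheet T)"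
    proof (cases c)
      case (Vertex v)
      then show ?thesis
        using hat_der_diff_0cell[of v S T \<gamma>] * by (simp add: link_dga_def surface_dga_def Let_def reindex_def)
    next
      case (Edge u v)
      define W where "W = (if v \<noteq> 0 then mat_add mat_id (edge_mat Y (Rotated (Vertex v))) else W0)"
      have W: "reindex rotated_sheet W P Q = mat_id P Q + hat_der \<gamma> (vertex_mat X (Edge u v) (Vertex v) P Q)"
        if PQ: "P \<in> sheets X (Edge u v)" "Q \<in> sheets X (Edge u v)" for P Q
      proof (cases "v = 0")
        case True
        then show ?thesis
          using W0[of u P Q] * Edge PQ by (simp add: W_def)
      next
        case False
        have e: "Edge u v \<in> link_cells" using * Edge by simp
        note inj = bij_betw_imp_inj_on[OF bij_rotated_sheet[OF e cell.distinct(2)]]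
        from False show ?thesis
          unfolding W_def
          by (simp add: reindex_mat_add mat_add_apply reindex_mat_id[OF inj PQ]
              hat_der_vertex_mat_edge[OF e _ False PQ])
      qed
      have "hat_der \<gamma> (diff_1cell X (Edge u v) (Vertex v) (Vertex u) S T) =
          reindex rotated_sheet (diff_2cell Y (Rotated (Edge u v)) (Radial (Vertex v)) (Radial (Vertex u))
            (Rotated (Vertex u)) (Radial (Edge u v)) W) S T"
        by (rule hat_der_diff_1cell) (use * Edge W in auto)
      moreover have "dgen ?D (c, S, T) = diff_1cell X (Edge u v) (Vertex v) (Vertex u) S T"
        by (simp add: Edge link_dga_def Let_def)
      moreover have "dgen ?E (Rotated c, rotated_sheet S, rotated_sheet T) =
          reindex rotated_sheet (diff_2cell Y (Rotated (Edge u v)) (Radial (Vertex v)) (Radial (Vertex u))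
            (Rotated (Vertex u)) (Radial (Edge u v)) W) S T"
        by (simp add: Edge surface_dga_def Let_def reindex_def W_def W0_def)
      ultimately show ?thesis by simp
    qed
    finally show ?thesis
      unfolding *(5) spin_gen_Hat .
  qed
qed

lemma origin_gens_empty: "A = {} \<Longrightarrow> origin_gens C A V = {}"
proof -
  assume "A = {}"
  have "Vertex 0 \<notin> link_cells"
  proof
    assume "Vertex 0 \<in> link_cells"
    then have "0 \<in> (\<Union>c\<in>link_cells. cell_locus c)" by force
    also have "\<dots> = fst ` link C A"
      using decomposition by (simp add: cell_decomposition_def)
    finally obtain p where "p \<in> link C A" "fst p = 0" by auto
    then show False using link_over_0E \<open>A = {}\<close> by blast
  qed
  then show ?thesis by (auto simp: origin_gens_def generators_def)
qed

lemma doubled_imp_Vertex_0: "doubled (link C A) \<noteq> {} \<Longrightarrow> Vertex 0 \<in> link_cells"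
proof -
  assume "doubled (link C A) \<noteq> {}"
  then obtain p where "p \<in> link C A" "fst p = 0" unfolding doubled_def by blast
  then have "A \<noteq> {}" using link_over_0E by blast
  then show ?thesis
    using decomposition by (auto simp: cell_decomposition_def cells_of_def)
qed

end

theorem proposition5p2:
  fixes C A :: "(real \<Rightarrow> jet1) set" and V :: "real set" and \<mu> :: "jet2 \<Rightarrow> int"
  assumes "front_spinnable C A"
    and "cell_decomposition C A V"
    and "maslov_potential (surface_maslov_number C A) (front_spin C A)
           (surface_singular_set C A) \<mu>"
  shows
    "(A = {} \<longrightarrow>
        fdga_iso (surface_maslov_number C A) spin_gen
          (suspension (link_dga C A V \<mu>)) (surface_dga C A V \<mu> [])) \<and>
     (A \<noteq> {} \<and> doubled (link C A) = {} \<longrightarrow>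
        fdga_iso (surface_maslov_number C A) spin_gen
          (relative_suspension (origin_gens C A V) (link_dga C A V \<mu>))
          (surface_dga C A V \<mu> [])) \<and>
     (A \<noteq> {} \<and> doubled (link C A) \<noteq> {} \<longrightarrow>
        (\<forall>ks. distinct ks \<and> set ks = joined_pairs (link_complex C A V) (Vertex 0) \<longrightarrow>
           (let ks' = map (map_prod (spin UNIV) (spin UNIV)) ks in
             distinct ks' \<and>
             set ks' = joined_pairs (surface_complex C A V) (Radial (Vertex 0)) \<and>
             fdga_iso (surface_maslov_number C A) spin_gen
               (modified_suspension (origin_gens C A V) (U_correction C A V ks)
                  (link_dga C A V \<mu>))
               (surface_dga C A V \<mu> ks'))))"
proof -
  interpret decomposed_front C A V
    using assms(1,2) by unfold_locales
  note iso = surface_dga_iso_modified_suspension[OF assms(3)]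
  have smooth: "fdga_iso (surface_maslov_number C A) spin_gen
      (relative_suspension (origin_gens C A V) (link_dga C A V \<mu>)) (surface_dga C A V \<mu> [])"
    if d: "doubled (link C A) = {}"
    unfolding relative_suspension_def
  proof (rule iso)
    fix u P Q
    assume e: "Edge u 0 \<in> cells_of C A V" and PQ: "P \<in> sheets X (Edge u 0)" "Q \<in> sheets X (Edge u 0)"
    note inj = bij_betw_imp_inj_on[OF bij_rotated_sheet[OF e cell.distinct(2)]]
    show "reindex (spin {0<..<2 * pi}) (if doubled (front_spin C A) = {} then mat_id
         else pull_mat Y (Radial (Vertex 0)) (U_mat Y (Radial (Vertex 0)) [])) P Q =
       mat_id P Q + hat_der (\<lambda>_. 0) (vertex_mat X (Edge u 0) (Vertex 0) P Q)"
      using d doubled_front_spin_iff by (simp add: inner_edge_smooth_origin reindex_mat_id[OF inj PQ])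
  qed
  have no_arcs: "doubled (link C A) = {} \<and> origin_gens C A V = {}" if "A = {}"
    using that origin_gens_empty link_over_0E unfolding doubled_def by blast
  show ?thesis
  proof (intro conjI impI allI)
    assume "A = {}"
    then show "fdga_iso (surface_maslov_number C A) spin_gen
        (suspension (link_dga C A V \<mu>)) (surface_dga C A V \<mu> [])"
      using smooth no_arcs by (simp add: suspension_def)
  next
    assume "A \<noteq> {} \<and> doubled (link C A) = {}"
    then show "fdga_iso (surface_maslov_number C A) spin_gen
        (relative_suspension (origin_gens C A V) (link_dga C A V \<mu>)) (surface_dga C A V \<mu> [])"
      using smooth by simp
  next
    fix ks
    assume d: "A \<noteq> {} \<and> doubled (link C A) \<noteq> {}"
      and ks: "distinct ks \<and> set ks = joined_pairs (link_complex C A V) (Vertex 0)"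
    let ?ks = "map (map_prod (spin UNIV) (spin UNIV)) ks"
    have d': "doubled (link C A) \<noteq> {}" using d by simp
    have v: "Vertex 0 \<in> cells_of C A V" using doubled_imp_Vertex_0[OF d'] .
    have "fdga_iso (surface_maslov_number C A) spin_gen
       (modified_suspension (origin_gens C A V) (U_correction C A V ks) (link_dga C A V \<mu>))
       (surface_dga C A V \<mu> ?ks)"
    proof (rule iso)
      fix u P Q
      assume e: "Edge u 0 \<in> cells_of C A V" and PQ: "P \<in> sheets X (Edge u 0)" "Q \<in> sheets X (Edge u 0)"
      have "set ks \<subseteq> joined_pairs X (Vertex 0)" using ks by simp
      from inner_edge_cone_points[OF e d' this PQ]
      show "reindex (spin {0<..<2 * pi}) (if doubled (front_spin C A) = {} then mat_id
           else pull_mat Y (Radial (Vertex 0)) (U_mat Y (Radial (Vertex 0)) ?ks)) P Q =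
         mat_id P Q + hat_der (U_correction C A V ks) (vertex_mat X (Edge u 0) (Vertex 0) P Q)"
        using d' doubled_front_spin_iff by simp
    qed
    moreover have "distinct ?ks" "set ?ks = joined_pairs (surface_complex C A V) (Radial (Vertex 0))"
      using joined_pairs_spun[OF v] ks by (simp_all add: distinct_map)
    ultimately show "let ks' = map (map_prod (spin UNIV) (spin UNIV)) ks in
             distinct ks' \<and>
             set ks' = joined_pairs (surface_complex C A V) (Radial (Vertex 0)) \<and>
             fdga_iso (surface_maslov_number C A) spin_gen
               (modified_suspension (origin_gens C A V) (U_correction C A V ks)
                  (link_dga C A V \<mu>))
               (surface_dga C A V \<mu> ks')"
      by (simp add: Let_def)
  qed
qed

end
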